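(* Assume that either $0<S^-_\phi\le S^+_\phi<1$ or $1<S^-_\phi\le S^+_\phi<+\infty$. Assume that, in the scalar case (respectively, in the incompressible vector-valued case), $F$ is a continuous linear functional as described in the context, i.e. it admits a continuous extension to a bounded linear functional on $H^1_0(\Omega)$ (respectively, on $H^1_0(\Omega;\mathbb{R}^d)$). Then, for every $\epsilon\in(0,1)$, the functional $\mathcal{E}_\epsilon: L^\Phi(\Omega)\to(-\infty,+\infty]$ (in the scalar case and in the incompressible vector-valued case, respectively) is lower semicontinuous with respect to the topology induced by the metric $d(\cdot,\cdot)$ on $L^\Phi(\Omega)$.
   Context: $\Omega\subset\mathbb{R}^d$, $d=2,3$ (here $d$ is the dimension), is an open bounded domain. $\phi:[0,+\infty)\to[0,+\infty)$ is an N-function: convex, continuous, $\phi(0)=0$, $\phi(r)>0$ for $r>0$, $\lim_{r\to0}\phi(r)/r=0$, $\lim_{r\to+\infty}\phi(r)/r=+\infty$. Standing assumptions: $\phi\in C^1([0,+\infty))\cap C^3((0,+\infty))$; $\inf_{r>0}\frac{r\phi'(r)}{\phi(r)}>1$ and $\sup_{r>0}\frac{r\phi'(r)}{\phi(r)}<+\infty$. Set $\Phi(r):=\phi(\sqrt r)$ and $\mu(r):=2\Phi'(r)=\phi'(\sqrt r)/\sqrt r$; it is assumed throughout that $\Phi$ is either strictly convex ($\mu'(r)>0$ for all $r>0$) or strictly concave ($\mu'(r)<0$ for all $r>0$) on $(0,+\infty)$. Put $\omega:=1$ if $\Phi$ is convex and $\omega:=-1$ if $\Phi$ is concave. Define $$S^-_\phi:=\inf_{r>0}\frac{r\phi''(r)}{\phi'(r)},\qquad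 S^+_\phi:=\sup_{r>0}\frac{r\phi''(r)}{\phi'(r)}.$$ $L^\phi(\Omega)$ and $W^{1,\phi}(\Omega)$ are the Orlicz and Orlicz--Sobolev spaces of $\phi$; $W^{1,\phi}_0(\Omega)$ is the closure of $C_c^\infty(\Omega)$ in $W^{1,\phi}(\Omega)$. Metric space: $L^\Phi(\Omega):=\{c:\Omega\to\mathbb{R}\text{ measurable}: \sqrt{|c|}\in L^\phi(\Omega)\}$ (equivalently $\int_\Omega\Phi(|c|)\,dx<+\infty$). Let $\psi(r):=\mathrm{sgn}(r)\int_0^{|r|}\sqrt{\tfrac{\omega}{2}\mu'(s)}\,ds$, $\Psi(c)(x):=\psi(c(x))$, which maps $L^\Phi(\Omega)$ bijectively onto $L^2(\Omega)$, and $d(c_0,c_1):=\|\Psi(c_1)-\Psi(c_0)\|_{L^2(\Omega)}$. For $\epsilon\in(0,1)$, $L^\Phi_\epsilon(\Omega):=\{c\in L^\Phi(\Omega):\epsilon\le c(x)\le 1/\epsilon\text{ a.e. in }\Omega\}$. Let $\mathcal{J}_c(c):=\int_\Omega \Phi(c)-\tfrac12\mu(c)c\,dx$. Scalar case: $F\in W^{1,\phi}_0(\Omega)^*$ admits a continuous extension to a bounded linear functional on $H^1_0(\Omega)$, still denoted $F$ (when $\Phi$ is concave, $H^1_0(\Omega)\hookrightarrow W^{1,\phi}_0(\Omega)$ and this is the restriction), and for $c\in L^\Phi_\epsilon(\Omega)$ $$\mathcal{J}(c):=\inf_{u\in H^1_0(\Omega)}\Big(\int_\Omega\tfrac12\mu(c)|\nabla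 u|^2\,dx-F(u)\Big).$$ Incompressible vector-valued case: $F\in W^{1,\phi}_0(\Omega;\mathbb{R}^d)^*$ admits a continuous extension to a bounded linear functional on $H^1_0(\Omega;\mathbb{R}^d)$ (same convention), $\varepsilon(\boldsymbol u):=\tfrac12(\nabla\boldsymbol u+\nabla\boldsymbol u^{T})$, $H^1_{0,\mathrm{div}}(\Omega;\mathbb{R}^d):=\{\boldsymbol v\in H^1_0(\Omega;\mathbb{R}^d):\nabla\cdot\boldsymbol v=0\}$, and for $c\in L^\Phi_\epsilon(\Omega)$ $$\mathcal{J}(c):=\inf_{\boldsymbol u\in H^1_{0,\mathrm{div}}(\Omega;\mathbb{R}^d)}\Big(\int_\Omega\tfrac12\mu(c)|\varepsilon(\boldsymbol u)|^2\,dx-F(\boldsymbol u)\Big).$$ In either case, $\mathcal{E}_\epsilon(c):=-\omega\mathcal{J}_c(c)-\omega\mathcal{J}(c)$ if $c\in L^\Phi_\epsilon(\Omega)$, and $\mathcal{E}_\epsilon(c):=+\infty$ for $c\in L^\Phi(\Omega)\setminus L^\Phi_\epsilon(\Omega)$. *)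

theory Defs
  imports "HOL-Analysis.Analysis"
begin

text \<open>
  Elements of the function spaces are represented by functions on the whole of \<open>real ^ 'n\<close>
  (not by equivalence classes); every notion below depends only on their restriction to
  \<open>\<Omega>\<close>, and norms, metrics and functionals on them are insensitive to changes on null sets.
\<close>

section \<open>N-functions\<close>

definition N_function :: "(real \<Rightarrow> real) \<Rightarrow> bool" where
  "N_function \<phi> \<longleftrightarrow> convex_on {0..} \<phi> \<and> continuous_on {0..} \<phi> \<and> \<phi> 0 = 0 \<and> (\<forall>r>0. 0 < \<phi> r) \<and>
     ((\<lambda>r. \<phi> r / r) \<longlongrightarrow> 0) (at_right 0) \<and> filterlim (\<lambda>r. \<phi> r / r) at_top at_top"

text \<open>
  The class \<open>C\<^sup>1([0,\<infinity>)) \<inter> C\<^sup>3((0,\<infinity>))\<close>; the derivative at \<open>0\<close> is one-sided, and the values of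
  \<open>\<phi>\<close> at negative arguments play no role.
\<close>

definition C1_C3 :: "(real \<Rightarrow> real) \<Rightarrow> bool" where
  "C1_C3 \<phi> \<longleftrightarrow>
     (\<exists>\<phi>'. continuous_on {0..} \<phi>' \<and> (\<forall>r\<ge>0. (\<phi> has_real_derivative \<phi>' r) (at r within {0..}))) \<and>
     (\<forall>k<3. \<forall>r>0. (deriv ^^ k) \<phi> differentiable (at r)) \<and>
     continuous_on {0<..} ((deriv ^^ 3) \<phi>)"

definition Phi :: "(real \<Rightarrow> real) \<Rightarrow> real \<Rightarrow> real" where
  "Phi \<phi> r = \<phi> (sqrt r)"

text \<open>Only the values of \<open>mu\<close> on \<open>(0,\<infinity>)\<close> are meaningful.\<close>

definition mu :: "(real \<Rightarrow> real) \<Rightarrow> real \<Rightarrow> real" where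
  "mu \<phi> r = 2 * deriv (Phi \<phi>) r"

definition omega :: "(real \<Rightarrow> real) \<Rightarrow> real" where
  "omega \<phi> = (if convex_on {0<..} (Phi \<phi>) then 1 else - 1)"

definition standing_assumptions :: "(real \<Rightarrow> real) \<Rightarrow> bool" where
  "standing_assumptions \<phi> \<longleftrightarrow> N_function \<phi> \<and> C1_C3 \<phi> \<and>
     1 < (INF r\<in>{0<..}. ereal (r * deriv \<phi> r / \<phi> r)) \<and>
     (SUP r\<in>{0<..}. ereal (r * deriv \<phi> r / \<phi> r)) < \<infinity> \<and>
     ((\<forall>r>0. 0 < deriv (mu \<phi>) r) \<or> (\<forall>r>0. deriv (mu \<phi>) r < 0))"

definition S_minus :: "(real \<Rightarrow> real) \<Rightarrow> ereal" where
  "S_minus \<phi> = (INF r\<in>{0<..}. ereal (r * (deriv ^^ 2) \<phi> r / deriv \<phi> r))"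

definition S_plus :: "(real \<Rightarrow> real) \<Rightarrow> ereal" where
  "S_plus \<phi> = (SUP r\<in>{0<..}. ereal (r * (deriv ^^ 2) \<phi> r / deriv \<phi> r))"

section \<open>Test functions and weak derivatives\<close>

definition partial :: "'n::finite \<Rightarrow> (real ^ 'n \<Rightarrow> 'b::real_normed_vector) \<Rightarrow> real ^ 'n \<Rightarrow> 'b" where
  "partial i f x = frechet_derivative f (at x) (axis i 1)"

primrec Ck :: "nat \<Rightarrow> (real ^ 'n::finite \<Rightarrow> 'b::real_normed_vector) \<Rightarrow> bool" where
  "Ck 0 f \<longleftrightarrow> continuous_on UNIV f"
| "Ck (Suc k) f \<longleftrightarrow> (\<forall>x. f differentiable (at x)) \<and> (\<forall>i. Ck k (partial i f))"

definition Cc_infinity :: "(real ^ 'n::finite) set \<Rightarrow> (real ^ 'n \<Rightarrow> 'b::real_normed_vector) set" where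
  "Cc_infinity \<Omega> = {f. (\<forall>k. Ck k f) \<and> compact (closure {x. f x \<noteq> 0}) \<and> closure {x. f x \<noteq> 0} \<subseteq> \<Omega>}"

definition locally_integrable :: "(real ^ 'n::finite) set \<Rightarrow> (real ^ 'n \<Rightarrow> 'b::euclidean_space) \<Rightarrow> bool" where
  "locally_integrable \<Omega> f \<longleftrightarrow> (\<forall>K. compact K \<longrightarrow> K \<subseteq> \<Omega> \<longrightarrow> integrable (lebesgue_on K) f)"

text \<open>
  The \<open>i\<close>-th component of the weak gradient is the weak \<open>i\<close>-th partial derivative. For scalar \<open>u\<close>
  this is a function into \<open>real ^ 'n\<close>. For \<open>u\<close> with values in \<open>real ^ 'n\<close> it is matrix-valued, with
  \<open>g x $ i $ j\<close> the derivative of \<open>u\<^sub>j\<close> in direction \<open>i\<close>; the norm on \<open>real ^ 'n ^ 'n\<close> is the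
  Frobenius norm.
\<close>

definition is_weak_grad ::
  "(real ^ 'n::finite) set \<Rightarrow> (real ^ 'n \<Rightarrow> 'b::euclidean_space) \<Rightarrow> (real ^ 'n \<Rightarrow> 'b ^ 'n) \<Rightarrow> bool" where
  "is_weak_grad \<Omega> u g \<longleftrightarrow> locally_integrable \<Omega> u \<and> locally_integrable \<Omega> g \<and>
     (\<forall>\<eta>::real ^ 'n \<Rightarrow> real. \<eta> \<in> Cc_infinity \<Omega> \<longrightarrow>
        (\<forall>i. (LINT x|lebesgue_on \<Omega>. partial i \<eta> x *\<^sub>R u x) =
             - (LINT x|lebesgue_on \<Omega>. \<eta> x *\<^sub>R (g x $ i))))"

text \<open>Weak gradients are unique up to null sets of \<open>\<Omega>\<close>, so the choice is immaterial.\<close>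

definition wgrad ::
  "(real ^ 'n::finite) set \<Rightarrow> (real ^ 'n \<Rightarrow> 'b::euclidean_space) \<Rightarrow> real ^ 'n \<Rightarrow> 'b ^ 'n" where
  "wgrad \<Omega> u = (SOME g. is_weak_grad \<Omega> u g)"

definition sym_grad ::
  "(real ^ 'n::finite) set \<Rightarrow> (real ^ 'n \<Rightarrow> real ^ 'n) \<Rightarrow> real ^ 'n \<Rightarrow> real ^ 'n ^ 'n" where
  "sym_grad \<Omega> u x = (1/2) *\<^sub>R (wgrad \<Omega> u x + transpose (wgrad \<Omega> u x))"

definition wdiv :: "(real ^ 'n::finite) set \<Rightarrow> (real ^ 'n \<Rightarrow> real ^ 'n) \<Rightarrow> real ^ 'n \<Rightarrow> real" where
  "wdiv \<Omega> u x = trace (wgrad \<Omega> u x)"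

section \<open>Function spaces\<close>

definition norm_closure ::
  "(('a \<Rightarrow> 'b::real_normed_vector) \<Rightarrow> real) \<Rightarrow> ('a \<Rightarrow> 'b) set \<Rightarrow> ('a \<Rightarrow> 'b) set \<Rightarrow> ('a \<Rightarrow> 'b) set" where
  "norm_closure N V A = {u \<in> V. \<forall>e>0. \<exists>v\<in>A. N (\<lambda>x. u x - v x) < e}"

definition dual_space ::
  "('a \<Rightarrow> 'b::real_normed_vector) set \<Rightarrow> (('a \<Rightarrow> 'b) \<Rightarrow> real) \<Rightarrow> (('a \<Rightarrow> 'b) \<Rightarrow> real) set" where
  "dual_space V N = {F.
     (\<forall>u\<in>V. \<forall>v\<in>V. F (\<lambda>x. u x + v x) = F u + F v) \<and>
     (\<forall>a. \<forall>u\<in>V. F (\<lambda>x. a *\<^sub>R u x) = a * F u) \<and>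
     (\<exists>C. \<forall>u\<in>V. \<bar>F u\<bar> \<le> C * N u)}"

definition Orlicz ::
  "(real \<Rightarrow> real) \<Rightarrow> (real ^ 'n::finite) set \<Rightarrow> (real ^ 'n \<Rightarrow> 'b::euclidean_space) set" where
  "Orlicz \<phi> \<Omega> = {u \<in> borel_measurable (lebesgue_on \<Omega>).
     \<exists>k>0. (\<integral>\<^sup>+ x. ennreal (\<phi> (norm (u x) / k)) \<partial>lebesgue_on \<Omega>) < \<infinity>}"

text \<open>The Luxemburg norm.\<close>

definition Orlicz_norm ::
  "(real \<Rightarrow> real) \<Rightarrow> (real ^ 'n::finite) set \<Rightarrow> (real ^ 'n \<Rightarrow> 'b::euclidean_space) \<Rightarrow> real" where
  "Orlicz_norm \<phi> \<Omega> u =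
     Inf {k. 0 < k \<and> (\<integral>\<^sup>+ x. ennreal (\<phi> (norm (u x) / k)) \<partial>lebesgue_on \<Omega>) \<le> 1}"

definition W1 ::
  "(real \<Rightarrow> real) \<Rightarrow> (real ^ 'n::finite) set \<Rightarrow> (real ^ 'n \<Rightarrow> 'b::euclidean_space) set" where
  "W1 \<phi> \<Omega> = {u \<in> Orlicz \<phi> \<Omega>. \<exists>g \<in> Orlicz \<phi> \<Omega>. is_weak_grad \<Omega> u g}"

definition W1_norm ::
  "(real \<Rightarrow> real) \<Rightarrow> (real ^ 'n::finite) set \<Rightarrow> (real ^ 'n \<Rightarrow> 'b::euclidean_space) \<Rightarrow> real" where
  "W1_norm \<phi> \<Omega> u = Orlicz_norm \<phi> \<Omega> u + Orlicz_norm \<phi> \<Omega> (wgrad \<Omega> u)"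

definition W10 ::
  "(real \<Rightarrow> real) \<Rightarrow> (real ^ 'n::finite) set \<Rightarrow> (real ^ 'n \<Rightarrow> 'b::euclidean_space) set" where
  "W10 \<phi> \<Omega> = norm_closure (W1_norm \<phi> \<Omega>) (W1 \<phi> \<Omega>) (Cc_infinity \<Omega>)"

definition L2 :: "(real ^ 'n::finite) set \<Rightarrow> (real ^ 'n \<Rightarrow> 'b::euclidean_space) set" where
  "L2 \<Omega> = {u \<in> borel_measurable (lebesgue_on \<Omega>). integrable (lebesgue_on \<Omega>) (\<lambda>x. (norm (u x))\<^sup>2)}"

definition L2_norm :: "(real ^ 'n::finite) set \<Rightarrow> (real ^ 'n \<Rightarrow> 'b::euclidean_space) \<Rightarrow> real" where
  "L2_norm \<Omega> u = sqrt (LINT x|lebesgue_on \<Omega>. (norm (u x))\<^sup>2)"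

definition H1 :: "(real ^ 'n::finite) set \<Rightarrow> (real ^ 'n \<Rightarrow> 'b::euclidean_space) set" where
  "H1 \<Omega> = {u \<in> L2 \<Omega>. \<exists>g \<in> L2 \<Omega>. is_weak_grad \<Omega> u g}"

definition H1_norm :: "(real ^ 'n::finite) set \<Rightarrow> (real ^ 'n \<Rightarrow> 'b::euclidean_space) \<Rightarrow> real" where
  "H1_norm \<Omega> u = sqrt ((L2_norm \<Omega> u)\<^sup>2 + (L2_norm \<Omega> (wgrad \<Omega> u))\<^sup>2)"

definition H10 :: "(real ^ 'n::finite) set \<Rightarrow> (real ^ 'n \<Rightarrow> 'b::euclidean_space) set" where
  "H10 \<Omega> = norm_closure (H1_norm \<Omega>) (H1 \<Omega>) (Cc_infinity \<Omega>)"

definition H10_div :: "(real ^ 'n::finite) set \<Rightarrow> (real ^ 'n \<Rightarrow> real ^ 'n) set" where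
  "H10_div \<Omega> = {u \<in> H10 \<Omega>. AE x in lebesgue_on \<Omega>. wdiv \<Omega> u x = 0}"

text \<open>
  One of \<open>W10 \<phi> \<Omega>\<close> and \<open>H10 \<Omega>\<close> contains the other: if \<open>Phi \<phi>\<close> is convex, then \<open>W10 \<phi> \<Omega> \<subseteq> H10 \<Omega>\<close>
  and \<open>G\<close> extends \<open>F\<close>; if it is concave, then \<open>H10 \<Omega> \<subseteq> W10 \<phi> \<Omega>\<close> and \<open>G\<close> is the restriction of \<open>F\<close>.
\<close>

definition is_H10_extension ::
  "(real \<Rightarrow> real) \<Rightarrow> (real ^ 'n::finite) set \<Rightarrow> ((real ^ 'n \<Rightarrow> 'b::euclidean_space) \<Rightarrow> real) \<Rightarrow>
   ((real ^ 'n \<Rightarrow> 'b) \<Rightarrow> real) \<Rightarrow> bool" where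
  "is_H10_extension \<phi> \<Omega> F G \<longleftrightarrow>
     G \<in> dual_space (H10 \<Omega>) (H1_norm \<Omega>) \<and> (\<forall>u \<in> W10 \<phi> \<Omega> \<inter> H10 \<Omega>. G u = F u)"

section \<open>The metric space\<close>

definition LPhi :: "(real \<Rightarrow> real) \<Rightarrow> (real ^ 'n::finite) set \<Rightarrow> (real ^ 'n \<Rightarrow> real) set" where
  "LPhi \<phi> \<Omega> = {c \<in> borel_measurable (lebesgue_on \<Omega>). (\<lambda>x. sqrt \<bar>c x\<bar>) \<in> Orlicz \<phi> \<Omega>}"

definition psi :: "(real \<Rightarrow> real) \<Rightarrow> real \<Rightarrow> real" where
  "psi \<phi> r = sgn r * integral {0..\<bar>r\<bar>} (\<lambda>s. sqrt (omega \<phi> / 2 * deriv (mu \<phi>) s))"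

definition dist_Phi ::
  "(real \<Rightarrow> real) \<Rightarrow> (real ^ 'n::finite) set \<Rightarrow> (real ^ 'n \<Rightarrow> real) \<Rightarrow> (real ^ 'n \<Rightarrow> real) \<Rightarrow> real" where
  "dist_Phi \<phi> \<Omega> c\<^sub>0 c\<^sub>1 = L2_norm \<Omega> (\<lambda>x. psi \<phi> (c\<^sub>1 x) - psi \<phi> (c\<^sub>0 x))"

text \<open>
  On representatives, \<open>dist_Phi\<close> is only a pseudometric (it vanishes exactly for functions that
  agree almost everywhere), so the locale \<open>Metric_space\<close> does not apply. The topology it induces
  is introduced directly.
\<close>

definition dist_topology :: "'a set \<Rightarrow> ('a \<Rightarrow> 'a \<Rightarrow> real) \<Rightarrow> 'a topology" where
  "dist_topology M d = topology (\<lambda>U. U \<subseteq> M \<and> (\<forall>x\<in>U. \<exists>r>0. {y \<in> M. d x y < r} \<subseteq> U))"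

lemma openin_dist_topology:
  "openin (dist_topology M d) U \<longleftrightarrow> U \<subseteq> M \<and> (\<forall>x\<in>U. \<exists>r>0. {y \<in> M. d x y < r} \<subseteq> U)"
proof -
  have "istopology (\<lambda>U. U \<subseteq> M \<and> (\<forall>x\<in>U. \<exists>r>0. {y \<in> M. d x y < r} \<subseteq> U))"
    unfolding istopology_def
  proof (intro conjI allI impI ballI)
    fix S T x
    assume S: "S \<subseteq> M \<and> (\<forall>x\<in>S. \<exists>r>0. {y \<in> M. d x y < r} \<subseteq> S)"
      and T: "T \<subseteq> M \<and> (\<forall>x\<in>T. \<exists>r>0. {y \<in> M. d x y < r} \<subseteq> T)" and x: "x \<in> S \<inter> T"
    from S x obtain r where r: "r > 0" "{y \<in> M. d x y < r} \<subseteq> S" by blast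
    from T x obtain s where s: "s > 0" "{y \<in> M. d x y < s} \<subseteq> T" by blast
    have "{y \<in> M. d x y < min r s} \<subseteq> S \<inter> T" using r s by auto
    then show "\<exists>r>0. {y \<in> M. d x y < r} \<subseteq> S \<inter> T" using r s by (metis min_less_iff_conj)
  next
    fix K x
    assume K: "\<forall>S\<in>K. S \<subseteq> M \<and> (\<forall>x\<in>S. \<exists>r>0. {y \<in> M. d x y < r} \<subseteq> S)" and "x \<in> \<Union>K"
    then obtain S r where "S \<in> K" "r > 0" "{y \<in> M. d x y < r} \<subseteq> S" by blast
    then show "\<exists>r>0. {y \<in> M. d x y < r} \<subseteq> \<Union>K" by blast
  qed blast+
  then show ?thesis
    unfolding dist_topology_def by (simp add: topology_inverse')
qed

lemma topspace_dist_topology [simp]: "topspace (dist_topology M d) = M"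
proof -
  have "openin (dist_topology M d) M"
    by (auto simp: openin_dist_topology intro: exI[of _ 1])
  then show ?thesis
    by (metis openin_dist_topology openin_subset openin_topspace subset_antisym)
qed

definition lower_semicontinuous_map :: "'a topology \<Rightarrow> ('a \<Rightarrow> ereal) \<Rightarrow> bool" where
  "lower_semicontinuous_map X f \<longleftrightarrow> (\<forall>a. openin X {x \<in> topspace X. a < f x})"

section \<open>The energies\<close>

definition LPhi_eps :: "(real \<Rightarrow> real) \<Rightarrow> (real ^ 'n::finite) set \<Rightarrow> real \<Rightarrow> (real ^ 'n \<Rightarrow> real) set" where
  "LPhi_eps \<phi> \<Omega> \<epsilon> = {c \<in> LPhi \<phi> \<Omega>. AE x in lebesgue_on \<Omega>. \<epsilon> \<le> c x \<and> c x \<le> 1 / \<epsilon>}"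

definition J_c :: "(real \<Rightarrow> real) \<Rightarrow> (real ^ 'n::finite) set \<Rightarrow> (real ^ 'n \<Rightarrow> real) \<Rightarrow> real" where
  "J_c \<phi> \<Omega> c = (LINT x|lebesgue_on \<Omega>. Phi \<phi> (c x) - 1/2 * mu \<phi> (c x) * c x)"

text \<open>
  The infima are taken in the extended reals, so that they cannot take an arbitrary value in case
  the functional should be unbounded below.
\<close>

definition J_scalar ::
  "(real \<Rightarrow> real) \<Rightarrow> (real ^ 'n::finite) set \<Rightarrow> ((real ^ 'n \<Rightarrow> real) \<Rightarrow> real) \<Rightarrow> (real ^ 'n \<Rightarrow> real) \<Rightarrow> ereal" where
  "J_scalar \<phi> \<Omega> F c = (INF u\<in>H10 \<Omega>.
     ereal ((LINT x|lebesgue_on \<Omega>. 1/2 * mu \<phi> (c x) * (norm (wgrad \<Omega> u x))\<^sup>2) - F u))"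

definition J_incompressible ::
  "(real \<Rightarrow> real) \<Rightarrow> (real ^ 'n::finite) set \<Rightarrow> ((real ^ 'n \<Rightarrow> real ^ 'n) \<Rightarrow> real) \<Rightarrow> (real ^ 'n \<Rightarrow> real) \<Rightarrow> ereal" where
  "J_incompressible \<phi> \<Omega> F c = (INF u\<in>H10_div \<Omega>.
     ereal ((LINT x|lebesgue_on \<Omega>. 1/2 * mu \<phi> (c x) * (norm (sym_grad \<Omega> u x))\<^sup>2) - F u))"

definition E_eps ::
  "(real \<Rightarrow> real) \<Rightarrow> (real ^ 'n::finite) set \<Rightarrow> real \<Rightarrow> ((real ^ 'n \<Rightarrow> real) \<Rightarrow> ereal) \<Rightarrow>
   (real ^ 'n \<Rightarrow> real) \<Rightarrow> ereal" where
  "E_eps \<phi> \<Omega> \<epsilon> J c =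
     (if c \<in> LPhi_eps \<phi> \<Omega> \<epsilon> then ereal (- omega \<phi> * J_c \<phi> \<Omega> c) - ereal (omega \<phi>) * J c else \<infinity>)"

end

theory Submission
  imports Defs
begin

text \<open>
  Write \<open>w = mu \<phi> (c x)\<close>. Up to signs, the energy is the integral \<open>J_c\<close> plus the minimal value
  \<open>J = INF u. (\<integral> 1/2 * w * \<bar>D u\<bar>\<^sup>2) - G u\<close> of a quadratic functional with weight \<open>w\<close>, where \<open>D\<close>
  is the gradient or the symmetric gradient. If a sequence of admissible \<open>c\<close> converges in the metric,
  then a subsequence converges almost everywhere, because \<open>psi\<close> is strictly increasing and maps the
  space into square integrable functions (\<open>dist_Phi_AE_subseq\<close>). On the admissible set the weights lie
  between two positive constants, so dominated convergence shows that \<open>J_c\<close> is continuous. It remains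
  to see how \<open>J\<close> depends on the weight.

  If \<open>Phi\<close> is convex, then \<open>- J\<close> has to be lower semicontinuous. This is the easy direction: \<open>J\<close> is an
  infimum of functionals each of which is continuous in \<open>w\<close> (\<open>min_energy_upper_semicontinuous\<close>).

  If \<open>Phi\<close> is concave, then \<open>J\<close> itself has to be lower semicontinuous
  (\<open>min_energy_lower_semicontinuous\<close>). Let \<open>u\<close> be an almost minimiser for the limit weight \<open>w\<close>. Its
  Euler-Lagrange equation holds up to a small error, and it replaces the linear term \<open>G v\<close> by
  \<open>\<integral> w * D u \<bullet> D v\<close>. For a nearby weight \<open>w'\<close> the functional \<open>\<integral> 1/2 * w' * \<bar>D v\<bar>\<^sup>2 - w * D u \<bullet> D v\<close>
  is minimised pointwise by completing the square, and it is at least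
  \<open>- \<integral> w\<^sup>2 / (2 * w') * \<bar>D u\<bar>\<^sup>2\<close>, whatever \<open>v\<close> is. This bound contains only \<open>u\<close> and the weights, and as \<open>w'\<close> approaches
  \<open>w\<close> it tends to
  \<open>- \<integral> 1/2 * w * \<bar>D u\<bar>\<^sup>2\<close>, which is the minimal value for \<open>w\<close> up to the small error.

  That the energy is never \<open>- \<infinity>\<close> is the coercivity of the quadratic functional: on \<open>H10\<close> the functional
  \<open>G\<close> is bounded by the gradient (\<open>Poincare\<close>), and the gradient is bounded by the symmetric gradient
  (\<open>Korn\<close>). Both inequalities are integrations by parts for test functions and pass to the closure.
  To treat \<open>wgrad\<close> as a linear operator, weak gradients have to be unique almost everywhere, which rests
  on \<open>test_functions_separate\<close>.
\<close>
section \<open>Minimal energies of weighted quadratic functionals\<close>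

text \<open>
  The operator \<open>D\<close> is linear up to null sets only, as weak gradients are. A single linearity
  condition in terms of \<open>u + t v\<close> covers sums and multiples.
\<close>

locale quadratic_energy =
  fixes M :: "'x measure" and V :: "('x \<Rightarrow> 'v::real_vector) set"
    and D :: "('x \<Rightarrow> 'v) \<Rightarrow> 'x \<Rightarrow> 'b::euclidean_space" and G :: "('x \<Rightarrow> 'v) \<Rightarrow> real"
  assumes zero_mem: "(\<lambda>x. 0) \<in> V"
    and lin_mem: "\<And>u v t. u \<in> V \<Longrightarrow> v \<in> V \<Longrightarrow> (\<lambda>x. u x + t *\<^sub>R v x) \<in> V"
    and D_measurable [measurable]: "\<And>u. u \<in> V \<Longrightarrow> D u \<in> borel_measurable M"
    and D_square: "\<And>u. u \<in> V \<Longrightarrow> integrable M (\<lambda>x. (norm (D u x))\<^sup>2)"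
    and D_lin: "\<And>u v t. u \<in> V \<Longrightarrow> v \<in> V \<Longrightarrow>
      AE x in M. D (\<lambda>x. u x + t *\<^sub>R v x) x = D u x + t *\<^sub>R D v x"
    and G_lin: "\<And>u v t. u \<in> V \<Longrightarrow> v \<in> V \<Longrightarrow> G (\<lambda>x. u x + t *\<^sub>R v x) = G u + t * G v"
begin

definition energy :: "('x \<Rightarrow> real) \<Rightarrow> ('x \<Rightarrow> 'v) \<Rightarrow> real" where
  "energy w u = (LINT x|M. 1/2 * w x * (norm (D u x))\<^sup>2) - G u"

definition min_energy :: "('x \<Rightarrow> real) \<Rightarrow> ereal" where
  "min_energy w = (INF u\<in>V. ereal (energy w u))"

definition form :: "('x \<Rightarrow> real) \<Rightarrow> ('x \<Rightarrow> 'v) \<Rightarrow> ('x \<Rightarrow> 'v) \<Rightarrow> real" where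
  "form w u v = (LINT x|M. w x * (D u x \<bullet> D v x))"

definition weight :: "real \<Rightarrow> real \<Rightarrow> ('x \<Rightarrow> real) \<Rightarrow> bool" where
  "weight m K w \<longleftrightarrow> 0 < m \<and> w \<in> borel_measurable M \<and> (AE x in M. m \<le> w x \<and> w x \<le> K)"

lemma weightD:
  assumes "weight m K w"
  shows "0 < m" "w \<in> borel_measurable M" "AE x in M. 0 < w x \<and> m \<le> w x \<and> w x \<le> K"
  using assms by (auto simp: weight_def)

lemma G_zero: "G (\<lambda>x. 0) = 0"
  using G_lin[OF zero_mem zero_mem, of 1] by simp

lemma D_zero: "AE x in M. D (\<lambda>x. 0) x = 0"
  using D_lin[OF zero_mem zero_mem, of 1] by simp

text \<open>
  The zero function is a competitor of energy \<open>0\<close>; it keeps all infima below \<open>0\<close>.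
\<close>

lemma energy_zero: "energy w (\<lambda>x. 0) = 0"
proof -
  have "(LINT x|M. 1/2 * w x * (norm (D (\<lambda>x. 0) x))\<^sup>2) = 0"
    by (rule integral_eq_zero_AE) (use D_zero in auto)
  then show ?thesis by (simp add: energy_def G_zero)
qed

lemma min_energy_le_zero: "min_energy w \<le> 0"
  unfolding min_energy_def using INF_lower[OF zero_mem, of "\<lambda>u. ereal (energy w u)"] energy_zero
  by (simp add: zero_ereal_def)

lemma form_integrable:
  assumes w: "weight m K w" and u: "u \<in> V" and v: "v \<in> V"
  shows "integrable M (\<lambda>x. w x * (D u x \<bullet> D v x))"
proof (rule Bochner_Integration.integrable_bound)
  show "integrable M (\<lambda>x. K * ((norm (D u x))\<^sup>2 + (norm (D v x))\<^sup>2))"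
    using D_square u v by simp
  have [measurable]: "w \<in> borel_measurable M" using w by (simp add: weight_def)
  show "(\<lambda>x. w x * (D u x \<bullet> D v x)) \<in> borel_measurable M" using u v by measurable
  from weightD(3)[OF w] show "AE x in M. norm (w x * (D u x \<bullet> D v x)) \<le> norm (K * ((norm (D u x))\<^sup>2 + (norm (D v x))\<^sup>2))"
  proof eventually_elim
    case (elim x)
    have "\<bar>D u x \<bullet> D v x\<bar> \<le> norm (D u x) * norm (D v x)" by (rule Cauchy_Schwarz_ineq2)
    also have "\<dots> \<le> (norm (D u x))\<^sup>2 + (norm (D v x))\<^sup>2"
      using sum_squares_bound[of "norm (D u x)" "norm (D v x)"]
        mult_nonneg_nonneg[OF norm_ge_zero norm_ge_zero, of "D u x" "D v x"] by linarith
    finally show ?case using elim by (simp add: abs_mult mult_mono)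
  qed
qed

lemma energy_eq_form: "energy w u = 1/2 * form w u u - G u"
  unfolding energy_def form_def by (simp flip: Bochner_Integration.integral_mult_right_zero
      add: dot_square_norm mult.assoc)

lemma form_nonneg: "weight m K w \<Longrightarrow> 0 \<le> form w u u"
  unfolding form_def by (rule integral_nonneg_AE, rule eventually_mono[OF weightD(3)]) auto

lemma form_weight_ratio:
  assumes w: "weight m K w" and w': "weight m K w'" and u: "u \<in> V"
  shows "form w u u \<le> K / m * form w' u u"
proof -
  have "form w u u \<le> (LINT x|M. K / m * (w' x * (D u x \<bullet> D u x)))"
    unfolding form_def
  proof (rule integral_mono_AE)
    from weightD(3)[OF w] weightD(3)[OF w'] show "AE x in M. w x * (D u x \<bullet> D u x) \<le> K / m * (w' x * (D u x \<bullet> D u x))"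
    proof eventually_elim
      case (elim x)
      have "m > 0" using w by (simp add: weight_def)
      then have "w x \<le> K / m * w' x"
        using elim mult_mono[of "w x" K m "w' x"] by (simp add: field_simps)
      then show ?case using mult_right_mono[of "w x" "K / m * w' x" "D u x \<bullet> D u x"] by (simp add: mult.assoc)
    qed
  qed (use form_integrable w w' u in auto)
  then show ?thesis by (simp add: form_def)
qed

lemma energy_line:
  assumes w: "weight m K w" and u: "u \<in> V" and v: "v \<in> V"
  shows "energy w (\<lambda>x. u x + t *\<^sub>R v x) =
    energy w u + t * (form w u v - G v) + t\<^sup>2 / 2 * form w v v"
proof -
  have "form w (\<lambda>x. u x + t *\<^sub>R v x) (\<lambda>x. u x + t *\<^sub>R v x) =
    (LINT x|M. w x * (D u x \<bullet> D u x) + 2 * t * (w x * (D u x \<bullet> D v x)) + t\<^sup>2 * (w x * (D v x \<bullet> D v x)))"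
    unfolding form_def
  proof (rule integral_cong_AE)
    have [measurable]: "w \<in> borel_measurable M" using w by (simp add: weight_def)
    have [measurable]: "D u \<in> borel_measurable M" "D v \<in> borel_measurable M"
      "D (\<lambda>x. u x + t *\<^sub>R v x) \<in> borel_measurable M"
      using u v by (auto intro: D_measurable lin_mem)
    show "(\<lambda>x. w x * (D (\<lambda>x. u x + t *\<^sub>R v x) x \<bullet> D (\<lambda>x. u x + t *\<^sub>R v x) x)) \<in> borel_measurable M"
      by measurable
    show "(\<lambda>x. w x * (D u x \<bullet> D u x) + 2 * t * (w x * (D u x \<bullet> D v x)) + t\<^sup>2 * (w x * (D v x \<bullet> D v x)))
      \<in> borel_measurable M" by measurable
    show "AE x in M. w x * (D (\<lambda>x. u x + t *\<^sub>R v x) x \<bullet> D (\<lambda>x. u x + t *\<^sub>R v x) x) =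
      w x * (D u x \<bullet> D u x) + 2 * t * (w x * (D u x \<bullet> D v x)) + t\<^sup>2 * (w x * (D v x \<bullet> D v x))"
      using D_lin[OF u v, of t]
      by eventually_elim
        (simp add: inner_add_left inner_add_right inner_commute algebra_simps power2_eq_square)
  qed
  also have "\<dots> = form w u u + 2 * t * form w u v + t\<^sup>2 * form w v v"
    unfolding form_def using form_integrable[OF w] u v by simp
  finally show ?thesis
    unfolding energy_eq_form G_lin[OF u v] by (simp add: algebra_simps)
qed

text \<open>
  An approximate Euler-Lagrange equation. Along the line \<open>u + t v\<close> the energy is a parabola in \<open>t\<close>
  whose values stay above \<open>energy w u - s\<^sup>2\<close>; the parameters \<open>t = s\<close> and \<open>t = - s\<close> yield the two bounds.
\<close>

lemma almost_minimiser_variation: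
  assumes w: "weight m K w" and u: "u \<in> V" and v: "v \<in> V" and s: "0 < s"
    and min: "\<And>z. z \<in> V \<Longrightarrow> energy w u \<le> energy w z + s\<^sup>2"
  shows "\<bar>form w u v - G v\<bar> \<le> s + s / 2 * form w v v"
proof -
  define A where "A = form w u v - G v"
  have *: "0 \<le> s\<^sup>2 + t * A + t\<^sup>2 / 2 * form w v v" for t
    using min[OF lin_mem[OF u v, of t]] energy_line[OF w u v, of t] by (simp add: A_def)
  have "0 \<le> s\<^sup>2 - s * A + s\<^sup>2 / 2 * form w v v" "0 \<le> s\<^sup>2 + s * A + s\<^sup>2 / 2 * form w v v"
    using *[of s] *[of "-s"] by auto
  then have "0 \<le> s * (s - A + s / 2 * form w v v)" "0 \<le> s * (s + A + s / 2 * form w v v)"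
    by (auto simp: algebra_simps power2_eq_square)
  then have "0 \<le> s - A + s / 2 * form w v v" "0 \<le> s + A + s / 2 * form w v v"
    using s by (auto simp: zero_le_mult_iff)
  then show ?thesis unfolding A_def by linarith
qed

text \<open>
  Young's inequality absorbs the linear term into half of the quadratic term.
\<close>

lemma min_energy_gt_minus_infinity:
  assumes w: "weight m K w"
    and coercive: "\<And>u. u \<in> V \<Longrightarrow> (G u)\<^sup>2 \<le> C * (LINT x|M. (norm (D u x))\<^sup>2)"
  shows "min_energy w \<noteq> - \<infinity>"
proof -
  have m: "0 < m" using w by (simp add: weight_def)
  have "ereal (- max C 0 / (2 * m)) \<le> min_energy w"
    unfolding min_energy_def
  proof (rule INF_greatest)
    fix u assume u: "u \<in> V"
    define X where "X = (LINT x|M. (norm (D u x))\<^sup>2)"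
    have X: "0 \<le> X" by (simp add: X_def)
    have "m * X \<le> form w u u"
      unfolding X_def form_def Bochner_Integration.integral_mult_right_zero[symmetric]
      by (rule integral_mono_AE)
        (use form_integrable[OF w u u] D_square[OF u]
          in \<open>auto simp: dot_square_norm intro!: mult_right_mono eventually_mono[OF weightD(3)[OF w]]\<close>)
    moreover have "(G u)\<^sup>2 \<le> max C 0 * X"
      using coercive[OF u] mult_right_mono[of C "max C 0" X] X by (simp add: X_def)
    moreover have "G u \<le> m / 2 * X + max C 0 / (2 * m)"
    proof (rule power2_le_imp_le)
      have "max C 0 * X \<le> (m / 2 * X + max C 0 / (2 * m))\<^sup>2"
      proof -
        have "0 \<le> (m / 2 * X - max C 0 / (2 * m))\<^sup>2" by simp
        also have "\<dots> = (m / 2 * X + max C 0 / (2 * m))\<^sup>2 - 4 * (m / 2 * X) * (max C 0 / (2 * m))"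
          by (simp add: power2_eq_square algebra_simps)
        also have "4 * (m / 2 * X) * (max C 0 / (2 * m)) = max C 0 * X" using m by simp
        finally show ?thesis by simp
      qed
      then show "(G u)\<^sup>2 \<le> (m / 2 * X + max C 0 / (2 * m))\<^sup>2"
        using calculation by linarith
      show "0 \<le> m / 2 * X + max C 0 / (2 * m)" using m X by simp
    qed
    ultimately show "ereal (- max C 0 / (2 * m)) \<le> ereal (energy w u)"
      by (simp add: energy_eq_form)
  qed
  then show ?thesis by auto
qed

text \<open>
  For fixed \<open>u\<close> the energy is continuous in the weight by dominated convergence, and an infimum of
  continuous functionals is upper semicontinuous.
\<close>

lemma min_energy_upper_semicontinuous:
  assumes w: "weight m K w" and wn: "\<And>n::nat. weight m K (wn n)"
    and lim: "AE x in M. (\<lambda>n. wn n x) \<longlonglongrightarrow> w x"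
    and b: "b \<longlonglongrightarrow> b'" and le: "\<And>n. ereal (b n) \<le> min_energy (wn n)"
  shows "ereal b' \<le> min_energy w"
  unfolding min_energy_def
proof (rule INF_greatest)
  fix u assume u: "u \<in> V"
  have [measurable]: "w \<in> borel_measurable M" "\<And>n. wn n \<in> borel_measurable M"
    using w wn by (simp_all add: weight_def)
  have "(\<lambda>n. form (wn n) u u) \<longlonglongrightarrow> form w u u"
    unfolding form_def
  proof (rule integral_dominated_convergence)
    show "integrable M (\<lambda>x. K * (D u x \<bullet> D u x))"
      using D_square[OF u] by (simp add: dot_square_norm)
    show "AE x in M. (\<lambda>n. wn n x * (D u x \<bullet> D u x)) \<longlonglongrightarrow> w x * (D u x \<bullet> D u x)"
      using lim by eventually_elim (intro tendsto_intros)
    show "AE x in M. norm (wn n x * (D u x \<bullet> D u x)) \<le> K * (D u x \<bullet> D u x)" for n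
      by (rule eventually_mono[OF weightD(3)[OF wn[of n]]]) (auto simp: abs_mult intro!: mult_right_mono)
  qed (use u in measurable)
  then have "(\<lambda>n. energy (wn n) u) \<longlonglongrightarrow> energy w u"
    unfolding energy_eq_form by (intro tendsto_intros)
  moreover have "b n \<le> energy (wn n) u" for n
    using order_trans[OF le[of n] INF_lower[OF u, of "\<lambda>u. ereal (energy (wn n) u)", folded min_energy_def]]
    by simp
  ultimately show "ereal b' \<le> ereal (energy w u)"
    using LIMSEQ_le[OF b] by auto
qed

text \<open>
  Let \<open>j\<close> be the minimal energy for \<open>w\<close> and let \<open>u\<close> be minimal up to \<open>s\<^sup>2\<close>. By
  \<open>almost_minimiser_variation\<close> the energy of any \<open>v\<close> for the weight \<open>wn n\<close> is at least
  \<open>\<integral> l/2 * wn n * \<bar>D v\<bar>\<^sup>2 - w * D u \<bullet> D v\<close> minus \<open>s\<close>, where the error proportional to \<open>form w v v\<close> has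
  turned the factor \<open>1\<close> into \<open>l = 1 - s * \<kappa>\<close>. Completing the square pointwise removes \<open>v\<close>, and the
  limit in \<open>n\<close> can be taken under the integral. Finally \<open>s\<close> tends to \<open>0\<close>.
\<close>

lemma min_energy_lower_semicontinuous:
  assumes w: "weight m K w" and wn: "\<And>n::nat. weight m K (wn n)"
    and lim: "AE x in M. (\<lambda>n. wn n x) \<longlonglongrightarrow> w x"
    and b: "b \<longlonglongrightarrow> b'" and le: "\<And>n. min_energy (wn n) \<le> ereal (b n)"
  shows "min_energy w \<le> ereal b'"
proof (cases "min_energy w")
  case PInf
  then show ?thesis using min_energy_le_zero[of w] by auto
next
  case MInf
  then show ?thesis by simp
next
  case (real j)
  have m: "0 < m" using w by (simp add: weight_def)
  have [measurable]: "w \<in> borel_measurable M" "\<And>n. wn n \<in> borel_measurable M"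
    using w wn by (simp_all add: weight_def)
  \<comment> \<open>the factor that is lost when \<open>form w v v\<close> is estimated by \<open>form (wn n) v v\<close>\<close>
  define \<kappa> where "\<kappa> = \<bar>K / m\<bar>"
  have \<kappa>: "0 \<le> \<kappa>" by (simp add: \<kappa>_def)
  have j_le: "j \<le> energy w z" if "z \<in> V" for z
    using INF_lower[OF that, of "\<lambda>u. ereal (energy w u)"] real by (simp add: min_energy_def)
  have bound: "(j - s) / ((1 - s * \<kappa>) * (1 - s)) - s \<le> b'" if s: "0 < s" "s < 1" "s * \<kappa> < 1" for s
  proof -
    define l where "l = 1 - s * \<kappa>"
    have l: "0 < l" using s by (simp add: l_def)
    have "min_energy w < ereal (j + s\<^sup>2)" using real s by simp
    then obtain u where u: "u \<in> V" and "energy w u < j + s\<^sup>2"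
      unfolding min_energy_def INF_less_iff by auto
    then have "energy w u \<le> energy w z + s\<^sup>2" if "z \<in> V" for z
      using j_le[OF that] by linarith
    note var = almost_minimiser_variation[OF w u _ s(1) this]
    have low: "- (1 / (2 * l)) * (LINT x|M. (w x)\<^sup>2 / wn n x * (D u x \<bullet> D u x)) - s \<le> b n" for n
    proof -
      have int: "integrable M (\<lambda>x. (w x)\<^sup>2 / wn n x * (D u x \<bullet> D u x))"
      proof (rule Bochner_Integration.integrable_bound)
        show "integrable M (\<lambda>x. K\<^sup>2 / m * (D u x \<bullet> D u x))"
          using D_square[OF u] by (simp add: dot_square_norm)
        show "(\<lambda>x. (w x)\<^sup>2 / wn n x * (D u x \<bullet> D u x)) \<in> borel_measurable M" using u by measurable
        from weightD(3)[OF w] weightD(3)[OF wn[of n]] show "AE x in M. norm ((w x)\<^sup>2 / wn n x * (D u x \<bullet> D u x)) \<le> norm (K\<^sup>2 / m * (D u x \<bullet> D u x))"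
          by eventually_elim (use m in \<open>auto simp: abs_mult intro!: mult_right_mono frac_le power_mono\<close>)
      qed
      have "ereal (- (1 / (2 * l)) * (LINT x|M. (w x)\<^sup>2 / wn n x * (D u x \<bullet> D u x)) - s) \<le> min_energy (wn n)"
        unfolding min_energy_def
      proof (rule INF_greatest)
        fix v assume v: "v \<in> V"
        have "form w v v \<le> \<kappa> * form (wn n) v v"
          using form_weight_ratio[OF w wn[of n] v]
            mult_right_mono[OF abs_ge_self[of "K / m"] form_nonneg[OF wn[of n], of v]]
          unfolding \<kappa>_def by linarith
        then have "s / 2 * form w v v \<le> s / 2 * (\<kappa> * form (wn n) v v)"
          using s by (simp add: mult_left_mono)
        then have 1: "G v \<le> form w u v + s + s * \<kappa> / 2 * form (wn n) v v"
          using var[OF v] by (simp add: abs_le_iff)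
        have "- (1 / (2 * l)) * (LINT x|M. (w x)\<^sup>2 / wn n x * (D u x \<bullet> D u x)) =
           (LINT x|M. - (1 / (2 * l)) * ((w x)\<^sup>2 / wn n x * (D u x \<bullet> D u x)))"
          by (rule Bochner_Integration.integral_mult_right_zero[symmetric])
        also have "\<dots> \<le> (LINT x|M. l / 2 * (wn n x * (D v x \<bullet> D v x)) - w x * (D u x \<bullet> D v x))"
        proof (rule integral_mono_AE)
          from weightD(3)[OF wn[of n]] show "AE x in M. - (1 / (2 * l)) * ((w x)\<^sup>2 / wn n x * (D u x \<bullet> D u x))
            \<le> l / 2 * (wn n x * (D v x \<bullet> D v x)) - w x * (D u x \<bullet> D v x)"
          proof eventually_elim
            case (elim x)
            \<comment> \<open>\<open>z\<close> vanishes where \<open>D v x\<close> minimises the right-hand side\<close>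
            define z where "z = (l * wn n x) *\<^sub>R D v x - w x *\<^sub>R D u x"
            have "0 \<le> (z \<bullet> z) / (2 * l * wn n x)" using l elim by simp
            also have "z \<bullet> z = l\<^sup>2 * (wn n x)\<^sup>2 * (D v x \<bullet> D v x) - 2 * l * wn n x * w x * (D u x \<bullet> D v x)
               + (w x)\<^sup>2 * (D u x \<bullet> D u x)"
              by (simp add: z_def inner_diff_left inner_diff_right inner_commute power2_eq_square algebra_simps)
            also have "\<dots> / (2 * l * wn n x) = l / 2 * (wn n x * (D v x \<bullet> D v x)) - w x * (D u x \<bullet> D v x)
               + (1 / (2 * l)) * ((w x)\<^sup>2 / wn n x * (D u x \<bullet> D u x))"
              using l elim by (simp add: field_simps power2_eq_square)
            finally show ?case by simp
          qed
        qed (intro Bochner_Integration.integrable_mult_right Bochner_Integration.integrable_diff int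
              form_integrable[OF w u v] form_integrable[OF wn v v])+
        also have "\<dots> = l / 2 * form (wn n) v v - form w u v"
          unfolding form_def using form_integrable[OF w u v] form_integrable[OF wn v v] by simp
        finally show "ereal (- (1 / (2 * l)) * (LINT x|M. (w x)\<^sup>2 / wn n x * (D u x \<bullet> D u x)) - s)
            \<le> ereal (energy (wn n) v)"
          using 1 by (simp add: energy_eq_form l_def algebra_simps)
      qed
      from order_trans[OF this le[of n]] show ?thesis by (simp only: ereal_less_eq(3))
    qed
    have "(\<lambda>n. LINT x|M. (w x)\<^sup>2 / wn n x * (D u x \<bullet> D u x)) \<longlonglongrightarrow> (LINT x|M. w x * (D u x \<bullet> D u x))"
    proof (rule integral_dominated_convergence)
      show "integrable M (\<lambda>x. K\<^sup>2 / m * (D u x \<bullet> D u x))"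
        using D_square[OF u] by (simp add: dot_square_norm)
      from lim weightD(3)[OF w] show "AE x in M. (\<lambda>n. (w x)\<^sup>2 / wn n x * (D u x \<bullet> D u x)) \<longlonglongrightarrow> w x * (D u x \<bullet> D u x)"
      proof eventually_elim
        case (elim x)
        then have "(\<lambda>n. (w x)\<^sup>2 / wn n x * (D u x \<bullet> D u x)) \<longlonglongrightarrow> (w x)\<^sup>2 / w x * (D u x \<bullet> D u x)"
          by (intro tendsto_intros) auto
        then show ?case using elim by (simp add: power2_eq_square)
      qed
      fix n
      from weightD(3)[OF w] weightD(3)[OF wn[of n]] show "AE x in M. norm ((w x)\<^sup>2 / wn n x * (D u x \<bullet> D u x)) \<le> K\<^sup>2 / m * (D u x \<bullet> D u x)"
        by eventually_elim (use m in \<open>auto simp: abs_mult intro!: mult_right_mono frac_le power_mono\<close>)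
    qed (use u in measurable)
    then have "(\<lambda>n. - (1 / (2 * l)) * (LINT x|M. (w x)\<^sup>2 / wn n x * (D u x \<bullet> D u x)) - s)
        \<longlonglongrightarrow> - (1 / (2 * l)) * form w u u - s"
      unfolding form_def by (intro tendsto_intros)
    then have 2: "- (1 / (2 * l)) * form w u u - s \<le> b'"
      using LIMSEQ_le[OF _ b] low by blast
    \<comment> \<open>testing the approximate equation with \<open>u\<close> itself relates \<open>j\<close> to \<open>form w u u\<close>\<close>
    have "j \<le> - 1/2 * form w u u + s + s / 2 * form w u u"
      using j_le[OF u] var[OF u] by (simp add: energy_eq_form abs_le_iff)
    then have "(1 - s) * form w u u \<le> 2 * (s - j)" by (simp add: algebra_simps)
    then have "form w u u \<le> 2 * (s - j) / (1 - s)" using s by (simp add: field_simps)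
    then have "1 / (2 * l) * form w u u \<le> 1 / (2 * l) * (2 * (s - j) / (1 - s))"
      using l by (intro mult_left_mono) auto
    also have "\<dots> = - ((j - s) / (l * (1 - s)))"
      using l s by (simp add: field_simps)
    finally show ?thesis using 2 by (simp add: l_def)
  qed
  have "((\<lambda>s. (j - s) / ((1 - s * \<kappa>) * (1 - s)) - s) \<longlongrightarrow> (j - 0) / ((1 - 0 * \<kappa>) * (1 - 0)) - 0) (at_right 0)"
    by (intro tendsto_intros) auto
  moreover have "\<forall>\<^sub>F s in at_right 0. (j - s) / ((1 - s * \<kappa>) * (1 - s)) - s \<le> b'"
  proof -
    have "\<forall>\<^sub>F s in at_right (0::real). 0 < s \<and> s < 1 / (1 + \<kappa>)"
      using \<kappa> by (auto simp: eventually_at_right_field intro!: exI[of _ "1 / (1 + \<kappa>)"])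
    then show ?thesis
    proof eventually_elim
      case (elim s)
      then have "s * (1 + \<kappa>) < 1" using \<kappa> by (simp add: field_simps)
      moreover have "0 \<le> s * \<kappa>" using elim \<kappa> by simp
      ultimately have "s < 1 \<and> s * \<kappa> < 1" using elim by (simp add: distrib_left)
      then show ?case using bound elim by blast
    qed
  qed
  ultimately have "j \<le> b'" using tendsto_upperbound[of _ j "at_right (0::real)"] by auto
  then show ?thesis using real by simp
qed

end

section \<open>Growth of the N-function\<close>

locale growth_function =
  fixes \<phi> :: "real \<Rightarrow> real"
  assumes standing: "standing_assumptions \<phi>"
    and S_bounds: "(0 < S_minus \<phi> \<and> S_minus \<phi> \<le> S_plus \<phi> \<and> S_plus \<phi> < 1) \<or>
      (1 < S_minus \<phi> \<and> S_minus \<phi> \<le> S_plus \<phi> \<and> S_plus \<phi> < \<infinity>)"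
begin

lemma phi_zero: "\<phi> 0 = 0" and phi_pos: "0 < r \<Longrightarrow> 0 < \<phi> r" and phi_cont: "continuous_on {0..} \<phi>"
  using standing by (auto simp: standing_assumptions_def N_function_def)

lemma phi_DERIV: "0 < r \<Longrightarrow> (\<phi> has_real_derivative deriv \<phi> r) (at r)"
  and phi'_DERIV: "0 < r \<Longrightarrow> (deriv \<phi> has_real_derivative (deriv ^^ 2) \<phi> r) (at r)"
  and phi''_isCont: "0 < r \<Longrightarrow> isCont ((deriv ^^ 2) \<phi>) r"
proof -
  assume r: "0 < r"
  have *: "(deriv ^^ k) \<phi> differentiable (at r)" if "k < 3" for k
    using standing r that by (auto simp: standing_assumptions_def C1_C3_def)
  show "(\<phi> has_real_derivative deriv \<phi> r) (at r)"
    using *[of 0] by (simp add: DERIV_deriv_iff_real_differentiable)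
  show "(deriv \<phi> has_real_derivative (deriv ^^ 2) \<phi> r) (at r)"
    using *[of 1] by (simp add: DERIV_deriv_iff_real_differentiable numeral_2_eq_2)
  show "isCont ((deriv ^^ 2) \<phi>) r"
    using *[of 2] by (simp add: differentiable_imp_continuous_within)
qed

lemma phi'_pos: "0 < r \<Longrightarrow> 0 < deriv \<phi> r"
proof -
  assume r: "0 < r"
  have "1 < (INF r\<in>{0<..}. ereal (r * deriv \<phi> r / \<phi> r))"
    using standing by (simp add: standing_assumptions_def)
  also have "\<dots> \<le> ereal (r * deriv \<phi> r / \<phi> r)" using r by (intro INF_lower) auto
  finally have "1 < r * deriv \<phi> r / \<phi> r" by (simp add: one_ereal_def)
  then have "0 < r * deriv \<phi> r / \<phi> r" by linarith
  then show ?thesis using r phi_pos[OF r] by (simp add: zero_less_divide_iff zero_less_mult_iff)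
qed

lemma phi'_upper_growth: "\<exists>K\<ge>1. \<forall>r>0. r * deriv \<phi> r \<le> K * \<phi> r"
proof -
  define S where "S = (SUP r\<in>{0<..}. ereal (r * deriv \<phi> r / \<phi> r))"
  have S: "S < \<infinity>" using standing by (simp add: standing_assumptions_def S_def)
  have le: "ereal (r * deriv \<phi> r / \<phi> r) \<le> S" if "0 < r" for r
    unfolding S_def using that by (intro SUP_upper) auto
  then have "S \<noteq> - \<infinity>" using le[of 1] by auto
  then obtain K where K: "S = ereal K" using S by (cases S) auto
  have "r * deriv \<phi> r \<le> max K 1 * \<phi> r" if r: "0 < r" for r
  proof -
    have "r * deriv \<phi> r \<le> K * \<phi> r"
      using le[OF r] phi_pos[OF r] by (simp add: K field_simps)
    also have "\<dots> \<le> max K 1 * \<phi> r" using phi_pos[OF r] by (intro mult_right_mono) auto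
    finally show ?thesis .
  qed
  then show ?thesis by (intro exI[of _ "max K 1"]) auto
qed

text \<open>
  Either alternative for \<open>S_minus\<close> and \<open>S_plus\<close> keeps \<open>r \<phi>''(r) / \<phi>'(r)\<close> positive and bounded. The
  positivity makes \<open>\<phi>'\<close> increasing, the bound controls \<open>mu'\<close>.
\<close>

lemma phi''_growth: "\<exists>A>0. \<forall>r>0. 0 < r * (deriv ^^ 2) \<phi> r \<and> r * (deriv ^^ 2) \<phi> r \<le> A * deriv \<phi> r"
proof -
  have S: "0 < S_minus \<phi>" "S_plus \<phi> < \<infinity>"
    using S_bounds by (auto intro: less_trans[of _ 1] order.strict_trans[of 0 "1::ereal"])
  have le: "S_minus \<phi> \<le> ereal (r * (deriv ^^ 2) \<phi> r / deriv \<phi> r)"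
    "ereal (r * (deriv ^^ 2) \<phi> r / deriv \<phi> r) \<le> S_plus \<phi>" if "0 < r" for r
    unfolding S_minus_def S_plus_def using that by (auto intro!: INF_lower SUP_upper)
  then obtain A where A: "S_plus \<phi> = ereal A" using S le[of 1] by (cases "S_plus \<phi>") auto
  have *: "0 < r * (deriv ^^ 2) \<phi> r \<and> r * (deriv ^^ 2) \<phi> r \<le> A * deriv \<phi> r" if r: "0 < r" for r
  proof -
    have "0 < r * (deriv ^^ 2) \<phi> r / deriv \<phi> r" using less_le_trans[OF S(1) le(1)[OF r]] by simp
    then have "0 < r * (deriv ^^ 2) \<phi> r"
      using phi'_pos[OF r] by (simp add: zero_less_divide_iff)
    then show ?thesis using le(2)[OF r] phi'_pos[OF r] by (simp add: A field_simps)
  qed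
  then have "0 < A * deriv \<phi> 1" using *[of 1] by linarith
  then have "0 < A" using phi'_pos[of 1] by (simp add: zero_less_mult_iff)
  then show ?thesis using * by blast
qed

lemma phi'_mono:
  assumes "0 < r" "r \<le> s"
  shows "deriv \<phi> r \<le> deriv \<phi> s"
  using assms(2)
proof (rule DERIV_nonneg_imp_nondecreasing)
  fix x assume "r \<le> x"
  note \<open>0 < r\<close> this
  moreover obtain A where "\<forall>r>0. 0 < r * (deriv ^^ 2) \<phi> r \<and> r * (deriv ^^ 2) \<phi> r \<le> A * deriv \<phi> r"
    using phi''_growth by blast
  ultimately have "0 < x * (deriv ^^ 2) \<phi> x" "0 < x" by auto
  then show "\<exists>y. (deriv \<phi> has_real_derivative y) (at x) \<and> 0 \<le> y"
    using phi'_DERIV[of x] by (auto simp: zero_less_mult_iff intro!: exI[of _ "(deriv ^^ 2) \<phi> x"])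
qed

lemma Phi_DERIV: "0 < s \<Longrightarrow> (Phi \<phi> has_real_derivative mu \<phi> s / 2) (at s)"
  and mu_eq: "0 < s \<Longrightarrow> mu \<phi> s = deriv \<phi> (sqrt s) / sqrt s"
proof -
  assume s: "0 < s"
  have "((\<lambda>s. \<phi> (sqrt s)) has_real_derivative deriv \<phi> (sqrt s) * (inverse (sqrt s) / 2)) (at s)"
    using s by (intro DERIV_chain2[OF phi_DERIV]) (auto intro!: derivative_eq_intros)
  then have *: "(Phi \<phi> has_real_derivative deriv \<phi> (sqrt s) / sqrt s / 2) (at s)"
    by (simp add: Phi_def[abs_def] field_simps)
  show "mu \<phi> s = deriv \<phi> (sqrt s) / sqrt s"
    using DERIV_imp_deriv[OF *] by (simp add: mu_def)
  then show "(Phi \<phi> has_real_derivative mu \<phi> s / 2) (at s)" using * by simp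
qed

lemma mu_pos: "0 < s \<Longrightarrow> 0 < mu \<phi> s"
  by (simp add: mu_eq phi'_pos)

lemma mu_DERIV: "0 < s \<Longrightarrow> (mu \<phi> has_real_derivative deriv (mu \<phi>) s) (at s)"
  and mu'_eq: "0 < s \<Longrightarrow> deriv (mu \<phi>) s = ((deriv ^^ 2) \<phi> (sqrt s) - deriv \<phi> (sqrt s) / sqrt s) / (2 * s)"
proof -
  assume s: "0 < s"
  have "((\<lambda>s. deriv \<phi> (sqrt s)) has_real_derivative (deriv ^^ 2) \<phi> (sqrt s) * (inverse (sqrt s) / 2)) (at s)"
    using s by (intro DERIV_chain2[OF phi'_DERIV]) (auto intro!: derivative_eq_intros)
  then have "((\<lambda>s. deriv \<phi> (sqrt s) / sqrt s) has_real_derivative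
     ((deriv ^^ 2) \<phi> (sqrt s) * (inverse (sqrt s) / 2) * sqrt s - deriv \<phi> (sqrt s) * (inverse (sqrt s) / 2)) /
       (sqrt s * sqrt s)) (at s)"
    using s by (intro DERIV_divide) (auto intro!: derivative_eq_intros)
  also have "((deriv ^^ 2) \<phi> (sqrt s) * (inverse (sqrt s) / 2) * sqrt s - deriv \<phi> (sqrt s) * (inverse (sqrt s) / 2)) /
       (sqrt s * sqrt s) = ((deriv ^^ 2) \<phi> (sqrt s) - deriv \<phi> (sqrt s) / sqrt s) / (2 * s)"
    using s by (simp add: field_simps)
  finally have *: "((\<lambda>s. deriv \<phi> (sqrt s) / sqrt s) has_real_derivative
      ((deriv ^^ 2) \<phi> (sqrt s) - deriv \<phi> (sqrt s) / sqrt s) / (2 * s)) (at s)" .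
  have **: "(mu \<phi> has_real_derivative
      ((deriv ^^ 2) \<phi> (sqrt s) - deriv \<phi> (sqrt s) / sqrt s) / (2 * s)) (at s)"
    by (rule has_field_derivative_transform_within_open[OF *, of "{0<..}"]) (use s in \<open>auto simp: mu_eq\<close>)
  show "deriv (mu \<phi>) s = ((deriv ^^ 2) \<phi> (sqrt s) - deriv \<phi> (sqrt s) / sqrt s) / (2 * s)"
    by (rule DERIV_imp_deriv[OF **])
  then show "(mu \<phi> has_real_derivative deriv (mu \<phi>) s) (at s)" using ** by simp
qed

lemma mu_continuous: "S \<subseteq> {0<..} \<Longrightarrow> continuous_on S (mu \<phi>)"
  by (intro continuous_at_imp_continuous_on ballI DERIV_isCont[OF mu_DERIV]) auto

lemma Phi_continuous: "S \<subseteq> {0<..} \<Longrightarrow> continuous_on S (Phi \<phi>)"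
  by (intro continuous_at_imp_continuous_on ballI DERIV_isCont[OF Phi_DERIV]) auto

lemma mu'_continuous: "continuous_on {0<..} (deriv (mu \<phi>))"
proof -
  have 1: "continuous_on {0<..} ((deriv ^^ 2) \<phi>)"
    by (intro continuous_at_imp_continuous_on ballI phi''_isCont) auto
  have 2: "continuous_on {0<..} (deriv \<phi>)"
    by (intro continuous_at_imp_continuous_on ballI DERIV_isCont[OF phi'_DERIV]) auto
  have "continuous_on {0<..} (\<lambda>s. ((deriv ^^ 2) \<phi> (sqrt s) - deriv \<phi> (sqrt s) / sqrt s) / (2 * s))"
    by (intro continuous_intros continuous_on_compose2[OF 1] continuous_on_compose2[OF 2]) auto
  then show ?thesis by (rule continuous_on_eq) (simp add: mu'_eq)
qed

text \<open>
  Since \<open>mu\<close> is twice the derivative of \<open>Phi\<close>, the sign of \<open>mu'\<close> decides about convexity. If \<open>mu\<close>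
  decreases, the tangents of a convex \<open>Phi\<close> at \<open>1\<close> and at \<open>2\<close> would give \<open>mu \<phi> 1 \<le> mu \<phi> 2\<close>.
\<close>

lemma omega_cases:
  shows "omega \<phi> = 1 \<and> (\<forall>r>0. 0 < deriv (mu \<phi>) r) \<or> omega \<phi> = -1 \<and> (\<forall>r>0. deriv (mu \<phi>) r < 0)"
proof -
  have "(\<forall>r>0. 0 < deriv (mu \<phi>) r) \<or> (\<forall>r>0. deriv (mu \<phi>) r < 0)"
    using standing by (simp add: standing_assumptions_def)
  then show ?thesis
  proof
    assume pos: "\<forall>r>0. 0 < deriv (mu \<phi>) r"
    have "convex_on {0<..} (Phi \<phi>)"
    proof (rule convex_on_realI)
      show "connected {0::real<..}" by (rule connected_Ioi)
      show "(Phi \<phi> has_real_derivative mu \<phi> x / 2) (at x)" if "x \<in> {0<..}" for x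
        using Phi_DERIV that by simp
      fix x y :: real assume xy: "x \<in> {0<..}" "x \<le> y"
      have "mu \<phi> x \<le> mu \<phi> y"
      proof (rule DERIV_nonneg_imp_nondecreasing[OF xy(2)])
        fix z assume "x \<le> z"
        then show "\<exists>d. (mu \<phi> has_real_derivative d) (at z) \<and> 0 \<le> d"
          using mu_DERIV[of z] pos xy by (intro exI[of _ "deriv (mu \<phi>) z"]) (auto intro: less_imp_le)
      qed
      then show "mu \<phi> x / 2 \<le> mu \<phi> y / 2" by simp
    qed
    then show ?thesis using pos by (simp add: omega_def)
  next
    assume neg: "\<forall>r>0. deriv (mu \<phi>) r < 0"
    have lt: "mu \<phi> 2 < mu \<phi> 1"
    proof (rule DERIV_neg_imp_decreasing[where f = "mu \<phi>" and a = 1 and b = 2])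
      fix z :: real assume "1 \<le> z"
      then show "\<exists>d. (mu \<phi> has_real_derivative d) (at z) \<and> d < 0"
        using mu_DERIV[of z] neg by (intro exI[of _ "deriv (mu \<phi>) z"]) auto
    qed simp
    have "\<not> convex_on {0<..} (Phi \<phi>)"
    proof
      assume c: "convex_on {0<..} (Phi \<phi>)"
      have tangent: "Phi \<phi> x - Phi \<phi> y \<ge> mu \<phi> y / 2 * (x - y)" if "0 < x" "0 < y" for x y
        by (rule convex_on_imp_above_tangent[OF c])
          (use that Phi_DERIV in \<open>auto simp: interior_open connected_Ioi intro: has_field_derivative_at_within\<close>)
      show False using tangent[of 1 2] tangent[of 2 1] lt by simp
    qed
    then show ?thesis using neg by (simp add: omega_def)
  qed
qed

text \<open>
  The value at \<open>0\<close> involves the derivative of \<open>mu\<close> there and is arbitrary; integrals from \<open>0\<close> are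
  therefore handled over half-open intervals.
\<close>

definition psi' :: "real \<Rightarrow> real" where
  "psi' s = sqrt (omega \<phi> / 2 * deriv (mu \<phi>) s)"

lemma psi_eq: "psi \<phi> r = sgn r * integral {0..\<bar>r\<bar>} psi'"
  by (simp add: psi_def psi'_def[abs_def])

lemma psi'_pos: "0 < s \<Longrightarrow> 0 < psi' s"
  using omega_cases by (auto simp: psi'_def)

lemma psi'_continuous: "continuous_on {0<..} psi'"
  unfolding psi'_def[abs_def] by (intro continuous_intros mu'_continuous)

text \<open>
  With \<open>t = sqrt s\<close> one has \<open>mu'(s) = (\<phi>''(t) - \<phi>'(t) / t) / (2 * s)\<close>. The growth of \<open>\<phi>''\<close> bounds this
  by a multiple of \<open>\<phi>'(t) / t ^ 3\<close>, and \<open>\<phi>'(t) \<le> \<phi>'(sqrt r)\<close> leaves, after taking the root, the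
  integrable singularity \<open>s powr (- 3/4)\<close>.
\<close>

lemma psi'_bound: "\<exists>A>0. \<forall>s r. 0 < s \<longrightarrow> s \<le> r \<longrightarrow> psi' s \<le> sqrt (A * deriv \<phi> (sqrt r)) * s powr (- 3/4)"
proof -
  obtain A where A: "A > 0"
    "\<And>r. 0 < r \<Longrightarrow> 0 < r * (deriv ^^ 2) \<phi> r \<and> r * (deriv ^^ 2) \<phi> r \<le> A * deriv \<phi> r"
    using phi''_growth by blast
  have "psi' s \<le> sqrt ((A + 1) * deriv \<phi> (sqrt r)) * s powr (- 3/4)" if s: "0 < s" "s \<le> r" for s r
    unfolding psi'_def
  proof (rule real_le_lsqrt)
    define t where "t = sqrt s"
    have t: "0 < t" and st: "s = t\<^sup>2" using s by (auto simp: t_def)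
    have p: "0 < deriv \<phi> t" using phi'_pos[OF t] .
    have "\<bar>(deriv ^^ 2) \<phi> t - deriv \<phi> t / t\<bar> \<le> (A + 1) * deriv \<phi> t / t"
    proof -
      have "\<bar>t * (deriv ^^ 2) \<phi> t - deriv \<phi> t\<bar> \<le> (A + 1) * deriv \<phi> t"
        using A(2)[OF t] p by (simp add: abs_le_iff distrib_right)
      moreover have "(deriv ^^ 2) \<phi> t - deriv \<phi> t / t = (t * (deriv ^^ 2) \<phi> t - deriv \<phi> t) / t"
        using t by (simp add: field_simps)
      ultimately show ?thesis
        using t by (simp add: divide_right_mono)
    qed
    have "omega \<phi> / 2 * deriv (mu \<phi>) s \<le> \<bar>deriv (mu \<phi>) s\<bar> / 2"
      using omega_cases by auto
    also have "\<dots> = \<bar>(deriv ^^ 2) \<phi> t - deriv \<phi> t / t\<bar> / (4 * t\<^sup>2)"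
      using s by (simp add: mu'_eq[OF s(1)] flip: t_def) (simp add: st abs_mult)
    also have "\<dots> \<le> ((A + 1) * deriv \<phi> t / t) / (4 * t\<^sup>2)"
      using \<open>\<bar>_\<bar> \<le> _\<close> by (intro divide_right_mono) auto
    also have "\<dots> \<le> (A + 1) * deriv \<phi> t * t powr (- 3)"
      using A(1) p t by (simp add: powr_minus field_simps power3_eq_cube power2_eq_square)
    also have "\<dots> \<le> (A + 1) * deriv \<phi> (sqrt r) * t powr (-3)"
      using A(1) s t phi'_mono[OF t, of "sqrt r"] by (intro mult_right_mono mult_left_mono) (auto simp: t_def)
    also have "t powr (-3) = (s powr (- 3/4))\<^sup>2"
      using t by (simp add: st powr_powr flip: powr_numeral powr_mult)
    also have "(A + 1) * deriv \<phi> (sqrt r) * (s powr (- 3/4))\<^sup>2 = (sqrt ((A + 1) * deriv \<phi> (sqrt r)) * s powr (- 3/4))\<^sup>2"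
      using A(1) s phi'_pos[of "sqrt r"] by (simp add: power_mult_distrib)
    finally show "omega \<phi> / 2 * deriv (mu \<phi>) s \<le> (sqrt ((A + 1) * deriv \<phi> (sqrt r)) * s powr (- 3/4))\<^sup>2" .
    show "0 \<le> sqrt ((A + 1) * deriv \<phi> (sqrt r)) * s powr (- 3/4)"
      using A(1) s phi'_pos[of "sqrt r"] by simp
  qed
  then show ?thesis using A(1) by (intro exI[of _ "A + 1"]) auto
qed

lemma psi'_integral_bound: "\<exists>A>0. \<forall>r>0. psi' integrable_on {0..r} \<and>
    integral {0..r} psi' \<le> sqrt (A * deriv \<phi> (sqrt r)) * (4 * r powr (1/4))"
proof -
  obtain A where A: "A > 0"
    "\<And>s r. 0 < s \<Longrightarrow> s \<le> r \<Longrightarrow> psi' s \<le> sqrt (A * deriv \<phi> (sqrt r)) * s powr (- 3/4)"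
    using psi'_bound by blast
  have "psi' integrable_on {0..r} \<and>
    integral {0..r} psi' \<le> sqrt (A * deriv \<phi> (sqrt r)) * (4 * r powr (1/4))" if r: "0 < r" for r
  proof -
    have sets: "{0<..r} - {0..r} = {}" "{0..r} - {0<..r} = {0}" using r by auto
    have I: "((\<lambda>s. sqrt (A * deriv \<phi> (sqrt r)) * s powr (- 3/4)) has_integral
        sqrt (A * deriv \<phi> (sqrt r)) * (4 * r powr (1/4))) {0..r}"
      using has_integral_mult_right[OF has_integral_powr_from_0[of "- 3/4" r]] r by (simp add: mult.commute)
    then have J: "((\<lambda>s. sqrt (A * deriv \<phi> (sqrt r)) * s powr (- 3/4)) has_integral
        sqrt (A * deriv \<phi> (sqrt r)) * (4 * r powr (1/4))) {0<..r}"
      by (subst has_integral_spike_set_eq[where T = "{0..r}"])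
        (auto simp: sets intro: negligible_subset[of "{0}"])
    have psi': "psi' integrable_on {0<..r}"
    proof (rule measurable_bounded_by_integrable_imp_integrable_real)
      show "psi' \<in> borel_measurable (lebesgue_on {0<..r})"
        by (intro continuous_imp_measurable_on_sets_lebesgue continuous_on_subset[OF psi'_continuous]) auto
      show "(\<lambda>s. sqrt (A * deriv \<phi> (sqrt r)) * s powr (- 3/4)) integrable_on {0<..r}" using J by blast
      show "\<bar>psi' s\<bar> \<le> sqrt (A * deriv \<phi> (sqrt r)) * s powr (- 3/4)" if "s \<in> {0<..r}" for s
        using A(2)[of s r] psi'_pos[of s] that by simp
    qed auto
    have eq: "psi' integrable_on {0..r} \<longleftrightarrow> psi' integrable_on {0<..r}"
      by (rule integrable_spike_set_eq) (auto simp: sets intro: negligible_subset[of "{0}"])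
    have "integral {0..r} psi' = integral {0<..r} psi'"
      by (rule integral_spike_set) (auto simp: sets intro: negligible_subset[of "{0}"])
    also have "\<dots> \<le> integral {0<..r} (\<lambda>s. sqrt (A * deriv \<phi> (sqrt r)) * s powr (- 3/4))"
      using psi' J A(2)[of _ r] by (intro integral_le) auto
    also have "\<dots> = sqrt (A * deriv \<phi> (sqrt r)) * (4 * r powr (1/4))" using J by blast
    finally show ?thesis using psi' eq by blast
  qed
  then show ?thesis using A(1) by blast
qed

lemma psi'_integrable: "psi' integrable_on {a..b}" if "0 \<le> a" "a \<le> b"
proof (cases "b = 0")
  case False
  then have "psi' integrable_on {0..b}" using psi'_integral_bound that by force
  then show ?thesis by (rule integrable_subinterval_real) (use that in auto)
next
  case True
  then show ?thesis using that integrable_on_refl[of psi' 0] by simp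
qed

lemma psi'_integral_pos: "0 < integral {a..b} psi'" if ab: "0 \<le> a" "a < b"
proof -
  \<comment> \<open>on \<open>{c..b}\<close>, away from the singularity at \<open>0\<close>, the integrand has a positive minimum\<close>
  define c where "c = (a + b) / 2"
  have c: "a < c" "c < b" "0 < c" using ab by (auto simp: c_def)
  obtain x where x: "x \<in> {c..b}" "\<And>y. y \<in> {c..b} \<Longrightarrow> psi' x \<le> psi' y"
  proof -
    have "continuous_on {c..b} psi'" by (rule continuous_on_subset[OF psi'_continuous]) (use c in auto)
    then show ?thesis using continuous_attains_inf[of "{c..b}" psi'] c that by fastforce
  qed
  have "0 < psi' x * (b - c)" using c x psi'_pos[of x] by auto
  also have "\<dots> = integral {c..b} (\<lambda>y. psi' x)" using c by simp
  also have "\<dots> \<le> integral {c..b} psi'" using c x by (intro integral_le psi'_integrable) auto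
  also have "\<dots> \<le> integral {a..c} psi' + integral {c..b} psi'"
  proof -
    have "integral {a..c} psi' = integral {a<..c} psi'"
      by (rule integral_spike_set) (auto intro: negligible_subset[of "{a}"])
    also have "\<dots> \<ge> 0"
    proof (rule integral_nonneg)
      show "psi' integrable_on {a<..c}"
        using psi'_integrable[of a c] ab c
        by (subst integrable_spike_set_eq[where T = "{a..c}"]) (auto intro: negligible_subset[of "{a}"])
      show "0 \<le> psi' x" if "x \<in> {a<..c}" for x using psi'_pos[of x] that ab by simp
    qed
    finally show ?thesis by simp
  qed
  also have "\<dots> = integral {a..b} psi'"
    using c ab by (intro Henstock_Kurzweil_Integration.integral_combine psi'_integrable) auto
  finally show ?thesis .
qed

lemma psi_nonneg_eq: "0 \<le> r \<Longrightarrow> psi \<phi> r = integral {0..r} psi'"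
  by (cases "r = 0") (auto simp: psi_eq)

lemma psi_minus: "psi \<phi> (- r) = - psi \<phi> r"
  by (simp add: psi_eq sgn_minus)

lemma psi_less_nonneg: "0 \<le> a \<Longrightarrow> a < b \<Longrightarrow> psi \<phi> a < psi \<phi> b"
  using Henstock_Kurzweil_Integration.integral_combine[of 0 a b psi'] psi'_integral_pos[of a b] psi'_integrable[of 0 b]
  by (simp add: psi_nonneg_eq)

lemma psi_strict_mono: "strict_mono (psi \<phi>)"
proof (rule strict_monoI)
  fix a b :: real assume ab: "a < b"
  have z: "psi \<phi> 0 = 0" by (simp add: psi_eq)
  consider "0 \<le> a" | "b \<le> 0" | "a < 0" "0 < b" by linarith
  then show "psi \<phi> a < psi \<phi> b"
  proof cases
    case 1 then show ?thesis using ab by (rule psi_less_nonneg)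
  next
    case 2 then show ?thesis using psi_less_nonneg[of "-b" "-a"] ab by (simp add: psi_minus)
  next
    case 3 then show ?thesis using psi_less_nonneg[of 0 "-a"] psi_less_nonneg[of 0 b] z by (simp add: psi_minus)
  qed
qed

text \<open>
  Integrating \<open>psi'_bound\<close> bounds \<open>(psi r)\<^sup>2\<close> by a multiple of \<open>\<phi>'(t) * t\<close> with \<open>t = sqrt \<bar>r\<bar>\<close>, hence by
  a multiple of \<open>\<phi> t\<close>. This is what makes \<open>dist_Phi\<close> meaningful: the Bochner integral in \<open>L2_norm\<close>
  is \<open>0\<close> by default if its integrand is not integrable.
\<close>

lemma psi_square_bound: "\<exists>C\<ge>0. \<forall>r. (psi \<phi> r)\<^sup>2 \<le> C * \<phi> (sqrt \<bar>r\<bar>)"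
proof -
  obtain A where A: "A > 0" "\<And>r. 0 < r \<Longrightarrow> integral {0..r} psi' \<le> sqrt (A * deriv \<phi> (sqrt r)) * (4 * r powr (1/4))"
    using psi'_integral_bound by blast
  obtain K where K: "K \<ge> 1" "\<And>r. 0 < r \<Longrightarrow> r * deriv \<phi> r \<le> K * \<phi> r" using phi'_upper_growth by blast
  have pos: "(psi \<phi> r)\<^sup>2 \<le> 16 * A * K * \<phi> (sqrt \<bar>r\<bar>)" if r: "0 < r" for r
  proof -
    have p: "0 < deriv \<phi> (sqrt r)" using r phi'_pos[of "sqrt r"] by simp
    have "0 < psi \<phi> r" using psi_less_nonneg[of 0 r] r by (simp add: psi_eq)
    then have "(psi \<phi> r)\<^sup>2 \<le> (sqrt (A * deriv \<phi> (sqrt r)) * (4 * r powr (1/4)))\<^sup>2"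
      using A(2)[OF r] r by (intro power_mono) (auto simp: psi_nonneg_eq)
    also have "\<dots> = 16 * A * (deriv \<phi> (sqrt r) * (r powr (1/4))\<^sup>2)"
      using A(1) p by (simp add: power_mult_distrib)
    also have "(r powr (1/4))\<^sup>2 = sqrt r"
      using r by (simp add: powr_powr powr_half_sqrt flip: powr_numeral)
    also have "16 * A * (deriv \<phi> (sqrt r) * sqrt r) \<le> 16 * A * (K * \<phi> (sqrt r))"
      using K(2)[of "sqrt r"] A(1) r by (intro mult_left_mono) (auto simp: mult.commute)
    finally show ?thesis using r by simp
  qed
  have "(psi \<phi> r)\<^sup>2 \<le> 16 * A * K * \<phi> (sqrt \<bar>r\<bar>)" for r
  proof -
    consider "0 < r" | "r = 0" | "r < 0" by linarith
    then show ?thesis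
    proof cases
      case 1 then show ?thesis by (rule pos)
    next
      case 2 then show ?thesis by (simp add: psi_eq phi_zero)
    next
      case 3 then show ?thesis using pos[of "- r"] by (simp add: psi_minus)
    qed
  qed
  then show ?thesis using A(1) K(1) by (intro exI[of _ "16 * A * K"]) auto
qed

lemma phi_mono: "0 \<le> r \<Longrightarrow> r \<le> s \<Longrightarrow> \<phi> r \<le> \<phi> s"
proof (cases "r = s")
  assume "0 \<le> r" "r \<le> s" "r \<noteq> s"
  have "\<phi> r < \<phi> s"
  proof (rule DERIV_pos_imp_increasing_open[where f = \<phi> and a = r and b = s])
    show "r < s" using \<open>r \<le> s\<close> \<open>r \<noteq> s\<close> by simp
    show "continuous_on {r..s} \<phi>" using \<open>0 \<le> r\<close> by (auto intro: continuous_on_subset[OF phi_cont])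
    fix x assume "r < x"
    then show "\<exists>y. (\<phi> has_real_derivative y) (at x) \<and> 0 < y"
      using phi_DERIV[of x] phi'_pos[of x] \<open>0 \<le> r\<close> by auto
  qed
  then show ?thesis by simp
qed simp

text \<open>
  The function \<open>\<phi> x * x powr (- K)\<close> is nonincreasing, since \<open>x * \<phi>'(x) \<le> K * \<phi> x\<close>. This removes the
  scaling factor in the definition of the Orlicz space.
\<close>

lemma phi_doubling: "1 \<le> k \<Longrightarrow> \<exists>C\<ge>0. \<forall>t\<ge>0. \<phi> (k * t) \<le> C * \<phi> t"
proof -
  assume k: "1 \<le> k"
  obtain K where K: "K \<ge> 1" "\<And>r. 0 < r \<Longrightarrow> r * deriv \<phi> r \<le> K * \<phi> r" using phi'_upper_growth by blast
  have "\<phi> (k * t) \<le> k powr K * \<phi> t" if t: "0 \<le> t" for t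
  proof (cases "t = 0")
    case False
    then have t: "0 < t" using t by simp
    have "\<phi> (k * t) * (k * t) powr (- K) \<le> \<phi> t * t powr (- K)"
    proof (rule DERIV_nonpos_imp_nonincreasing[where f = "\<lambda>x. \<phi> x * x powr (- K)"])
      show "t \<le> k * t" using k t by simp
      fix x assume "t \<le> x"
      then have x: "0 < x" using t by simp
      have "((\<lambda>x. \<phi> x * x powr (- K)) has_real_derivative
          deriv \<phi> x * x powr (- K) + (- K * x powr (- K - 1)) * \<phi> x) (at x)"
        by (rule DERIV_mult[OF phi_DERIV[OF x] has_real_derivative_powr[OF x]])
      moreover have "deriv \<phi> x * x powr (- K) + (- K * x powr (- K - 1)) * \<phi> x =
          x powr (- K - 1) * (x * deriv \<phi> x - K * \<phi> x)"
        using x by (simp add: powr_diff field_simps)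
      moreover have "x powr (- K - 1) * (x * deriv \<phi> x - K * \<phi> x) \<le> 0"
        using K(2)[OF x] by (intro mult_nonneg_nonpos) auto
      ultimately show "\<exists>y. ((\<lambda>x. \<phi> x * x powr (- K)) has_real_derivative y) (at x) \<and> y \<le> 0"
        by auto
    qed
    then show ?thesis using k t by (simp add: powr_mult powr_minus field_simps)
  qed (simp add: phi_zero)
  then show ?thesis by (intro exI[of _ "k powr K"]) auto
qed

end

section \<open>Convergence in the metric of the Orlicz-type space\<close>

lemma borel_measurable_lebesgue_on_AE:
  fixes f g :: "'a::euclidean_space \<Rightarrow> 'b::euclidean_space"
  assumes S: "S \<in> sets lebesgue" and f: "f \<in> borel_measurable (lebesgue_on S)"
    and eq: "AE x in lebesgue_on S. f x = g x"
  shows "g \<in> borel_measurable (lebesgue_on S)"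
proof -
  have "AE x in lebesgue. (if x \<in> S then f x else 0) = (if x \<in> S then g x else 0)"
    using eq S by (simp add: AE_restrict_space_iff)
  then have "(\<lambda>x. if x \<in> S then g x else 0) \<in> borel_measurable lebesgue"
    by (rule borel_measurable_AE[OF borel_measurable_if_I[OF f S]])
  then show ?thesis using S borel_measurable_if_D by blast
qed

text \<open>
  The inverse of a strictly increasing function is continuous on its range, even if the function
  itself jumps.
\<close>

lemma tendsto_of_strict_mono_tendsto:
  fixes f :: "real \<Rightarrow> real"
  assumes f: "strict_mono f" and lim: "((\<lambda>n. f (a n)) \<longlongrightarrow> f l) F"
  shows "(a \<longlongrightarrow> l) F"
proof (rule order_tendstoI)
  fix y assume "y < l"
  then have "f y < f l" using f by (simp add: strict_mono_less)
  from order_tendstoD(1)[OF lim this] show "\<forall>\<^sub>F n in F. y < a n"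
    using f by (simp add: strict_mono_less)
next
  fix y assume "l < y"
  then have "f l < f y" using f by (simp add: strict_mono_less)
  from order_tendstoD(2)[OF lim this] show "\<forall>\<^sub>F n in F. a n < y"
    using f by (simp add: strict_mono_less)
qed

text \<open>
  Clamping the argument to \<open>{a..b}\<close> turns \<open>h\<close> into a continuous function on the whole line and changes
  the composition on a null set only.
\<close>

lemma superposition_measurable:
  fixes h :: "real \<Rightarrow> real" and c :: "real ^ 'n::finite \<Rightarrow> real"
  assumes S: "S \<in> sets lebesgue" and c: "c \<in> borel_measurable (lebesgue_on S)"
    and ae: "AE x in lebesgue_on S. a \<le> c x \<and> c x \<le> b" and ab: "a \<le> b"
    and h: "continuous_on {a..b} h"
  shows "(\<lambda>x. h (c x)) \<in> borel_measurable (lebesgue_on S)"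
proof (rule borel_measurable_lebesgue_on_AE[OF S])
  have "continuous_on UNIV (\<lambda>s. h (max a (min b s)))"
    using ab by (intro continuous_on_compose2[OF h] continuous_intros) auto
  then have "(\<lambda>s. h (max a (min b s))) \<in> borel_measurable borel"
    by (rule borel_measurable_continuous_onI)
  then show "(\<lambda>x. h (max a (min b (c x)))) \<in> borel_measurable (lebesgue_on S)"
    using measurable_compose[OF c] by blast
  show "AE x in lebesgue_on S. h (max a (min b (c x))) = h (c x)"
    using ae by eventually_elim auto
qed

lemma superposition_integral_tendsto:
  fixes h :: "real \<Rightarrow> real" and c :: "real ^ 'n::finite \<Rightarrow> real"
  assumes S: "S \<in> lmeasurable" and c: "c \<in> borel_measurable (lebesgue_on S)"
    and cn: "\<And>n::nat. cn n \<in> borel_measurable (lebesgue_on S)"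
    and ae: "AE x in lebesgue_on S. a \<le> c x \<and> c x \<le> b"
    and aen: "\<And>n. AE x in lebesgue_on S. a \<le> cn n x \<and> cn n x \<le> b"
    and ab: "a \<le> b" and h: "continuous_on {a..b} h"
    and lim: "AE x in lebesgue_on S. (\<lambda>n. cn n x) \<longlonglongrightarrow> c x"
  shows "(\<lambda>n. LINT x|lebesgue_on S. h (cn n x)) \<longlonglongrightarrow> (LINT x|lebesgue_on S. h (c x))"
proof -
  have S': "S \<in> sets lebesgue" using S by auto
  have "compact (h ` {a..b})" using h by (rule compact_continuous_image) auto
  then obtain B where B: "\<And>s. s \<in> {a..b} \<Longrightarrow> norm (h s) \<le> B"
    by (meson bounded_iff compact_imp_bounded imageI)
  show ?thesis
  proof (rule integral_dominated_convergence)
    show "integrable (lebesgue_on S) (\<lambda>x. B)"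
      by (rule finite_measure.integrable_const[OF finite_measure_lebesgue_on[OF S]])
    show "(\<lambda>x. h (c x)) \<in> borel_measurable (lebesgue_on S)"
      by (rule superposition_measurable[OF S' c ae ab h])
    show "(\<lambda>x. h (cn n x)) \<in> borel_measurable (lebesgue_on S)" for n
      by (rule superposition_measurable[OF S' cn aen ab h])
    show "AE x in lebesgue_on S. norm (h (cn n x)) \<le> B" for n
      using aen[of n] by eventually_elim (use B in auto)
    have all: "AE x in lebesgue_on S. \<forall>n. a \<le> cn n x \<and> cn n x \<le> b"
      using aen by (simp add: AE_all_countable)
    from ae all lim show "AE x in lebesgue_on S. (\<lambda>n. h (cn n x)) \<longlonglongrightarrow> h (c x)"
      by eventually_elim (auto intro!: continuous_on_tendsto_compose[OF h])
  qed
qed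

lemma eps_le_inverse:
  fixes \<epsilon> :: real assumes "0 < \<epsilon>" "\<epsilon> < 1" shows "\<epsilon> \<le> 1 / \<epsilon>"
  using assms mult_le_one[of \<epsilon> \<epsilon>] by (simp add: field_simps)

context growth_function
begin

lemma psi_square_integrable:
  fixes \<Omega> :: "(real ^ 'n::finite) set"
  assumes c: "c \<in> LPhi \<phi> \<Omega>"
  shows "(\<lambda>x. psi \<phi> (c x)) \<in> borel_measurable (lebesgue_on \<Omega>)"
    and "integrable (lebesgue_on \<Omega>) (\<lambda>x. (psi \<phi> (c x))\<^sup>2)"
proof -
  have [measurable]: "c \<in> borel_measurable (lebesgue_on \<Omega>)" using c by (simp add: LPhi_def)
  have "mono (psi \<phi>)" using psi_strict_mono by (rule strict_mono_mono)
  then have [measurable]: "psi \<phi> \<in> borel_measurable borel" by (rule borel_measurable_mono)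
  show m: "(\<lambda>x. psi \<phi> (c x)) \<in> borel_measurable (lebesgue_on \<Omega>)" by measurable
  obtain k where k: "k > 0" and fin: "(\<integral>\<^sup>+ x. ennreal (\<phi> (norm (sqrt \<bar>c x\<bar>) / k)) \<partial>lebesgue_on \<Omega>) < \<infinity>"
    using c by (auto simp: LPhi_def Orlicz_def)
  obtain C where C: "C \<ge> 0" "\<And>r. (psi \<phi> r)\<^sup>2 \<le> C * \<phi> (sqrt \<bar>r\<bar>)" using psi_square_bound by blast
  obtain B where B: "B \<ge> 0" "\<And>t. t \<ge> 0 \<Longrightarrow> \<phi> (max k 1 * t) \<le> B * \<phi> t" using phi_doubling[of "max k 1"] by auto
  have bound: "(psi \<phi> r)\<^sup>2 \<le> C * B * \<phi> (norm (sqrt \<bar>r\<bar>) / k)" for r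
  proof -
    have "\<phi> (sqrt \<bar>r\<bar>) \<le> B * \<phi> (sqrt \<bar>r\<bar> / max k 1)"
      using B(2)[of "sqrt \<bar>r\<bar> / max k 1"] by simp
    also have "\<dots> \<le> B * \<phi> (sqrt \<bar>r\<bar> / k)"
      using B(1) k by (intro mult_left_mono phi_mono divide_left_mono) auto
    finally show ?thesis
      using order_trans[OF C(2)[of r] mult_left_mono[OF _ C(1)]] by (simp add: mult.assoc)
  qed
  have "continuous_on UNIV (\<lambda>s. \<phi> (max 0 s))"
    by (intro continuous_on_compose2[OF phi_cont] continuous_intros) auto
  then have [measurable]: "(\<lambda>s. \<phi> (max 0 s)) \<in> borel_measurable borel"
    by (rule borel_measurable_continuous_onI)
  have "(\<lambda>x. \<phi> (max 0 (norm (sqrt \<bar>c x\<bar>) / k))) \<in> borel_measurable (lebesgue_on \<Omega>)" by measurable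
  then have [measurable]: "(\<lambda>x. \<phi> (norm (sqrt \<bar>c x\<bar>) / k)) \<in> borel_measurable (lebesgue_on \<Omega>)"
    using k by simp
  show "integrable (lebesgue_on \<Omega>) (\<lambda>x. (psi \<phi> (c x))\<^sup>2)"
  proof (rule integrableI_bounded)
    have "(\<integral>\<^sup>+ x. ennreal (norm ((psi \<phi> (c x))\<^sup>2)) \<partial>lebesgue_on \<Omega>) \<le>
       (\<integral>\<^sup>+ x. ennreal (C * B) * ennreal (\<phi> (norm (sqrt \<bar>c x\<bar>) / k)) \<partial>lebesgue_on \<Omega>)"
      using bound C(1) B(1) by (intro nn_integral_mono) (simp add: ennreal_leI flip: ennreal_mult')
    also have "\<dots> = ennreal (C * B) * (\<integral>\<^sup>+ x. ennreal (\<phi> (norm (sqrt \<bar>c x\<bar>) / k)) \<partial>lebesgue_on \<Omega>)"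
      by (rule nn_integral_cmult) measurable
    also have "\<dots> < \<infinity>" using fin by (simp add: ennreal_mult_less_top)
    finally show "(\<integral>\<^sup>+ x. ennreal (norm ((psi \<phi> (c x))\<^sup>2)) \<partial>lebesgue_on \<Omega>) < \<infinity>" .
  qed measurable
qed

text \<open>
  Convergence in the metric is convergence of \<open>psi \<phi> (cn n)\<close> in \<open>L2\<close>, so a subsequence converges
  almost everywhere, and strict monotonicity transfers this to \<open>cn n\<close>. The pointwise constraints pass
  to the limit, so \<open>LPhi_eps\<close> is closed.
\<close>

lemma dist_Phi_AE_subseq:
  fixes \<Omega> :: "(real ^ 'n::finite) set"
  assumes c: "c \<in> LPhi \<phi> \<Omega>" and cn: "\<And>n::nat. cn n \<in> LPhi_eps \<phi> \<Omega> \<epsilon>"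
    and lim: "(\<lambda>n. dist_Phi \<phi> \<Omega> c (cn n)) \<longlonglongrightarrow> 0"
  shows "\<exists>r. strict_mono r \<and> c \<in> LPhi_eps \<phi> \<Omega> \<epsilon> \<and> (AE x in lebesgue_on \<Omega>. (\<lambda>n. cn (r n) x) \<longlonglongrightarrow> c x)"
proof -
  let ?M = "lebesgue_on \<Omega>"
  define u where "u n x = (psi \<phi> (cn n x) - psi \<phi> (c x))\<^sup>2" for n x
  have cn': "cn n \<in> LPhi \<phi> \<Omega>" for n using cn[of n] by (simp add: LPhi_eps_def)
  note [measurable] = psi_square_integrable(1)[OF c] psi_square_integrable(1)[OF cn']
  have int: "integrable ?M (u n)" for n
  proof (rule Bochner_Integration.integrable_bound)
    show "integrable ?M (\<lambda>x. 2 * ((psi \<phi> (cn n x))\<^sup>2 + (psi \<phi> (c x))\<^sup>2))"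
      using psi_square_integrable(2)[OF c] psi_square_integrable(2)[OF cn'] by simp
    show "u n \<in> borel_measurable ?M" unfolding u_def by measurable
    have "(a - b)\<^sup>2 \<le> 2 * (a\<^sup>2 + b\<^sup>2)" for a b :: real
      using sum_squares_ge_zero[of "a + b" 0] by (simp add: power2_eq_square algebra_simps)
    then show "AE x in ?M. norm (u n x) \<le> norm (2 * ((psi \<phi> (cn n x))\<^sup>2 + (psi \<phi> (c x))\<^sup>2))"
      by (simp add: u_def)
  qed
  have "(\<lambda>n. (dist_Phi \<phi> \<Omega> c (cn n))\<^sup>2) \<longlonglongrightarrow> 0\<^sup>2" using lim by (intro tendsto_intros)
  then have "(\<lambda>n. LINT x|?M. norm (u n x)) \<longlonglongrightarrow> 0"
    by (simp add: dist_Phi_def L2_norm_def u_def)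
  then obtain r where r: "strict_mono r" and ae: "AE x in ?M. (\<lambda>n. u (r n) x) \<longlonglongrightarrow> 0"
    using tendsto_L1_AE_subseq[where M = ?M and u = u] int by metis
  have conv: "AE x in ?M. (\<lambda>n. cn (r n) x) \<longlonglongrightarrow> c x"
    using ae
  proof eventually_elim
    case (elim x)
    then have "(\<lambda>n. sqrt (u (r n) x)) \<longlonglongrightarrow> sqrt 0" by (intro tendsto_intros)
    then have "(\<lambda>n. psi \<phi> (cn (r n) x) - psi \<phi> (c x)) \<longlonglongrightarrow> 0"
      by (simp add: u_def tendsto_rabs_zero_iff)
    then show ?case
      by (rule tendsto_of_strict_mono_tendsto[OF psi_strict_mono LIM_zero_cancel])
  qed
  have "AE x in ?M. \<forall>n. \<epsilon> \<le> cn n x \<and> cn n x \<le> 1 / \<epsilon>"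
    using cn by (simp add: AE_all_countable LPhi_eps_def)
  with conv have "AE x in ?M. \<epsilon> \<le> c x \<and> c x \<le> 1 / \<epsilon>"
  proof eventually_elim
    case (elim x)
    then show ?case
      using LIMSEQ_le_const[of "\<lambda>n. cn (r n) x" "c x" \<epsilon>] LIMSEQ_le_const2[of "\<lambda>n. cn (r n) x" "c x" "1 / \<epsilon>"]
      by blast
  qed
  then show ?thesis using c r conv by (auto simp: LPhi_eps_def)
qed

lemma mu_bounds:
  assumes "0 < \<epsilon>" "\<epsilon> < 1"
  shows "\<exists>m K. 0 < m \<and> (\<forall>s\<in>{\<epsilon>..1/\<epsilon>}. m \<le> mu \<phi> s \<and> mu \<phi> s \<le> K)"
proof -
  have ne: "{\<epsilon>..1/\<epsilon>} \<noteq> {}" using eps_le_inverse[OF assms] by simp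
  have c: "continuous_on {\<epsilon>..1/\<epsilon>} (mu \<phi>)" using assms by (intro mu_continuous) auto
  obtain s where "s \<in> {\<epsilon>..1/\<epsilon>}" "\<forall>t\<in>{\<epsilon>..1/\<epsilon>}. mu \<phi> s \<le> mu \<phi> t"
    using continuous_attains_inf[OF compact_Icc ne c] by blast
  moreover obtain t where "t \<in> {\<epsilon>..1/\<epsilon>}" "\<forall>r\<in>{\<epsilon>..1/\<epsilon>}. mu \<phi> r \<le> mu \<phi> t"
    using continuous_attains_sup[OF compact_Icc ne c] by blast
  ultimately show ?thesis using mu_pos[of s] assms by (intro exI[of _ "mu \<phi> s"] exI[of _ "mu \<phi> t"]) auto
qed

end

section \<open>Test functions\<close>

lemma partial_eq: "(f has_derivative f') (at x) \<Longrightarrow> partial i f x = f' (axis i 1)"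
  by (simp add: partial_def frechet_derivative_at[symmetric])

lemma partial_add:
  "f differentiable (at x) \<Longrightarrow> g differentiable (at x) \<Longrightarrow>
    partial i (\<lambda>x. f x + g x) x = partial i f x + partial i g x"
  unfolding partial_def frechet_derivative_works
  by (subst frechet_derivative_at[symmetric, OF has_derivative_add]) auto

lemma partial_scaleR:
  "g differentiable (at x) \<Longrightarrow> f differentiable (at x) \<Longrightarrow>
    partial i (\<lambda>x. g x *\<^sub>R f x) x = partial i g x *\<^sub>R f x + g x *\<^sub>R partial i f x"
  unfolding partial_def frechet_derivative_works
  by (subst frechet_derivative_at[symmetric, OF has_derivative_scaleR]) auto

lemma Ck_const: "Ck k (\<lambda>x :: real ^ 'n::finite. a)"
proof (induction k arbitrary: a)
  case (Suc k)
  have "partial i (\<lambda>x :: real ^ 'n. a) = (\<lambda>x. 0)" for i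
    by (rule ext, subst partial_eq[OF has_derivative_const]) simp
  then show ?case using Suc by simp
qed simp

lemma Ck_Suc_imp_Ck: "Ck (Suc k) f \<Longrightarrow> Ck k f"
proof (induction k arbitrary: f)
  case 0
  then show ?case by (auto intro!: continuous_at_imp_continuous_on differentiable_imp_continuous_within)
next
  case (Suc k)
  have "\<forall>x. f differentiable (at x)" "\<And>i. Ck (Suc k) (partial i f)" using Suc.prems by simp_all
  then show ?case using Suc.IH by simp
qed

lemma Ck_add: "Ck k f \<Longrightarrow> Ck k g \<Longrightarrow> Ck k (\<lambda>x. f x + g x)"
proof (induction k arbitrary: f g)
  case 0
  then show ?case by (auto intro: continuous_intros)
next
  case (Suc k)
  have "partial i (\<lambda>x. f x + g x) = (\<lambda>x. partial i f x + partial i g x)" for i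
    using Suc.prems by (auto intro!: ext partial_add)
  then show ?case using Suc by auto
qed

lemma Ck_scaleR: "Ck k g \<Longrightarrow> Ck k f \<Longrightarrow> Ck k (\<lambda>x. g x *\<^sub>R f x)"
proof (induction k arbitrary: f g)
  case 0
  then show ?case by (auto intro: continuous_intros)
next
  case (Suc k)
  have "partial i (\<lambda>x. g x *\<^sub>R f x) = (\<lambda>x. partial i g x *\<^sub>R f x + g x *\<^sub>R partial i f x)" for i
    using Suc.prems by (auto intro!: ext partial_scaleR)
  moreover have "Ck k (\<lambda>x. partial i g x *\<^sub>R f x + g x *\<^sub>R partial i f x)" for i
    using Suc.prems Ck_Suc_imp_Ck[OF Suc.prems(1)] Ck_Suc_imp_Ck[OF Suc.prems(2)]
    by (intro Ck_add Suc.IH) auto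
  ultimately show ?case using Suc.prems by auto
qed

lemma Ck_prod:
  fixes f :: "'i \<Rightarrow> real ^ 'n::finite \<Rightarrow> real"
  assumes "finite I" "\<And>i. i \<in> I \<Longrightarrow> Ck k (f i)"
  shows "Ck k (\<lambda>x. \<Prod>i\<in>I. f i x)"
  using assms
proof (induction I rule: finite_induct)
  case empty
  then show ?case by (simp add: Ck_const)
next
  case (insert i I)
  then show ?case using Ck_scaleR[of k "f i" "\<lambda>x. \<Prod>i\<in>I. f i x"] by simp
qed

lemma nonzero_imp_mem_support:
  assumes "f x \<noteq> 0" shows "x \<in> closure {x. f x \<noteq> 0}"
  using assms closure_subset[of "{x. f x \<noteq> 0}"] by blast

lemma partial_zero_outside_open:
  assumes "open U" "\<And>y. y \<in> U \<Longrightarrow> f y = 0" "x \<in> U"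
  shows "partial i f x = 0"
proof -
  have "(f has_derivative (\<lambda>h. 0)) (at x)"
    by (rule has_derivative_transform_within_open[OF has_derivative_const assms(1,3)]) (simp add: assms(2))
  then show ?thesis by (simp add: partial_eq)
qed

lemma Cc_infinity_imp_Ck: "f \<in> Cc_infinity \<Omega> \<Longrightarrow> Ck k f"
  by (simp add: Cc_infinity_def)

lemma Cc_infinity_differentiable: "f \<in> Cc_infinity \<Omega> \<Longrightarrow> f differentiable (at x)"
  using Cc_infinity_imp_Ck[of f \<Omega> "Suc 0"] by simp

lemma Cc_infinity_continuous: "f \<in> Cc_infinity \<Omega> \<Longrightarrow> continuous_on UNIV f"
  using Cc_infinity_imp_Ck[of f \<Omega> 0] by simp

lemma Cc_infinity_partial_continuous: "f \<in> Cc_infinity \<Omega> \<Longrightarrow> continuous_on UNIV (partial i f)"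
  using Cc_infinity_imp_Ck[of f \<Omega> "Suc 0"] by simp

lemma Cc_infinity_support:
  assumes "f \<in> Cc_infinity \<Omega>"
  shows "\<exists>K. compact K \<and> K \<subseteq> \<Omega> \<and> (\<forall>x. x \<notin> K \<longrightarrow> f x = 0 \<and> (\<forall>i. partial i f x = 0))"
proof (intro exI conjI allI impI)
  let ?K = "closure {x. f x \<noteq> 0}"
  show "compact ?K" "?K \<subseteq> \<Omega>" using assms by (auto simp: Cc_infinity_def)
  fix x assume x: "x \<notin> ?K"
  then show "f x = 0" using nonzero_imp_mem_support[of f x] by blast
  show "partial i f x = 0" for i
  proof (rule partial_zero_outside_open[of "- ?K"])
    show "f y = 0" if "y \<in> - ?K" for y using that nonzero_imp_mem_support[of f y] by blast
  qed (use x in \<open>simp_all add: open_Compl\<close>)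
qed

lemma Cc_infinityI:
  assumes "\<And>k. Ck k f" "compact K" "K \<subseteq> \<Omega>" "\<And>x. x \<notin> K \<Longrightarrow> f x = 0"
  shows "f \<in> Cc_infinity \<Omega>"
proof -
  have sub: "closure {x. f x \<noteq> 0} \<subseteq> K"
    using assms by (intro closure_minimal compact_imp_closed) auto
  then have "compact (closure {x. f x \<noteq> 0})"
    using compact_Int_closed[OF assms(2) closed_closure[of "{x. f x \<noteq> 0}"]] by (simp add: Int_absorb1)
  then show ?thesis using assms(1,3) sub unfolding Cc_infinity_def by blast
qed

lemma Cc_infinity_lin:
  assumes f: "f \<in> Cc_infinity \<Omega>" and g: "g \<in> Cc_infinity \<Omega>"
  shows "(\<lambda>x. f x + t *\<^sub>R g x) \<in> Cc_infinity \<Omega>"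
proof -
  obtain K where "compact K" "K \<subseteq> \<Omega>" "\<forall>x. x \<notin> K \<longrightarrow> f x = 0"
    using Cc_infinity_support[OF f] by auto
  moreover obtain L where "compact L" "L \<subseteq> \<Omega>" "\<forall>x. x \<notin> L \<longrightarrow> g x = 0"
    using Cc_infinity_support[OF g] by auto
  ultimately show ?thesis
    by (intro Cc_infinityI[of _ "K \<union> L"] Ck_add Ck_scaleR Ck_const Cc_infinity_imp_Ck[OF f] Cc_infinity_imp_Ck[OF g])
      auto
qed

lemma Cc_infinity_zero: "(\<lambda>x. 0) \<in> Cc_infinity \<Omega>"
  by (rule Cc_infinityI[of _ "{}"]) (auto simp: Ck_const)

section \<open>Integrals of partial derivatives\<close>

lemma integrable_continuous_compact_support:
  fixes f :: "'a::euclidean_space \<Rightarrow> 'b::euclidean_space"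
  assumes "continuous_on UNIV f" "\<And>x. R < norm x \<Longrightarrow> f x = 0"
  shows "integrable lborel f"
proof -
  have "integrable lborel (\<lambda>x. indicator (cball 0 R) x *\<^sub>R f x)"
    by (rule borel_integrable_compact[OF compact_cball continuous_on_subset[OF assms(1) subset_UNIV]])
  moreover have "(\<lambda>x. indicator (cball 0 R) x *\<^sub>R f x) = f"
  proof
    show "indicator (cball 0 R) x *\<^sub>R f x = f x" for x
      using assms(2)[of x] by (cases "R < norm x") auto
  qed
  ultimately show ?thesis by simp
qed

lemma bounded_continuous_compact_support:
  fixes f :: "'a::euclidean_space \<Rightarrow> 'b::euclidean_space"
  assumes "continuous_on UNIV f" "\<And>x. R < norm x \<Longrightarrow> f x = 0"
  shows "\<exists>B\<ge>0. \<forall>x. norm (f x) \<le> B"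
proof -
  have "compact (f ` cball 0 R)"
    by (rule compact_continuous_image[OF continuous_on_subset[OF assms(1) subset_UNIV] compact_cball])
  from compact_imp_bounded[OF this] obtain B where B: "\<forall>y \<in> f ` cball 0 R. norm y \<le> B"
    unfolding bounded_iff by blast
  have "norm (f x) \<le> max B 0" for x
  proof (cases "norm x \<le> R")
    case True
    then have "norm (f x) \<le> B" using B by simp
    then show ?thesis by simp
  next
    case False
    then show ?thesis using assms(2)[of x] by simp
  qed
  then show ?thesis by (intro exI[of _ "max B 0"]) auto
qed

lemma integral_lborel_translate:
  fixes f :: "'a::euclidean_space \<Rightarrow> 'b::euclidean_space"
  assumes "f \<in> borel_measurable borel"
  shows "(LINT x|lborel. f (x + a)) = (LINT x|lborel. f x)"
proof -
  have "(LINT x|lborel. f x) = (LINT x|distr lborel borel ((+) a). f x)"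
    by (simp add: lborel_distr_plus)
  also have "\<dots> = (LINT x|lborel. f (a + x))"
    by (rule integral_distr) (use assms in auto)
  finally show ?thesis by (simp add: add.commute)
qed

definition diff_quot :: "'n::finite \<Rightarrow> real \<Rightarrow> (real ^ 'n \<Rightarrow> 'b::real_normed_vector) \<Rightarrow> real ^ 'n \<Rightarrow> 'b" where
  "diff_quot i h f x = (f (x + h *\<^sub>R axis i 1) - f x) /\<^sub>R h"

lemma has_derivative_along_axis:
  assumes "f differentiable (at (x + s *\<^sub>R axis i 1))"
  shows "((\<lambda>s. f (x + s *\<^sub>R axis i 1)) has_derivative (\<lambda>t. t *\<^sub>R partial i f (x + s *\<^sub>R axis i 1))) (at s)"
proof -
  let ?D = "frechet_derivative f (at (x + s *\<^sub>R axis i 1))"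
  have f: "(f has_derivative ?D) (at (x + s *\<^sub>R axis i 1))"
    using assms by (simp only: frechet_derivative_works)
  have g: "((\<lambda>s. x + s *\<^sub>R axis i 1) has_derivative (\<lambda>t. t *\<^sub>R axis i 1)) (at s)"
    by (rule has_derivative_eq_rhs[OF has_derivative_add[OF has_derivative_const has_derivative_scaleR_left[OF has_derivative_ident]]]) simp
  have "((\<lambda>s. f (x + s *\<^sub>R axis i 1)) has_derivative (\<lambda>t. ?D (t *\<^sub>R axis i 1))) (at s)"
    using has_derivative_compose[OF g f] .
  moreover have "?D (t *\<^sub>R axis i 1) = t *\<^sub>R partial i f (x + s *\<^sub>R axis i 1)" for t
    unfolding partial_def by (rule linear_scale[OF has_derivative_linear[OF f]])
  ultimately show ?thesis by simp
qed

lemma diff_quot_tendsto: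
  assumes "f differentiable (at x)"
  shows "((\<lambda>h. diff_quot i h f x) \<longlongrightarrow> partial i f x) (at 0)"
proof -
  have "((\<lambda>s. f (x + s *\<^sub>R axis i 1)) has_derivative (\<lambda>t. t *\<^sub>R partial i f x)) (at 0)"
    using has_derivative_along_axis[of f x 0 i] assms by simp
  then have lim: "((\<lambda>h. norm (f (x + h *\<^sub>R axis i 1) - f x - h *\<^sub>R partial i f x) / norm h) \<longlongrightarrow> 0) (at 0)"
    by (simp add: has_derivative_iff_norm)
  have eq: "norm (f (x + h *\<^sub>R axis i 1) - f x - h *\<^sub>R partial i f x) / norm h =
      norm (diff_quot i h f x - partial i f x)" if "h \<noteq> 0" for h
  proof -
    have "diff_quot i h f x - partial i f x = (f (x + h *\<^sub>R axis i 1) - f x - h *\<^sub>R partial i f x) /\<^sub>R h"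
      using that by (simp add: diff_quot_def scaleR_diff_right)
    then show ?thesis using that by (simp add: divide_inverse mult.commute)
  qed
  have "((\<lambda>h. norm (diff_quot i h f x - partial i f x)) \<longlongrightarrow> 0) (at 0)"
    by (rule Lim_transform_eventually[OF lim]) (use eq in \<open>auto simp: eventually_at_filter\<close>)
  then show ?thesis
    by (rule LIM_zero_cancel[OF tendsto_norm_zero_cancel])
qed

lemma diff_quot_bound:
  assumes f: "\<And>x. f differentiable (at x)" and B: "\<And>x. norm (partial i f x) \<le> B" and h: "h \<noteq> 0"
  shows "norm (diff_quot i h f x) \<le> B"
proof -
  have "norm (f (x + h *\<^sub>R axis i 1) - f (x + 0 *\<^sub>R axis i 1)) \<le> B * norm (h - 0)"
  proof (rule differentiable_bound[of UNIV "\<lambda>s. f (x + s *\<^sub>R axis i 1)"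
        "\<lambda>s t. t *\<^sub>R partial i f (x + s *\<^sub>R axis i 1)" B h 0])
    show "onorm (\<lambda>t. t *\<^sub>R partial i f (x + s *\<^sub>R axis i 1)) \<le> B" for s
    proof (rule onorm_le)
      show "norm (t *\<^sub>R partial i f (x + s *\<^sub>R axis i 1)) \<le> B * norm t" for t
        using mult_left_mono[OF B[of "x + s *\<^sub>R axis i 1"], of "\<bar>t\<bar>"] by (simp add: mult.commute)
    qed
  qed (use has_derivative_along_axis[OF f] in auto)
  then have "norm (f (x + h *\<^sub>R axis i 1) - f x) / \<bar>h\<bar> \<le> B" using h by (simp add: divide_le_eq)
  then show ?thesis by (simp add: diff_quot_def divide_inverse mult.commute)
qed

lemma diff_quot_continuous:
  assumes "continuous_on UNIV f"
  shows "continuous_on UNIV (diff_quot i h f)"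
proof -
  have "continuous_on UNIV (\<lambda>x. f (x + h *\<^sub>R axis i 1))"
    by (rule continuous_on_compose2[OF assms]) (auto intro!: continuous_intros)
  then show ?thesis unfolding diff_quot_def[abs_def] using assms by (intro continuous_intros)
qed

lemma diff_quot_support:
  assumes "\<And>x. R < norm x \<Longrightarrow> f x = 0" "\<bar>h\<bar> \<le> 1" "R + 1 < norm x"
  shows "diff_quot i h f x = 0"
proof -
  have "norm x \<le> norm (x + h *\<^sub>R axis i 1) + norm (h *\<^sub>R axis i (1::real))"
    using norm_triangle_ineq4[of "x + h *\<^sub>R axis i 1" "h *\<^sub>R axis i (1::real)"] by simp
  then have "R < norm (x + h *\<^sub>R axis i 1)" "R < norm x" using assms(2,3) by (auto simp: norm_axis_1)
  then show ?thesis using assms(1) by (simp add: diff_quot_def)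
qed

text \<open>
  Difference quotients of a \<open>C\<^sup>1\<close> function are bounded by the maximum of the partial derivative and
  live on a slightly larger ball, so dominated convergence applies. The bounded factor \<open>g n\<close> is needed
  for products of two difference quotients.
\<close>

lemma diff_quot_integral_tendsto:
  fixes f :: "real ^ 'n::finite \<Rightarrow> 'b::euclidean_space" and g :: "nat \<Rightarrow> real ^ 'n \<Rightarrow> real"
  assumes f: "\<And>x. f differentiable (at x)" and f': "continuous_on UNIV (partial i f)"
    and supp: "\<And>x. R < norm x \<Longrightarrow> f x = 0"
    and h: "h \<longlonglongrightarrow> 0" "\<And>n. h n \<noteq> 0" "\<And>n. \<bar>h n\<bar> \<le> 1"
    and g: "\<And>n. continuous_on UNIV (g n)" "\<And>n x. norm (g n x) \<le> A" "\<And>x. (\<lambda>n. g n x) \<longlonglongrightarrow> g' x"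
  shows "(\<lambda>n. LINT x|lborel. g n x *\<^sub>R diff_quot i (h n) f x) \<longlonglongrightarrow> (LINT x|lborel. g' x *\<^sub>R partial i f x)"
proof -
  have cf: "continuous_on UNIV f"
    using f by (auto intro!: continuous_at_imp_continuous_on differentiable_imp_continuous_within)
  have p0: "partial i f x = 0" if "R < norm x" for x
    by (rule partial_zero_outside_open[of "{x. R < norm x}"]) (use supp that in \<open>auto intro!: open_Collect_less continuous_intros\<close>)
  obtain B where B: "B \<ge> 0" "\<And>x. norm (partial i f x) \<le> B"
    using bounded_continuous_compact_support[OF f' p0] by blast
  show ?thesis
  proof (rule integral_dominated_convergence)
    show "integrable lborel (\<lambda>x::real ^ 'n. A * B * indicator (cball 0 (R + 1)) x)"
      using emeasure_bounded_finite[OF bounded_cball, of "0 :: real ^ 'n" "R + 1"]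
      by (intro integrable_mult_right integrable_real_indicator) auto
    have gm [measurable]: "g n \<in> borel_measurable borel" for n
      by (rule borel_measurable_continuous_onI[OF g(1)])
    have "g' \<in> borel_measurable borel"
      by (rule borel_measurable_LIMSEQ_metric[OF gm g(3)])
    then show "(\<lambda>x. g' x *\<^sub>R partial i f x) \<in> borel_measurable lborel"
      using borel_measurable_continuous_onI[OF f'] by simp
    show "(\<lambda>x. g n x *\<^sub>R diff_quot i (h n) f x) \<in> borel_measurable lborel" for n
      using borel_measurable_continuous_onI[OF diff_quot_continuous[OF cf], of i "h n"] by simp
    show "AE x in lborel. (\<lambda>n. g n x *\<^sub>R diff_quot i (h n) f x) \<longlonglongrightarrow> g' x *\<^sub>R partial i f x"
    proof (intro AE_I2 tendsto_scaleR g(3))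
      fix x
      have "filterlim h (at 0) sequentially" using h by (auto simp: filterlim_at)
      from filterlim_compose[OF diff_quot_tendsto[OF f] this]
      show "(\<lambda>n. diff_quot i (h n) f x) \<longlonglongrightarrow> partial i f x" .
    qed
    show "AE x in lborel. norm (g n x *\<^sub>R diff_quot i (h n) f x) \<le> A * B * indicator (cball 0 (R + 1)) x" for n
    proof (intro AE_I2)
      fix x
      have A: "0 \<le> A" using order_trans[OF norm_ge_zero g(2)] .
      show "norm (g n x *\<^sub>R diff_quot i (h n) f x) \<le> A * B * indicator (cball 0 (R + 1)) x"
      proof (cases "norm x \<le> R + 1")
        case True
        then show ?thesis
          using mult_mono[OF g(2)[of n x] diff_quot_bound[OF f B(2) h(2)[of n], of x] A norm_ge_zero]
          by simp
      next
        case False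
        then show ?thesis using diff_quot_support[of R f "h n" x i] supp h(3)[of n] by simp
      qed
    qed
  qed
qed

text \<open>
  Difference quotients have integral \<open>0\<close> by translation invariance of Lebesgue measure.
\<close>

lemma integral_partial_zero:
  fixes f :: "real ^ 'n::finite \<Rightarrow> 'b::euclidean_space"
  assumes f: "\<And>x. f differentiable (at x)" and f': "continuous_on UNIV (partial i f)"
    and supp: "\<And>x. R < norm x \<Longrightarrow> f x = 0"
  shows "(LINT x|lborel. partial i f x) = 0"
proof -
  have cf: "continuous_on UNIV f"
    using f by (auto intro!: continuous_at_imp_continuous_on differentiable_imp_continuous_within)
  have int: "integrable lborel (\<lambda>x. f (x + a))" for a
  proof (rule integrable_continuous_compact_support[where R = "R + norm a"])
    show "continuous_on UNIV (\<lambda>x. f (x + a))"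
      by (intro continuous_on_compose2[OF cf] continuous_intros) auto
    show "f (x + a) = 0" if "R + norm a < norm x" for x
      using that norm_triangle_ineq4[of "x + a" a] by (intro supp) simp
  qed
  have "(LINT x|lborel. diff_quot i h f x) = 0" for h
    using int[of "h *\<^sub>R axis i 1"] int[of 0]
    by (simp add: diff_quot_def integral_lborel_translate[OF borel_measurable_continuous_onI[OF cf]])
  moreover have "(\<lambda>n. LINT x|lborel. 1 *\<^sub>R diff_quot i (inverse (real (Suc n))) f x) \<longlonglongrightarrow> (LINT x|lborel. 1 *\<^sub>R partial i f x)"
    by (rule diff_quot_integral_tendsto[OF f f' supp, where A = 1 and h = "\<lambda>n. inverse (real (Suc n))"])
      (use LIMSEQ_inverse_real_of_nat in \<open>auto simp: field_simps\<close>)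
  ultimately show ?thesis by (simp add: LIMSEQ_const_iff)
qed

text \<open>
  For smooth functions this is two integrations by parts. With a forward difference quotient for \<open>f\<close>
  and a backward one for \<open>g\<close> it is an identity: by translation invariance both sides are expressed
  through the correlation \<open>T a = \<integral> f (x + a) * g x\<close> in a way that is symmetric in \<open>i\<close> and \<open>j\<close>. Thus only
  first derivatives occur.
\<close>

lemma integral_partial_partial_swap:
  fixes f g :: "real ^ 'n::finite \<Rightarrow> real"
  assumes f: "\<And>x. f differentiable (at x)" "\<And>i. continuous_on UNIV (partial i f)" "\<And>x. R < norm x \<Longrightarrow> f x = 0"
    and g: "\<And>x. g differentiable (at x)" "\<And>i. continuous_on UNIV (partial i g)" "\<And>x. R < norm x \<Longrightarrow> g x = 0"
  shows "(LINT x|lborel. partial i f x * partial j g x) = (LINT x|lborel. partial j f x * partial i g x)"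
proof -
  have cf: "continuous_on UNIV f" and cg: "continuous_on UNIV g"
    using f(1) g(1) by (auto intro!: continuous_at_imp_continuous_on differentiable_imp_continuous_within)
  note [measurable] = borel_measurable_continuous_onI[OF cf] borel_measurable_continuous_onI[OF cg]
  have int: "integrable lborel (\<lambda>x. f (x + a) * g (x + b))" for a b
  proof (rule integrable_continuous_compact_support[where R = "R + norm a"])
    show "continuous_on UNIV (\<lambda>x. f (x + a) * g (x + b))"
      by (intro continuous_intros continuous_on_compose2[OF cf] continuous_on_compose2[OF cg]) auto
    show "f (x + a) * g (x + b) = 0" if "R + norm a < norm x" for x
      using that norm_triangle_ineq4[of "x + a" a] f(3)[of "x + a"] by simp
  qed
  define T where "T a = (LINT x|lborel. f (x + a) * g x)" for a
  have T: "(LINT x|lborel. f (x + a) * g (x + b)) = T (a - b)" for a b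
    using integral_lborel_translate[of "\<lambda>x. f (x + (a - b)) * g x" b] by (simp add: T_def algebra_simps)
  let ?e = "\<lambda>i. axis i (1::real) :: real ^ 'n"
  have quot: "(LINT x|lborel. diff_quot i h f x * diff_quot j (- h) g x) =
      - (T (h *\<^sub>R ?e i + h *\<^sub>R ?e j) - T (h *\<^sub>R ?e i) - T (h *\<^sub>R ?e j) + T 0) / h\<^sup>2" for h i j
  proof -
    have "(LINT x|lborel. diff_quot i h f x * diff_quot j (- h) g x) =
       (LINT x|lborel. - (1 / h\<^sup>2) * (f (x + h *\<^sub>R ?e i) * g (x + (- h) *\<^sub>R ?e j) - f (x + h *\<^sub>R ?e i) * g (x + 0)
           - f (x + 0) * g (x + (- h) *\<^sub>R ?e j) + f (x + 0) * g (x + 0)))"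
      by (rule Bochner_Integration.integral_cong)
        (auto simp: diff_quot_def power2_eq_square divide_inverse algebra_simps)
    also have "\<dots> = - (1 / h\<^sup>2) * (T (h *\<^sub>R ?e i - (- h) *\<^sub>R ?e j) - T (h *\<^sub>R ?e i - 0) - T (0 - (- h) *\<^sub>R ?e j) + T (0 - 0))"
      unfolding T[symmetric]
      by (subst Bochner_Integration.integral_mult_right_zero)
        (simp only: Bochner_Integration.integral_add Bochner_Integration.integral_diff int
          Bochner_Integration.integrable_diff Bochner_Integration.integrable_add)
    finally show ?thesis by (simp add: diff_divide_distrib add_divide_distrib algebra_simps)
  qed
  have lim: "(\<lambda>n. LINT x|lborel. diff_quot i (inverse (real (Suc n))) f x * diff_quot j (- inverse (real (Suc n))) g x)
      \<longlonglongrightarrow> (LINT x|lborel. partial i f x * partial j g x)" for i j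
  proof -
    have p0: "partial i f x = 0" if "R < norm x" for x
      by (rule partial_zero_outside_open[of "{x. R < norm x}"])
        (use f(3) that in \<open>auto intro!: open_Collect_less continuous_intros\<close>)
    obtain B where B: "B \<ge> 0" "\<And>x. norm (partial i f x) \<le> B"
      using bounded_continuous_compact_support[OF f(2) p0] by blast
    have inv: "filterlim (\<lambda>n. inverse (real (Suc n))) (at 0) sequentially"
      using LIMSEQ_inverse_real_of_nat by (auto simp: filterlim_at)
    have "(\<lambda>n. LINT x|lborel. diff_quot i (inverse (real (Suc n))) f x *\<^sub>R diff_quot j (- inverse (real (Suc n))) g x)
      \<longlonglongrightarrow> (LINT x|lborel. partial i f x *\<^sub>R partial j g x)"
    proof (rule diff_quot_integral_tendsto[OF g(1,2,3), where A = B and h = "\<lambda>n. - inverse (real (Suc n))"])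
      show "(\<lambda>n. - inverse (real (Suc n))) \<longlonglongrightarrow> 0"
        using tendsto_minus[OF LIMSEQ_inverse_real_of_nat] by simp
      show "\<bar>- inverse (real (Suc n))\<bar> \<le> 1" for n by (simp add: field_simps)
      show "continuous_on UNIV (diff_quot i (inverse (real (Suc n))) f)" for n
        by (rule diff_quot_continuous[OF cf])
      show "norm (diff_quot i (inverse (real (Suc n))) f x) \<le> B" for n x
        by (rule diff_quot_bound[OF f(1) B(2)]) simp
      show "(\<lambda>n. diff_quot i (inverse (real (Suc n))) f x) \<longlonglongrightarrow> partial i f x" for x
        by (rule filterlim_compose[OF diff_quot_tendsto[OF f(1)] inv])
    qed auto
    then show ?thesis by simp
  qed
  show ?thesis
  proof (rule LIMSEQ_unique[OF lim])
    show "(\<lambda>n. LINT x|lborel. diff_quot i (inverse (real (Suc n))) f x * diff_quot j (- inverse (real (Suc n))) g x)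
      \<longlonglongrightarrow> (LINT x|lborel. partial j f x * partial i g x)"
      using lim[of j i] unfolding quot by (simp add: algebra_simps)
  qed
qed

section \<open>Test functions separate locally integrable functions\<close>

text \<open>
  For \<open>p = 1\<close> this is the classical smooth function \<open>exp (- 1 / t)\<close>; the polynomial factor makes the
  family closed under differentiation.
\<close>

definition bump :: "real poly \<Rightarrow> real \<Rightarrow> real" where
  "bump p t = (if 0 < t then poly p (1 / t) * exp (- (1 / t)) else 0)"

lemma tendsto_poly_times_exp_minus: "((\<lambda>y. poly p y * exp (- y)) \<longlongrightarrow> (0::real)) at_top"
proof -
  have "((\<lambda>y. \<Sum>i\<le>degree p. coeff p i * (y ^ i / exp y)) \<longlongrightarrow> (\<Sum>i\<le>degree p. coeff p i * 0)) at_top"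
    by (intro tendsto_sum tendsto_mult tendsto_const tendsto_power_div_exp_0)
  moreover have "(\<Sum>i\<le>degree p. coeff p i * (y ^ i / exp y)) = poly p y * exp (- y)" for y :: real
    by (simp add: poly_altdef sum_distrib_right exp_minus divide_inverse mult.assoc)
  ultimately show ?thesis by simp
qed

lemma bump_tendsto_zero: "(bump p \<longlongrightarrow> 0) (at 0)"
proof (rule filterlim_split_at)
  have "((\<lambda>t. poly p (inverse t) * exp (- inverse t)) \<longlongrightarrow> 0) (at_right 0)"
    by (rule filterlim_compose[OF tendsto_poly_times_exp_minus filterlim_inverse_at_top_right])
  then show "(bump p \<longlongrightarrow> 0) (at_right 0)"
    by (rule Lim_transform_eventually) (auto simp: bump_def eventually_at_filter inverse_eq_divide)
  show "(bump p \<longlongrightarrow> 0) (at_left 0)"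
    by (rule tendsto_eventually) (auto simp: bump_def eventually_at_filter)
qed

lemma bump_DERIV: "(bump p has_real_derivative bump (monom 1 2 * (p - pderiv p)) t) (at t)"
proof -
  consider "0 < t" | "t < 0" | "t = 0" by linarith
  then show ?thesis
  proof cases
    case 1
    have "((\<lambda>t. poly p (1 / t) * exp (- (1 / t))) has_real_derivative
        poly (monom 1 2 * (p - pderiv p)) (1 / t) * exp (- (1 / t))) (at t)"
      using 1 by (auto intro!: derivative_eq_intros DERIV_chain2[OF poly_DERIV]
          simp: poly_monom field_simps power2_eq_square)
    then show ?thesis
      unfolding bump_def[of _ t] using 1
      by simp (rule has_field_derivative_transform_within_open[where S = "{0<..}"], auto simp: bump_def)
  next
    case 2
    have "(bump p has_real_derivative 0) (at t)"
      by (rule has_field_derivative_transform_within_open[OF DERIV_const[where k = 0], where S = "{..<0}"])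
        (use 2 in \<open>auto simp: bump_def\<close>)
    then show ?thesis using 2 by (simp add: bump_def)
  next
    case 3
    \<comment> \<open>the difference quotient at \<open>0\<close> is again a bump, with one more factor \<open>1 / h\<close>\<close>
    have "((\<lambda>h. bump (monom 1 1 * p) h) \<longlongrightarrow> 0) (at 0)" by (rule bump_tendsto_zero)
    then have "((\<lambda>h. (bump p (0 + h) - bump p 0) / h) \<longlongrightarrow> 0) (at 0)"
      by (rule Lim_transform_eventually) (auto simp: bump_def eventually_at_filter poly_monom)
    then show ?thesis using 3 by (simp add: DERIV_def bump_def)
  qed
qed

lemma Ck_bump: "Ck k (\<lambda>x :: real ^ 'n::finite. bump p (x \<bullet> a + b))"
proof (induction k arbitrary: p)
  case 0
  have "continuous_on UNIV (bump p)"
    by (intro continuous_at_imp_continuous_on ballI DERIV_isCont[OF bump_DERIV])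
  then have "continuous_on UNIV (\<lambda>x :: real ^ 'n. bump p (x \<bullet> a + b))"
    by (rule continuous_on_compose2) (auto intro!: continuous_intros)
  then show ?case by simp
next
  case (Suc k)
  let ?q = "monom 1 2 * (p - pderiv p)"
  have der: "((\<lambda>x :: real ^ 'n. bump p (x \<bullet> a + b)) has_derivative (\<lambda>h. bump ?q (x \<bullet> a + b) * (h \<bullet> a))) (at x)" for x
  proof -
    have "((\<lambda>x. x \<bullet> a + b) has_derivative (\<lambda>h. h \<bullet> a)) (at x)"
      by (auto intro!: derivative_eq_intros)
    from has_derivative_compose[OF this bump_DERIV[unfolded has_field_derivative_def]]
    show ?thesis .
  qed
  have "partial i (\<lambda>x :: real ^ 'n. bump p (x \<bullet> a + b)) = (\<lambda>x. (axis i 1 \<bullet> a) *\<^sub>R bump ?q (x \<bullet> a + b))" for i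
    by (rule ext) (simp add: partial_eq[OF der] mult.commute)
  moreover have "Ck k (\<lambda>x :: real ^ 'n. (axis i 1 \<bullet> a) *\<^sub>R bump ?q (x \<bullet> a + b))" for i
    by (rule Ck_scaleR[OF Ck_const Suc.IH])
  moreover have "(\<lambda>x :: real ^ 'n. bump p (x \<bullet> a + b)) differentiable (at x)" for x
    using der differentiable_def by blast
  ultimately show ?case by simp
qed

text \<open>
  A product over the coordinates of the ramps \<open>exp (- 1 / (n * t))\<close>, where \<open>t\<close> is the distance to a
  face of the box. As \<open>n\<close> grows, every ramp tends to \<open>1\<close> for \<open>t > 0\<close> and stays \<open>0\<close> for \<open>t \<le> 0\<close>.
\<close>

lemma test_functions_approximate_box:
  fixes a b :: "real ^ 'n::finite"
  obtains \<eta> :: "nat \<Rightarrow> real ^ 'n \<Rightarrow> real"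
  where "\<And>n k. Ck k (\<eta> n)" "\<And>n x. x \<notin> cbox a b \<Longrightarrow> \<eta> n x = 0" "\<And>n x. \<bar>\<eta> n x\<bar> \<le> 1"
    "\<And>x. (\<lambda>n. \<eta> n x) \<longlonglongrightarrow> indicator (box a b) x"
proof -
  define ramp where "ramp n t = bump 1 (real n * t)" for n t
  have ramp_range: "0 \<le> ramp n t \<and> ramp n t \<le> 1" for n t by (simp add: ramp_def bump_def)
  have ramp_lim: "(\<lambda>n. ramp n t) \<longlonglongrightarrow> (if 0 < t then 1 else 0)" for t
  proof (cases "0 < t")
    case True
    have "(\<lambda>n. exp (- ((1 / t) * inverse (real n)))) \<longlonglongrightarrow> exp (- ((1 / t) * 0))"
      by (intro tendsto_intros lim_inverse_n)
    moreover have "\<forall>\<^sub>F n in sequentially. exp (- ((1 / t) * inverse (real n))) = ramp n t"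
      using eventually_gt_at_top[of 0] by eventually_elim (use True in \<open>simp add: ramp_def bump_def divide_inverse mult.commute\<close>)
    ultimately show ?thesis using True Lim_transform_eventually by fastforce
  next
    case False
    then have "\<not> 0 < real n * t" for n by (simp add: zero_less_mult_iff)
    then show ?thesis using False by (simp add: ramp_def bump_def)
  qed
  define \<eta> where "\<eta> n x = (\<Prod>i\<in>UNIV. ramp n (x $ i - a $ i) *\<^sub>R ramp n (b $ i - x $ i))" for n and x :: "real ^ 'n"
  show thesis
  proof
    fix n :: nat
    show "Ck k (\<eta> n)" for k
      unfolding \<eta>_def[abs_def]
    proof (intro Ck_prod Ck_scaleR)
      fix i :: 'n
      have "Ck k (\<lambda>x :: real ^ 'n. bump 1 (x \<bullet> (real n *\<^sub>R axis i 1) + (- real n * a $ i)))"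
        "Ck k (\<lambda>x :: real ^ 'n. bump 1 (x \<bullet> (- real n *\<^sub>R axis i 1) + real n * b $ i))"
        by (rule Ck_bump)+
      then show "Ck k (\<lambda>x. ramp n (x $ i - a $ i))" "Ck k (\<lambda>x. ramp n (b $ i - x $ i))"
        by (simp_all add: ramp_def inner_axis algebra_simps)
    qed simp
    show "\<eta> n x = 0" if x: "x \<notin> cbox a b" for x
    proof -
      obtain i where "x $ i < a $ i \<or> b $ i < x $ i"
        using x by (auto simp: mem_box_cart not_le)
      then have "ramp n (x $ i - a $ i) *\<^sub>R ramp n (b $ i - x $ i) = 0"
        by (auto simp: ramp_def bump_def zero_less_mult_iff)
      then show ?thesis unfolding \<eta>_def by (subst prod_zero_iff) auto
    qed
    show "\<bar>\<eta> n x\<bar> \<le> 1" for x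
    proof -
      have "0 \<le> \<eta> n x" unfolding \<eta>_def using ramp_range by (intro prod_nonneg) auto
      moreover have "\<eta> n x \<le> 1"
        unfolding \<eta>_def using ramp_range by (intro prod_le_1) (auto intro: mult_le_one)
      ultimately show ?thesis by simp
    qed
  next
    fix x
    have "(\<lambda>n. \<eta> n x) \<longlonglongrightarrow> (\<Prod>i\<in>UNIV. (if 0 < x $ i - a $ i then 1 else 0) *\<^sub>R (if 0 < b $ i - x $ i then 1 else 0))"
      unfolding \<eta>_def by (intro tendsto_prod tendsto_scaleR ramp_lim)
    also have "(\<Prod>i\<in>UNIV. (if 0 < x $ i - a $ i then 1 else 0) *\<^sub>R (if 0 < b $ i - x $ i then 1 else 0)) = (indicator (box a b) x :: real)"
    proof (cases "x \<in> box a b")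
      case True
      then show ?thesis by (simp add: mem_box_cart)
    next
      case False
      then obtain i where "\<not> (0 < x $ i - a $ i \<and> 0 < b $ i - x $ i)" by (auto simp: mem_box_cart)
      then show ?thesis using False by (subst prod_zero) auto
    qed
    finally show "(\<lambda>n. \<eta> n x) \<longlonglongrightarrow> indicator (box a b) x" .
  qed
qed

lemma integral_lebesgue_on_support:
  fixes f :: "'a::euclidean_space \<Rightarrow> 'b::euclidean_space"
  assumes S: "S \<in> sets lebesgue" and K: "K \<in> sets lebesgue" and sub: "K \<subseteq> S" and f: "\<And>x. x \<notin> K \<Longrightarrow> f x = 0"
  shows "integral\<^sup>L (lebesgue_on S) f = integral\<^sup>L (lebesgue_on K) f"
    and "integrable (lebesgue_on S) f \<longleftrightarrow> integrable (lebesgue_on K) f"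
proof -
  have "(\<lambda>x. if x \<in> S then f x else 0) = (\<lambda>x. if x \<in> K then f x else 0)"
    by (rule ext) (use f sub in auto)
  then show "integral\<^sup>L (lebesgue_on S) f = integral\<^sup>L (lebesgue_on K) f"
    "integrable (lebesgue_on S) f \<longleftrightarrow> integrable (lebesgue_on K) f"
    using Lebesgue_Measure.integral_restrict_UNIV[OF S, of f] Lebesgue_Measure.integral_restrict_UNIV[OF K, of f]
      Lebesgue_Measure.integrable_restrict_UNIV[OF S, of f] Lebesgue_Measure.integrable_restrict_UNIV[OF K, of f] by simp_all
qed

lemma integrable_continuous_times_locally_integrable:
  fixes \<Omega> :: "(real ^ 'n::finite) set" and g :: "real ^ 'n \<Rightarrow> 'b::euclidean_space" and \<eta> :: "real ^ 'n \<Rightarrow> real"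
  assumes \<Omega>: "open \<Omega>" and g: "locally_integrable \<Omega> g"
    and \<eta>: "continuous_on UNIV \<eta>" and K: "compact K" "K \<subseteq> \<Omega>" and 0: "\<And>x. x \<notin> K \<Longrightarrow> \<eta> x = 0"
  shows "integrable (lebesgue_on \<Omega>) (\<lambda>x. \<eta> x *\<^sub>R g x)"
proof -
  have gK: "integrable (lebesgue_on K) g" using g K by (simp add: locally_integrable_def)
  have sets: "\<Omega> \<in> sets lebesgue" "K \<in> sets lebesgue"
    using \<Omega> fmeasurableD[OF lmeasurable_compact[OF K(1)]] by auto
  from compact_imp_bounded[OF compact_continuous_image[OF continuous_on_subset[OF \<eta> subset_UNIV] K(1)]]
  obtain B where B: "\<forall>y\<in>\<eta> ` K. norm y \<le> B" unfolding bounded_iff by blast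
  have "integrable (lebesgue_on K) (\<lambda>x. \<eta> x *\<^sub>R g x)"
  proof (rule Bochner_Integration.integrable_bound)
    show "integrable (lebesgue_on K) (\<lambda>x. B *\<^sub>R g x)" using gK by simp
    have "\<eta> \<in> borel_measurable lborel" using borel_measurable_continuous_onI[OF \<eta>] by simp
    then have "\<eta> \<in> borel_measurable (lebesgue_on K)"
      by (intro measurable_restrict_space1 measurable_completion)
    then show "(\<lambda>x. \<eta> x *\<^sub>R g x) \<in> borel_measurable (lebesgue_on K)"
      using borel_measurable_integrable[OF gK] by (rule borel_measurable_scaleR)
    show "AE x in lebesgue_on K. norm (\<eta> x *\<^sub>R g x) \<le> norm (B *\<^sub>R g x)"
    proof (rule AE_I2)
      fix x assume "x \<in> space (lebesgue_on K)"
      then have "\<bar>\<eta> x\<bar> \<le> B" using B by simp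
      then have "\<bar>\<eta> x\<bar> \<le> \<bar>B\<bar>" by linarith
      then show "norm (\<eta> x *\<^sub>R g x) \<le> norm (B *\<^sub>R g x)" by (simp add: mult_right_mono)
    qed
  qed
  then show ?thesis
    using integral_lebesgue_on_support(2)[OF sets K(2), of "\<lambda>x. \<eta> x *\<^sub>R g x"] 0 by simp
qed

text \<open>
  By the Lebesgue differentiation theorem, almost every value of \<open>g\<close> is a limit of averages over small
  boxes, all of which vanish.
\<close>

lemma zero_integral_on_boxes_imp_zero:
  fixes g :: "'a::euclidean_space \<Rightarrow> 'b::euclidean_space"
  assumes int: "g integrable_on cbox a b" and zero: "\<And>c d. cbox c d \<subseteq> cbox a b \<Longrightarrow> integral (cbox c d) g = 0"
  shows "AE x in lebesgue. x \<in> cbox a b \<longrightarrow> g x = 0"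
proof -
  define f where "f x = (if x \<in> cbox a b then g x else 0)" for x
  have "f integrable_on cbox c d" for c d
    unfolding f_def using int by (rule integrable_altD(1))
  then obtain N where N: "negligible N"
    "\<And>x e. \<lbrakk>x \<notin> N; 0 < e\<rbrakk> \<Longrightarrow>
       \<exists>d>0. \<forall>h. 0 < h \<and> h < d \<longrightarrow> norm (integral (cbox x (x + h *\<^sub>R One)) f /\<^sub>R h ^ DIM('a) - f x) < e"
    using integrable_ccontinuous_explicit[of f] by metis
  have "g x = 0" if x: "x \<in> cbox a b" "x \<notin> N" "x \<notin> cbox a b - box a b" for x
  proof (rule ccontr)
    assume nz: "g x \<noteq> 0"
    have xb: "x \<in> box a b" using x by blast
    obtain d where d: "d > 0" "\<And>h. 0 < h \<Longrightarrow> h < d \<Longrightarrow>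
        norm (integral (cbox x (x + h *\<^sub>R One)) f /\<^sub>R h ^ DIM('a) - f x) < norm (g x)"
      using N(2)[OF x(2), of "norm (g x)"] nz by auto
    obtain e where e: "e > 0" "ball x e \<subseteq> box a b" using xb open_box open_contains_ball by blast
    define h where "h = min (d / 2) (e / (2 * norm (One :: 'a)))"
    have n1: "0 < norm (One :: 'a)" by (simp add: norm_le_zero_iff)
    have h: "0 < h" "h < d" "h * norm (One :: 'a) < e"
    proof -
      show "0 < h" "h < d" using d(1) e(1) n1 by (auto simp: h_def)
      have "h * norm (One :: 'a) \<le> e / (2 * norm (One :: 'a)) * norm (One :: 'a)"
        using n1 by (intro mult_right_mono) (auto simp: h_def)
      also have "\<dots> < e" using n1 e(1) by simp
      finally show "h * norm (One :: 'a) < e" .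
    qed
    have "x + h *\<^sub>R One \<in> ball x e" using h by (simp add: dist_norm)
    then have "x + h *\<^sub>R One \<in> cbox a b" using e(2) box_subset_cbox by blast
    then have sub: "cbox x (x + h *\<^sub>R One) \<subseteq> cbox a b" using x(1) by (auto simp: subset_box mem_box)
    have "integral (cbox x (x + h *\<^sub>R One)) f = integral (cbox x (x + h *\<^sub>R One)) g"
      by (rule integral_cong) (use sub in \<open>auto simp: f_def\<close>)
    then have "integral (cbox x (x + h *\<^sub>R One)) f = 0" using zero[OF sub] by simp
    then show False using d(2)[OF h(1,2)] x(1) by (simp add: f_def)
  qed
  then have "{x. \<not> (x \<in> cbox a b \<longrightarrow> g x = 0)} \<subseteq> N \<union> (cbox a b - box a b)" by blast
  moreover have "negligible (N \<union> (cbox a b - box a b))"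
    using N(1) negligible_frontier_interval by (rule negligible_Un)
  ultimately have "negligible {x. \<not> (x \<in> cbox a b \<longrightarrow> g x = 0)}"
    by (rule negligible_subset[rotated])
  then show ?thesis
    by (simp add: negligible_iff_null_sets completion.AE_iff_null_sets)
qed

text \<open>
  The fundamental lemma of the calculus of variations. Approximating indicators of boxes by test
  functions shows that \<open>g\<close> has integral \<open>0\<close> over every box inside \<open>\<Omega>\<close>, and countably many such boxes
  cover \<open>\<Omega>\<close>.
\<close>

lemma test_functions_separate:
  fixes \<Omega> :: "(real ^ 'n::finite) set" and g :: "real ^ 'n \<Rightarrow> 'b::euclidean_space"
  assumes \<Omega>: "open \<Omega>" and g: "locally_integrable \<Omega> g"
    and zero: "\<And>\<eta> :: real ^ 'n \<Rightarrow> real. \<eta> \<in> Cc_infinity \<Omega> \<Longrightarrow> (LINT x|lebesgue_on \<Omega>. \<eta> x *\<^sub>R g x) = 0"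
  shows "AE x in lebesgue_on \<Omega>. g x = 0"
proof -
  have box0: "integral (cbox a b) g = 0" if ab: "cbox a b \<subseteq> \<Omega>" for a b
  proof -
    obtain \<eta> :: "nat \<Rightarrow> real ^ 'n \<Rightarrow> real" where \<eta>: "\<And>n k. Ck k (\<eta> n)" "\<And>n x. x \<notin> cbox a b \<Longrightarrow> \<eta> n x = 0"
      "\<And>n x. \<bar>\<eta> n x\<bar> \<le> 1" "\<And>x. (\<lambda>n. \<eta> n x) \<longlonglongrightarrow> indicator (box a b) x"
      using test_functions_approximate_box[of a b] by blast
    let ?M = "lebesgue_on (cbox a b)"
    have int: "integrable ?M g" using g ab by (simp add: locally_integrable_def)
    have sets: "\<Omega> \<in> sets lebesgue" "cbox a b \<in> sets lebesgue" using \<Omega> by auto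
    have z: "(LINT x|?M. \<eta> n x *\<^sub>R g x) = 0" for n
    proof -
      have "\<eta> n \<in> Cc_infinity \<Omega>"
        by (rule Cc_infinityI[OF \<eta>(1) compact_cbox ab \<eta>(2)])
      from zero[OF this] show ?thesis
        using integral_lebesgue_on_support(1)[OF sets ab, of "\<lambda>x. \<eta> n x *\<^sub>R g x"] \<eta>(2) by simp
    qed
    have "(\<lambda>n. LINT x|?M. \<eta> n x *\<^sub>R g x) \<longlonglongrightarrow> (LINT x|?M. indicator (box a b) x *\<^sub>R g x)"
    proof (rule integral_dominated_convergence)
      show "integrable ?M (\<lambda>x. norm (g x))" using int by simp
      have gm: "g \<in> borel_measurable ?M" using int by (rule borel_measurable_integrable)
      show "(\<lambda>x. indicator (box a b) x *\<^sub>R g x) \<in> borel_measurable ?M"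
        by (intro borel_measurable_scaleR gm measurable_restrict_space1 borel_measurable_indicator) auto
      show "(\<lambda>x. \<eta> n x *\<^sub>R g x) \<in> borel_measurable ?M" for n
      proof (rule borel_measurable_scaleR[OF _ gm])
        have "continuous_on UNIV (\<eta> n)" using \<eta>(1)[of 0 n] by simp
        then have "\<eta> n \<in> borel_measurable lborel" using borel_measurable_continuous_onI by simp
        then show "\<eta> n \<in> borel_measurable ?M" by (intro measurable_restrict_space1 measurable_completion)
      qed
      show "AE x in ?M. (\<lambda>n. \<eta> n x *\<^sub>R g x) \<longlonglongrightarrow> indicator (box a b) x *\<^sub>R g x"
        by (intro AE_I2 tendsto_scaleR \<eta>(4) tendsto_const)
      show "AE x in ?M. norm (\<eta> n x *\<^sub>R g x) \<le> norm (g x)" for n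
        using mult_right_mono[OF \<eta>(3)[of n] norm_ge_zero] by (intro AE_I2) simp
    qed
    then have "(LINT x|?M. indicator (box a b) x *\<^sub>R g x) = 0" by (simp add: z LIMSEQ_const_iff)
    moreover have "(LINT x|?M. indicator (box a b) x *\<^sub>R g x) = (LINT x|?M. g x)"
    proof (rule integral_cong_AE)
      have gm: "g \<in> borel_measurable ?M" using int by (rule borel_measurable_integrable)
      show "g \<in> borel_measurable ?M" by (rule gm)
      show "(\<lambda>x. indicator (box a b) x *\<^sub>R g x) \<in> borel_measurable ?M"
        by (intro borel_measurable_scaleR gm measurable_restrict_space1 borel_measurable_indicator) auto
      have "cbox a b - box a b \<in> null_sets lebesgue"
        using negligible_frontier_interval[of a b] by (simp add: negligible_iff_null_sets)
      then have "AE x in lebesgue. x \<notin> cbox a b - box a b" by (rule AE_not_in)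
      then have "AE x in lebesgue. x \<in> cbox a b \<longrightarrow> indicator (box a b) x *\<^sub>R g x = g x"
        by eventually_elim (auto simp: indicator_def)
      then show "AE x in ?M. indicator (box a b) x *\<^sub>R g x = g x" by (simp add: AE_restrict_space_iff)
    qed
    ultimately show ?thesis using lebesgue_integral_eq_integral[OF int] by simp
  qed
  obtain \<D> where \<D>: "countable \<D>" "\<D> \<subseteq> Pow \<Omega>" "\<And>X. X \<in> \<D> \<Longrightarrow> \<exists>a b. X = cbox a b" "\<Union>\<D> = \<Omega>"
    using open_countable_Union_open_cbox[OF \<Omega>] by metis
  have "AE x in lebesgue. x \<in> X \<longrightarrow> g x = 0" if X: "X \<in> \<D>" for X
  proof -
    obtain a b where ab: "X = cbox a b" using \<D>(3)[OF X] by blast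
    have sub: "cbox a b \<subseteq> \<Omega>" using X \<D>(2) ab by blast
    show ?thesis unfolding ab
    proof (rule zero_integral_on_boxes_imp_zero)
      have "integrable (lebesgue_on (cbox a b)) g" using g sub by (simp add: locally_integrable_def)
      then show "g integrable_on cbox a b" by (simp add: integrable_on_lebesgue_on)
      show "integral (cbox c d) g = 0" if "cbox c d \<subseteq> cbox a b" for c d
        using box0 that sub by blast
    qed
  qed
  then have "AE x in lebesgue. \<forall>X\<in>\<D>. x \<in> X \<longrightarrow> g x = 0"
    unfolding AE_ball_countable[OF \<D>(1)] by blast
  then have "AE x in lebesgue. x \<in> \<Omega> \<longrightarrow> g x = 0"
    by eventually_elim (use \<D>(4) in blast)
  then show ?thesis using \<Omega> by (simp add: AE_restrict_space_iff)
qed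

section \<open>Weak gradients and square integrable functions\<close>

lemma locally_integrable_lin:
  assumes "locally_integrable \<Omega> f" "locally_integrable \<Omega> g"
  shows "locally_integrable \<Omega> (\<lambda>x. f x + t *\<^sub>R g x)"
  using assms unfolding locally_integrable_def by auto

lemma locally_integrable_nth:
  fixes g :: "real ^ 'n::finite \<Rightarrow> 'b::euclidean_space ^ 'm::finite"
  assumes "locally_integrable \<Omega> g"
  shows "locally_integrable \<Omega> (\<lambda>x. g x $ i)"
  using assms unfolding locally_integrable_def
  by (auto intro: integrable_bounded_linear[OF bounded_linear_vec_nth])

lemma integrable_test_times:
  fixes \<Omega> :: "(real ^ 'n::finite) set" and g :: "real ^ 'n \<Rightarrow> 'b::euclidean_space" and \<eta> :: "real ^ 'n \<Rightarrow> real"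
  assumes "open \<Omega>" "locally_integrable \<Omega> g" "\<eta> \<in> Cc_infinity \<Omega>"
  shows "integrable (lebesgue_on \<Omega>) (\<lambda>x. \<eta> x *\<^sub>R g x)"
    and "integrable (lebesgue_on \<Omega>) (\<lambda>x. partial i \<eta> x *\<^sub>R g x)"
proof -
  obtain K where K: "compact K" "K \<subseteq> \<Omega>" and 0: "\<forall>x. x \<notin> K \<longrightarrow> \<eta> x = 0 \<and> (\<forall>i. partial i \<eta> x = 0)"
    using Cc_infinity_support[OF assms(3)] by blast
  show "integrable (lebesgue_on \<Omega>) (\<lambda>x. \<eta> x *\<^sub>R g x)"
    by (rule integrable_continuous_times_locally_integrable[OF assms(1,2) Cc_infinity_continuous[OF assms(3)] K])
      (use 0 in blast)
  show "integrable (lebesgue_on \<Omega>) (\<lambda>x. partial i \<eta> x *\<^sub>R g x)"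
    by (rule integrable_continuous_times_locally_integrable[OF assms(1,2) Cc_infinity_partial_continuous[OF assms(3)] K])
      (use 0 in blast)
qed

lemma integral_lin:
  fixes f g :: "'a \<Rightarrow> 'b::{banach, second_countable_topology}"
  assumes "integrable M f" "integrable M g"
  shows "(LINT x|M. f x + t *\<^sub>R g x) = (LINT x|M. f x) + t *\<^sub>R (LINT x|M. g x)"
  using assms by simp

lemma is_weak_grad_lin:
  fixes \<Omega> :: "(real ^ 'n::finite) set" and u v :: "real ^ 'n \<Rightarrow> 'b::euclidean_space"
  assumes \<Omega>: "open \<Omega>" and u: "is_weak_grad \<Omega> u g" and v: "is_weak_grad \<Omega> v h"
  shows "is_weak_grad \<Omega> (\<lambda>x. u x + t *\<^sub>R v x) (\<lambda>x. g x + t *\<^sub>R h x)"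
  unfolding is_weak_grad_def
proof (intro conjI allI impI)
  have li: "locally_integrable \<Omega> u" "locally_integrable \<Omega> v" "locally_integrable \<Omega> g" "locally_integrable \<Omega> h"
    using u v by (auto simp: is_weak_grad_def)
  show "locally_integrable \<Omega> (\<lambda>x. u x + t *\<^sub>R v x)" "locally_integrable \<Omega> (\<lambda>x. g x + t *\<^sub>R h x)"
    using li by (auto intro: locally_integrable_lin)
  fix \<eta> :: "real ^ 'n \<Rightarrow> real" and i
  assume \<eta>: "\<eta> \<in> Cc_infinity \<Omega>"
  have "(LINT x|lebesgue_on \<Omega>. partial i \<eta> x *\<^sub>R (u x + t *\<^sub>R v x)) =
      (LINT x|lebesgue_on \<Omega>. partial i \<eta> x *\<^sub>R u x + t *\<^sub>R (partial i \<eta> x *\<^sub>R v x))"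
    by (simp add: scaleR_add_right mult.commute)
  also have "\<dots> = (LINT x|lebesgue_on \<Omega>. partial i \<eta> x *\<^sub>R u x) + t *\<^sub>R (LINT x|lebesgue_on \<Omega>. partial i \<eta> x *\<^sub>R v x)"
    by (intro integral_lin integrable_test_times(2)[OF \<Omega> _ \<eta>] li)
  also have "\<dots> = - ((LINT x|lebesgue_on \<Omega>. \<eta> x *\<^sub>R (g x $ i)) + t *\<^sub>R (LINT x|lebesgue_on \<Omega>. \<eta> x *\<^sub>R (h x $ i)))"
    using u v \<eta> by (simp add: is_weak_grad_def)
  also have "\<dots> = - (LINT x|lebesgue_on \<Omega>. \<eta> x *\<^sub>R (g x $ i) + t *\<^sub>R (\<eta> x *\<^sub>R (h x $ i)))"
    by (subst integral_lin) (intro integrable_test_times(1)[OF \<Omega> locally_integrable_nth \<eta>] li refl)+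
  also have "\<dots> = - (LINT x|lebesgue_on \<Omega>. \<eta> x *\<^sub>R ((g x + t *\<^sub>R h x) $ i))"
    by (simp add: scaleR_add_right mult.commute)
  finally show "(LINT x|lebesgue_on \<Omega>. partial i \<eta> x *\<^sub>R (u x + t *\<^sub>R v x)) =
     - (LINT x|lebesgue_on \<Omega>. \<eta> x *\<^sub>R ((g x + t *\<^sub>R h x) $ i))" .
qed

text \<open>
  This makes the choice in \<open>wgrad\<close> harmless and \<open>wgrad\<close> linear almost everywhere.
\<close>

lemma is_weak_grad_unique:
  fixes \<Omega> :: "(real ^ 'n::finite) set" and u :: "real ^ 'n \<Rightarrow> 'b::euclidean_space"
  assumes \<Omega>: "open \<Omega>" and g: "is_weak_grad \<Omega> u g" and h: "is_weak_grad \<Omega> u h"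
  shows "AE x in lebesgue_on \<Omega>. g x = h x"
proof -
  have li: "locally_integrable \<Omega> g" "locally_integrable \<Omega> h"
    using g h by (auto simp: is_weak_grad_def)
  have "AE x in lebesgue_on \<Omega>. g x $ i + (-1) *\<^sub>R (h x $ i) = 0" for i
  proof (rule test_functions_separate[OF \<Omega>])
    show "locally_integrable \<Omega> (\<lambda>x. g x $ i + (-1) *\<^sub>R (h x $ i))"
      by (intro locally_integrable_lin locally_integrable_nth li)
    fix \<eta> :: "real ^ 'n \<Rightarrow> real" assume \<eta>: "\<eta> \<in> Cc_infinity \<Omega>"
    have "(LINT x|lebesgue_on \<Omega>. \<eta> x *\<^sub>R (g x $ i)) = (LINT x|lebesgue_on \<Omega>. \<eta> x *\<^sub>R (h x $ i))"
    proof -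
      have "- (LINT x|lebesgue_on \<Omega>. \<eta> x *\<^sub>R (g x $ i)) = - (LINT x|lebesgue_on \<Omega>. \<eta> x *\<^sub>R (h x $ i))"
        using g h \<eta> unfolding is_weak_grad_def by simp
      then show ?thesis by simp
    qed
    moreover have "(LINT x|lebesgue_on \<Omega>. \<eta> x *\<^sub>R (g x $ i) + (-1) *\<^sub>R (\<eta> x *\<^sub>R (h x $ i))) =
        (LINT x|lebesgue_on \<Omega>. \<eta> x *\<^sub>R (g x $ i)) + (-1) *\<^sub>R (LINT x|lebesgue_on \<Omega>. \<eta> x *\<^sub>R (h x $ i))"
      by (intro integral_lin integrable_test_times(1)[OF \<Omega> locally_integrable_nth \<eta>] li)
    ultimately show "(LINT x|lebesgue_on \<Omega>. \<eta> x *\<^sub>R (g x $ i + (-1) *\<^sub>R (h x $ i))) = 0"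
      by (simp add: scaleR_diff_right)
  qed
  then have "AE x in lebesgue_on \<Omega>. \<forall>i. g x $ i + (-1) *\<^sub>R (h x $ i) = 0"
    by (rule eventually_all_finite)
  then show ?thesis by eventually_elim (simp add: vec_eq_iff)
qed

lemma integrable_lebesgue_on_compact:
  fixes f :: "'a::euclidean_space \<Rightarrow> 'b::euclidean_space"
  assumes f: "continuous_on UNIV f" and K: "compact K"
  shows "integrable (lebesgue_on K) f"
proof -
  have "integrable lborel (\<lambda>x. indicator K x *\<^sub>R f x)"
    by (rule borel_integrable_compact[OF K continuous_on_subset[OF f subset_UNIV]])
  from integrable_completion[OF borel_measurable_integrable[OF this]] this
  have "integrable lebesgue (\<lambda>x. indicator K x *\<^sub>R f x)" by simp
  then show ?thesis
    using fmeasurableD[OF lmeasurable_compact[OF K]] by (simp add: integrable_restrict_space)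
qed

lemma locally_integrable_continuous:
  "continuous_on UNIV f \<Longrightarrow> locally_integrable \<Omega> f"
  by (simp add: locally_integrable_def integrable_lebesgue_on_compact)

lemma integral_lebesgue_on_eq_lborel:
  fixes f :: "'a::euclidean_space \<Rightarrow> 'b::euclidean_space"
  assumes S: "S \<in> sets lebesgue" and f: "f \<in> borel_measurable borel" and 0: "\<And>x. x \<notin> S \<Longrightarrow> f x = 0"
  shows "(LINT x|lebesgue_on S. f x) = (LINT x|lborel. f x)"
proof -
  have "(LINT x|lebesgue_on S. f x) = (LINT x|lebesgue. (if x \<in> S then f x else 0))"
    by (rule Lebesgue_Measure.integral_restrict_UNIV[OF S, symmetric])
  also have "(\<lambda>x. if x \<in> S then f x else 0) = f" by (rule ext) (use 0 in auto)
  also have "(LINT x|lebesgue. f x) = (LINT x|lborel. f x)"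
    using f by (intro integral_completion) simp
  finally show ?thesis .
qed

lemma Cc_infinity_is_weak_grad:
  fixes \<Omega> :: "(real ^ 'n::finite) set" and v :: "real ^ 'n \<Rightarrow> 'b::euclidean_space"
  assumes \<Omega>: "open \<Omega>" and v: "v \<in> Cc_infinity \<Omega>"
  shows "is_weak_grad \<Omega> v (\<lambda>x. \<chi> i. partial i v x)"
  unfolding is_weak_grad_def
proof (intro conjI allI impI)
  have cg: "continuous_on UNIV (\<lambda>x. \<chi> i. partial i v x)"
    by (intro continuous_on_vec_lambda Cc_infinity_partial_continuous[OF v])
  show li: "locally_integrable \<Omega> v" "locally_integrable \<Omega> (\<lambda>x. \<chi> i. partial i v x)"
    by (rule locally_integrable_continuous, rule Cc_infinity_continuous[OF v])
      (rule locally_integrable_continuous[OF cg])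
  fix \<eta> :: "real ^ 'n \<Rightarrow> real" and i
  assume \<eta>: "\<eta> \<in> Cc_infinity \<Omega>"
  obtain K where K: "compact K" "K \<subseteq> \<Omega>" "\<forall>x. x \<notin> K \<longrightarrow> \<eta> x = 0 \<and> (\<forall>i. partial i \<eta> x = 0)"
    using Cc_infinity_support[OF \<eta>] by blast
  obtain R where R: "\<forall>x\<in>K. norm x \<le> R" using compact_imp_bounded[OF K(1), unfolded bounded_iff] by blast
  have d: "\<eta> differentiable (at x)" "v differentiable (at x)" for x
    using Cc_infinity_differentiable \<eta> v by auto
  have p: "partial i (\<lambda>x. \<eta> x *\<^sub>R v x) = (\<lambda>x. partial i \<eta> x *\<^sub>R v x + \<eta> x *\<^sub>R partial i v x)"
    by (rule ext, rule partial_scaleR[OF d])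
  have cp: "continuous_on UNIV (partial i (\<lambda>x. \<eta> x *\<^sub>R v x))"
    unfolding p
    by (intro continuous_on_add continuous_on_scaleR Cc_infinity_continuous[OF \<eta>] Cc_infinity_continuous[OF v]
        Cc_infinity_partial_continuous[OF \<eta>] Cc_infinity_partial_continuous[OF v])
  have "(LINT x|lebesgue_on \<Omega>. partial i \<eta> x *\<^sub>R v x) + (LINT x|lebesgue_on \<Omega>. \<eta> x *\<^sub>R partial i v x) =
      (LINT x|lebesgue_on \<Omega>. partial i (\<lambda>x. \<eta> x *\<^sub>R v x) x)"
    using integrable_test_times(2)[OF \<Omega> li(1) \<eta>, of i]
      integrable_test_times(1)[OF \<Omega> locally_integrable_nth[OF li(2)] \<eta>, of i] by (simp add: p)
  also have "\<dots> = (LINT x|lborel. partial i (\<lambda>x. \<eta> x *\<^sub>R v x) x)"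
  proof (rule integral_lebesgue_on_eq_lborel)
    show "\<Omega> \<in> sets lebesgue" using \<Omega> by auto
    show "partial i (\<lambda>x. \<eta> x *\<^sub>R v x) x = 0" if "x \<notin> \<Omega>" for x
    proof -
      have "x \<notin> K" using that K(2) by blast
      then show ?thesis using K(3) by (simp add: p)
    qed
  qed (rule borel_measurable_continuous_onI[OF cp])
  also have "\<dots> = 0"
  proof (rule integral_partial_zero[OF _ cp])
    show "(\<lambda>x. \<eta> x *\<^sub>R v x) differentiable (at x)" for x
      using has_derivative_scaleR[OF d(1)[of x, unfolded frechet_derivative_works] d(2)[of x, unfolded frechet_derivative_works]]
      unfolding differentiable_def by blast
    show "\<eta> x *\<^sub>R v x = 0" if "R < norm x" for x
    proof -
      have "x \<notin> K" using that R by force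
      then show ?thesis using K(3) by simp
    qed
  qed
  finally show "(LINT x|lebesgue_on \<Omega>. partial i \<eta> x *\<^sub>R v x) =
      - (LINT x|lebesgue_on \<Omega>. \<eta> x *\<^sub>R ((\<chi> i. partial i v x) $ i))"
    by (simp add: eq_neg_iff_add_eq_0)
qed

lemma L2_norm_square: "(L2_norm \<Omega> u)\<^sup>2 = (LINT x|lebesgue_on \<Omega>. (norm (u x))\<^sup>2)"
  by (simp add: L2_norm_def)

lemma norm_add_square_le: "(norm (a + b))\<^sup>2 \<le> 2 * (norm a)\<^sup>2 + 2 * (norm (b::'b::real_inner))\<^sup>2"
proof -
  have "(norm (a + b))\<^sup>2 \<le> (norm a + norm b)\<^sup>2" by (intro power_mono norm_triangle_ineq) auto
  also have "\<dots> \<le> 2 * (norm a)\<^sup>2 + 2 * (norm b)\<^sup>2"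
    using sum_squares_bound[of "norm a" "norm b"] by (simp add: power2_sum)
  finally show ?thesis .
qed

lemma L2D:
  assumes "u \<in> L2 \<Omega>"
  shows "u \<in> borel_measurable (lebesgue_on \<Omega>)" "integrable (lebesgue_on \<Omega>) (\<lambda>x. (norm (u x))\<^sup>2)"
  using assms by (auto simp: L2_def)

lemma L2_lin:
  fixes u v :: "real ^ 'n::finite \<Rightarrow> 'b::euclidean_space"
  assumes u: "u \<in> L2 \<Omega>" and v: "v \<in> L2 \<Omega>"
  shows "(\<lambda>x. u x + t *\<^sub>R v x) \<in> L2 \<Omega>"
    and "(L2_norm \<Omega> (\<lambda>x. u x + t *\<^sub>R v x))\<^sup>2 \<le> 2 * (L2_norm \<Omega> u)\<^sup>2 + 2 * t\<^sup>2 * (L2_norm \<Omega> v)\<^sup>2"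
proof -
  note [measurable] = L2D(1)[OF u] L2D(1)[OF v]
  let ?b = "\<lambda>x. 2 * (norm (u x))\<^sup>2 + 2 * t\<^sup>2 * (norm (v x))\<^sup>2"
  have b: "integrable (lebesgue_on \<Omega>) ?b" using L2D(2)[OF u] L2D(2)[OF v] by simp
  have le: "(norm (u x + t *\<^sub>R v x))\<^sup>2 \<le> ?b x" for x
    using norm_add_square_le[of "u x" "t *\<^sub>R v x"] by (simp add: power_mult_distrib)
  have int: "integrable (lebesgue_on \<Omega>) (\<lambda>x. (norm (u x + t *\<^sub>R v x))\<^sup>2)"
    by (rule Bochner_Integration.integrable_bound[OF b]) (use le order_trans[OF le abs_ge_self] in \<open>simp_all\<close>)
  then show "(\<lambda>x. u x + t *\<^sub>R v x) \<in> L2 \<Omega>" by (simp add: L2_def)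
  show "(L2_norm \<Omega> (\<lambda>x. u x + t *\<^sub>R v x))\<^sup>2 \<le> 2 * (L2_norm \<Omega> u)\<^sup>2 + 2 * t\<^sup>2 * (L2_norm \<Omega> v)\<^sup>2"
    unfolding L2_norm_square using integral_mono[OF int b le] L2D(2)[OF u] L2D(2)[OF v] by simp
qed

lemma L2_AE:
  fixes u v :: "real ^ 'n::finite \<Rightarrow> 'b::euclidean_space"
  assumes \<Omega>: "open \<Omega>" and u: "u \<in> L2 \<Omega>" and eq: "AE x in lebesgue_on \<Omega>. u x = v x"
  shows "v \<in> L2 \<Omega>" and "L2_norm \<Omega> v = L2_norm \<Omega> u"
proof -
  have [measurable]: "u \<in> borel_measurable (lebesgue_on \<Omega>)" using L2D(1)[OF u] .
  have [measurable]: "v \<in> borel_measurable (lebesgue_on \<Omega>)"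
    using \<Omega> by (intro borel_measurable_lebesgue_on_AE[OF _ L2D(1)[OF u] eq]) auto
  have eq': "AE x in lebesgue_on \<Omega>. (norm (u x))\<^sup>2 = (norm (v x))\<^sup>2" using eq by eventually_elim simp
  have "integrable (lebesgue_on \<Omega>) (\<lambda>x. (norm (v x))\<^sup>2)"
    by (rule integrable_cong_AE_imp[OF L2D(2)[OF u] _ eq']) measurable
  then show "v \<in> L2 \<Omega>" by (simp add: L2_def)
  have "(LINT x|lebesgue_on \<Omega>. (norm (v x))\<^sup>2) = (LINT x|lebesgue_on \<Omega>. (norm (u x))\<^sup>2)"
    by (rule integral_cong_AE[symmetric, OF _ _ eq']) measurable
  then show "L2_norm \<Omega> v = L2_norm \<Omega> u" by (simp add: L2_norm_def)
qed

lemma L2_continuous_compact_support: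
  fixes f :: "real ^ 'n::finite \<Rightarrow> 'b::euclidean_space"
  assumes \<Omega>: "open \<Omega>" and f: "continuous_on UNIV f" and K: "compact K" "K \<subseteq> \<Omega>" and 0: "\<And>x. x \<notin> K \<Longrightarrow> f x = 0"
  shows "f \<in> L2 \<Omega>"
proof -
  have "f \<in> borel_measurable lborel" using borel_measurable_continuous_onI[OF f] by simp
  then have "f \<in> borel_measurable (lebesgue_on \<Omega>)"
    by (intro measurable_restrict_space1 measurable_completion)
  moreover have "integrable (lebesgue_on \<Omega>) (\<lambda>x. (norm (f x))\<^sup>2)"
  proof -
    have "continuous_on UNIV (\<lambda>x. (norm (f x))\<^sup>2)" using f by (intro continuous_intros)
    then have "integrable (lebesgue_on K) (\<lambda>x. (norm (f x))\<^sup>2)"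
      using K(1) by (rule integrable_lebesgue_on_compact)
    moreover have "\<Omega> \<in> sets lebesgue" "K \<in> sets lebesgue"
      using \<Omega> fmeasurableD[OF lmeasurable_compact[OF K(1)]] by auto
    ultimately show ?thesis
      using integral_lebesgue_on_support(2)[of \<Omega> K "\<lambda>x. (norm (f x))\<^sup>2"] K(2) 0 by simp
  qed
  ultimately show ?thesis by (simp add: L2_def)
qed

section \<open>Sobolev spaces\<close>

lemma H1D:
  fixes \<Omega> :: "(real ^ 'n::finite) set" and u :: "real ^ 'n \<Rightarrow> 'b::euclidean_space"
  assumes \<Omega>: "open \<Omega>" and u: "u \<in> H1 \<Omega>"
  shows "u \<in> L2 \<Omega>" "is_weak_grad \<Omega> u (wgrad \<Omega> u)" "wgrad \<Omega> u \<in> L2 \<Omega>"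
proof -
  obtain g where g: "g \<in> L2 \<Omega>" "is_weak_grad \<Omega> u g" using u by (auto simp: H1_def)
  show "u \<in> L2 \<Omega>" using u by (simp add: H1_def)
  show w: "is_weak_grad \<Omega> u (wgrad \<Omega> u)" unfolding wgrad_def by (rule someI[of "is_weak_grad \<Omega> u", OF g(2)])
  show "wgrad \<Omega> u \<in> L2 \<Omega>" by (rule L2_AE(1)[OF \<Omega> g(1) is_weak_grad_unique[OF \<Omega> g(2) w]])
qed

lemma H1_lin:
  fixes \<Omega> :: "(real ^ 'n::finite) set" and u v :: "real ^ 'n \<Rightarrow> 'b::euclidean_space"
  assumes \<Omega>: "open \<Omega>" and u: "u \<in> H1 \<Omega>" and v: "v \<in> H1 \<Omega>"
  shows "(\<lambda>x. u x + t *\<^sub>R v x) \<in> H1 \<Omega>"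
    and "AE x in lebesgue_on \<Omega>. wgrad \<Omega> (\<lambda>x. u x + t *\<^sub>R v x) x = wgrad \<Omega> u x + t *\<^sub>R wgrad \<Omega> v x"
proof -
  have w: "is_weak_grad \<Omega> (\<lambda>x. u x + t *\<^sub>R v x) (\<lambda>x. wgrad \<Omega> u x + t *\<^sub>R wgrad \<Omega> v x)"
    by (rule is_weak_grad_lin[OF \<Omega> H1D(2)[OF \<Omega> u] H1D(2)[OF \<Omega> v]])
  show H: "(\<lambda>x. u x + t *\<^sub>R v x) \<in> H1 \<Omega>"
    using w L2_lin(1)[OF H1D(1)[OF \<Omega> u] H1D(1)[OF \<Omega> v]] L2_lin(1)[OF H1D(3)[OF \<Omega> u] H1D(3)[OF \<Omega> v]]
    unfolding H1_def by blast
  show "AE x in lebesgue_on \<Omega>. wgrad \<Omega> (\<lambda>x. u x + t *\<^sub>R v x) x = wgrad \<Omega> u x + t *\<^sub>R wgrad \<Omega> v x"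
    by (rule is_weak_grad_unique[OF \<Omega> H1D(2)[OF \<Omega> H] w])
qed

lemma H1_norm_square: "(H1_norm \<Omega> u)\<^sup>2 = (L2_norm \<Omega> u)\<^sup>2 + (L2_norm \<Omega> (wgrad \<Omega> u))\<^sup>2"
  by (simp add: H1_norm_def)

lemma H1_norm_nonneg: "0 \<le> H1_norm \<Omega> u"
  by (simp add: H1_norm_def)

lemma L2_norm_wgrad_lin:
  fixes \<Omega> :: "(real ^ 'n::finite) set" and u v :: "real ^ 'n \<Rightarrow> 'b::euclidean_space"
  assumes \<Omega>: "open \<Omega>" and u: "u \<in> H1 \<Omega>" and v: "v \<in> H1 \<Omega>"
  shows "(L2_norm \<Omega> (wgrad \<Omega> (\<lambda>x. u x + t *\<^sub>R v x)))\<^sup>2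
    \<le> 2 * (L2_norm \<Omega> (wgrad \<Omega> u))\<^sup>2 + 2 * t\<^sup>2 * (L2_norm \<Omega> (wgrad \<Omega> v))\<^sup>2"
  using L2_AE(2)[OF \<Omega> H1D(3)[OF \<Omega> H1_lin(1)[OF \<Omega> u v]] H1_lin(2)[OF \<Omega> u v], of t]
    L2_lin(2)[OF H1D(3)[OF \<Omega> u] H1D(3)[OF \<Omega> v], of t] by simp

lemma H1_norm_lin:
  fixes \<Omega> :: "(real ^ 'n::finite) set" and u v :: "real ^ 'n \<Rightarrow> 'b::euclidean_space"
  assumes \<Omega>: "open \<Omega>" and u: "u \<in> H1 \<Omega>" and v: "v \<in> H1 \<Omega>"
  shows "(H1_norm \<Omega> (\<lambda>x. u x + t *\<^sub>R v x))\<^sup>2 \<le> 2 * (H1_norm \<Omega> u)\<^sup>2 + 2 * t\<^sup>2 * (H1_norm \<Omega> v)\<^sup>2"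
  using L2_norm_wgrad_lin[OF assms, of t] L2_lin(2)[OF H1D(1)[OF \<Omega> u] H1D(1)[OF \<Omega> v], of t]
  unfolding H1_norm_square by (simp add: algebra_simps)

lemma Cc_infinity_L2:
  assumes \<Omega>: "open \<Omega>" and v: "v \<in> Cc_infinity \<Omega>"
  shows "v \<in> L2 \<Omega>" "(\<lambda>x. \<chi> i. partial i v x) \<in> L2 \<Omega>"
proof -
  obtain K where K: "compact K" "K \<subseteq> \<Omega>" and 0: "\<forall>x. x \<notin> K \<longrightarrow> v x = 0 \<and> (\<forall>i. partial i v x = 0)"
    using Cc_infinity_support[OF v] by blast
  show "v \<in> L2 \<Omega>"
    by (rule L2_continuous_compact_support[OF \<Omega> Cc_infinity_continuous[OF v] K]) (use 0 in blast)
  have "continuous_on UNIV (\<lambda>x. \<chi> i. partial i v x)"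
    by (intro continuous_on_vec_lambda Cc_infinity_partial_continuous[OF v])
  then show "(\<lambda>x. \<chi> i. partial i v x) \<in> L2 \<Omega>"
    by (rule L2_continuous_compact_support[OF \<Omega> _ K]) (use 0 in \<open>simp add: vec_eq_iff\<close>)
qed

lemma Cc_infinity_H1:
  fixes \<Omega> :: "(real ^ 'n::finite) set" and v :: "real ^ 'n \<Rightarrow> 'b::euclidean_space"
  assumes \<Omega>: "open \<Omega>" and v: "v \<in> Cc_infinity \<Omega>"
  shows "v \<in> H1 \<Omega>" "AE x in lebesgue_on \<Omega>. (\<chi> i. partial i v x) = wgrad \<Omega> v x"
proof -
  show H: "v \<in> H1 \<Omega>"
    unfolding H1_def using Cc_infinity_L2[OF \<Omega> v] Cc_infinity_is_weak_grad[OF \<Omega> v] by blast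
  show "AE x in lebesgue_on \<Omega>. (\<chi> i. partial i v x) = wgrad \<Omega> v x"
    by (rule is_weak_grad_unique[OF \<Omega> Cc_infinity_is_weak_grad[OF \<Omega> v] H1D(2)[OF \<Omega> H]])
qed

lemma H10_H1: "u \<in> H10 \<Omega> \<Longrightarrow> u \<in> H1 \<Omega>"
  by (simp add: H10_def norm_closure_def)

text \<open>
  The difference is written as \<open>u + (-1) v\<close> to match the linearity lemmas.
\<close>

lemma H10_approx:
  assumes "u \<in> H10 \<Omega>" "0 < e"
  obtains v where "v \<in> Cc_infinity \<Omega>" "(H1_norm \<Omega> (\<lambda>x. u x + (-1) *\<^sub>R v x))\<^sup>2 < e\<^sup>2"
proof -
  obtain v where "v \<in> Cc_infinity \<Omega>" "H1_norm \<Omega> (\<lambda>x. u x - v x) < e"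
    using assms unfolding H10_def norm_closure_def by blast
  then show thesis
    using that power_strict_mono[OF _ H1_norm_nonneg, of \<Omega> "\<lambda>x. u x - v x" e 2] by simp
qed

lemma H10_zero: "open \<Omega> \<Longrightarrow> (\<lambda>x. 0) \<in> H10 \<Omega>"
proof -
  assume \<Omega>: "open \<Omega>"
  let ?z = "\<lambda>x::real ^ 'a. 0 :: 'b"
  have H: "?z \<in> H1 \<Omega>" using Cc_infinity_H1(1)[OF \<Omega> Cc_infinity_zero] .
  have "AE x in lebesgue_on \<Omega>. (\<chi> i. partial i ?z x) = wgrad \<Omega> ?z x"
    by (rule Cc_infinity_H1(2)[OF \<Omega> Cc_infinity_zero])
  moreover have "(\<chi> i. partial i ?z x) = 0" for x
    by (simp add: vec_eq_iff partial_eq[OF has_derivative_const])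
  ultimately have "L2_norm \<Omega> (wgrad \<Omega> ?z) = 0"
    unfolding L2_norm_def by (subst integral_eq_zero_AE) auto
  then have "H1_norm \<Omega> ?z = 0" by (simp add: H1_norm_def) (simp add: L2_norm_def)
  then show ?thesis unfolding H10_def norm_closure_def using H Cc_infinity_zero[of \<Omega>]
    by (auto intro!: bexI[of _ ?z])
qed

lemma H10_lin:
  fixes \<Omega> :: "(real ^ 'n::finite) set" and u v :: "real ^ 'n \<Rightarrow> 'b::euclidean_space"
  assumes \<Omega>: "open \<Omega>" and u: "u \<in> H10 \<Omega>" and v: "v \<in> H10 \<Omega>"
  shows "(\<lambda>x. u x + t *\<^sub>R v x) \<in> H10 \<Omega>"
  unfolding H10_def norm_closure_def
proof (intro CollectI conjI allI impI)
  show "(\<lambda>x. u x + t *\<^sub>R v x) \<in> H1 \<Omega>" by (intro H1_lin(1) \<Omega> H10_H1 u v)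
  fix e :: real assume e: "0 < e"
  \<comment> \<open>chosen such that \<open>(4 + 2 * t\<^sup>2) * d\<^sup>2 \<le> e\<^sup>2\<close>\<close>
  define d where "d = e / (2 * (1 + \<bar>t\<bar>))"
  have d: "0 < d" using e by (simp add: d_def)
  obtain f where f: "f \<in> Cc_infinity \<Omega>" "(H1_norm \<Omega> (\<lambda>x. u x + (-1) *\<^sub>R f x))\<^sup>2 < d\<^sup>2"
    using H10_approx[OF u d] .
  obtain g where g: "g \<in> Cc_infinity \<Omega>" "(H1_norm \<Omega> (\<lambda>x. v x + (-1) *\<^sub>R g x))\<^sup>2 < d\<^sup>2"
    using H10_approx[OF v d] .
  have H: "(\<lambda>x. u x + (-1) *\<^sub>R f x) \<in> H1 \<Omega>" "(\<lambda>x. v x + (-1) *\<^sub>R g x) \<in> H1 \<Omega>"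
    by (intro H1_lin(1) \<Omega> H10_H1 u v Cc_infinity_H1(1) f g)+
  have eq: "(\<lambda>x. u x + t *\<^sub>R v x - (f x + t *\<^sub>R g x)) = (\<lambda>x. (u x + (-1) *\<^sub>R f x) + t *\<^sub>R (v x + (-1) *\<^sub>R g x))"
    by (simp add: algebra_simps)
  have "(H1_norm \<Omega> (\<lambda>x. u x + t *\<^sub>R v x - (f x + t *\<^sub>R g x)))\<^sup>2 \<le> 2 * (H1_norm \<Omega> (\<lambda>x. u x + (-1) *\<^sub>R f x))\<^sup>2
      + 2 * t\<^sup>2 * (H1_norm \<Omega> (\<lambda>x. v x + (-1) *\<^sub>R g x))\<^sup>2"
    unfolding eq by (rule H1_norm_lin[OF \<Omega> H])
  also have "\<dots> < 2 * d\<^sup>2 + 2 * t\<^sup>2 * d\<^sup>2 + 2 * d\<^sup>2"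
  proof -
    have "2 * t\<^sup>2 * (H1_norm \<Omega> (\<lambda>x. v x + (-1) *\<^sub>R g x))\<^sup>2 \<le> 2 * t\<^sup>2 * d\<^sup>2"
      using g(2) by (intro mult_left_mono) auto
    moreover have "0 < d\<^sup>2" using d by simp
    ultimately show ?thesis using f(2) by linarith
  qed
  also have "\<dots> \<le> e\<^sup>2"
  proof -
    have "0 < 2 * (1 + \<bar>t\<bar>)" by (simp add: add_pos_nonneg)
    then have "e = 2 * (1 + \<bar>t\<bar>) * d" unfolding d_def
      by (metis less_irrefl nonzero_mult_div_cancel_left times_divide_eq_right)
    then have "e\<^sup>2 = 4 * (1 + \<bar>t\<bar>)\<^sup>2 * d\<^sup>2" by (simp only: power_mult_distrib) simp
    also have "\<dots> \<ge> (4 + 2 * t\<^sup>2) * d\<^sup>2"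
      by (intro mult_right_mono) (auto simp: power2_sum)
    finally show ?thesis by (simp add: algebra_simps)
  qed
  finally have "H1_norm \<Omega> (\<lambda>x. u x + t *\<^sub>R v x - (f x + t *\<^sub>R g x)) < e"
    using power_less_imp_less_base[of _ 2 e] e by simp
  then show "\<exists>w\<in>Cc_infinity \<Omega>. H1_norm \<Omega> (\<lambda>x. u x + t *\<^sub>R v x - w x) < e"
    using Cc_infinity_lin[OF f(1) g(1), of t] by (intro bexI[of _ "\<lambda>x. f x + t *\<^sub>R g x"])
qed

section \<open>The inequalities of Poincare and Korn\<close>

lemma le_of_le_plus_small_square:
  fixes A B C :: real
  assumes "\<And>e. 0 < e \<Longrightarrow> A \<le> B + C * e\<^sup>2"
  shows "A \<le> B"
proof (rule tendsto_lowerbound)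
  show "((\<lambda>e. B + C * e\<^sup>2) \<longlongrightarrow> B) (at_right 0)"
    by (rule tendsto_eq_intros refl | simp)+
  show "\<forall>\<^sub>F e in at_right 0. A \<le> B + C * e\<^sup>2"
    using assms by (auto simp: eventually_at_right_field intro: exI[of _ 1])
qed simp

lemma norm_vec_square: "(norm x)\<^sup>2 = (\<Sum>i\<in>UNIV. (norm (x $ i))\<^sup>2)"
  by (simp add: norm_vec_def L2_set_def sum_nonneg)

text \<open>
  The \<open>i\<close>-th partial derivative of \<open>x\<^sub>i \<bar>v\<bar>\<^sup>2\<close> has integral \<open>0\<close>, which says that \<open>\<integral> \<bar>v\<bar>\<^sup>2\<close> equals
  \<open>- 2 * \<integral> x\<^sub>i (v \<bullet> \<partial>\<^sub>i v)\<close>. As \<open>\<bar>x\<^sub>i\<bar> \<le> R\<close> on \<open>\<Omega>\<close>, Young's inequality bounds the latter by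
  \<open>1/2 * \<integral> \<bar>v\<bar>\<^sup>2 + 2 * R\<^sup>2 * \<integral> \<bar>\<partial>\<^sub>i v\<bar>\<^sup>2\<close>.
\<close>

lemma Poincare_test_functions:
  fixes \<Omega> :: "(real ^ 'n::finite) set" and v :: "real ^ 'n \<Rightarrow> 'b::euclidean_space"
  assumes \<Omega>: "open \<Omega>" and R: "\<And>x. x \<in> \<Omega> \<Longrightarrow> norm x \<le> R" and v: "v \<in> Cc_infinity \<Omega>"
  shows "(L2_norm \<Omega> v)\<^sup>2 \<le> 4 * R\<^sup>2 * (L2_norm \<Omega> (wgrad \<Omega> v))\<^sup>2"
proof -
  obtain K where K: "compact K" "K \<subseteq> \<Omega>" and 0: "\<And>x. x \<notin> K \<Longrightarrow> v x = 0"
    using Cc_infinity_support[OF v] by blast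
  \<comment> \<open>any fixed direction will do\<close>
  fix i :: 'n
  let ?M = "lebesgue_on \<Omega>"
  let ?grad = "\<lambda>x. \<chi> i. partial i v x"
  define f where "f x = x $ i * (v x \<bullet> v x)" for x
  have dv: "(v has_derivative frechet_derivative v (at x)) (at x)" for x
    using Cc_infinity_differentiable[OF v] by (simp only: frechet_derivative_works)
  have der: "(f has_derivative (\<lambda>h. x $ i * (v x \<bullet> frechet_derivative v (at x) h + frechet_derivative v (at x) h \<bullet> v x) + h $ i * (v x \<bullet> v x))) (at x)" for x
    unfolding f_def
    by (intro has_derivative_mult has_derivative_inner dv bounded_linear_imp_has_derivative bounded_linear_vec_nth)
  have p: "partial i f = (\<lambda>x. v x \<bullet> v x + 2 * (x $ i) * (v x \<bullet> partial i v x))"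
    by (rule ext, unfold partial_eq[OF der]) (simp add: partial_def inner_commute)
  have cv: "continuous_on UNIV v" and cp: "continuous_on UNIV (partial i v)"
    by (rule Cc_infinity_continuous[OF v], rule Cc_infinity_partial_continuous[OF v])
  have cpf: "continuous_on UNIV (partial i f)"
    unfolding p by (intro continuous_on_add continuous_on_mult continuous_on_inner cv cp continuous_on_const
        continuous_on_component continuous_on_id)
  have "(LINT x|lborel. partial i f x) = 0"
  proof (rule integral_partial_zero[OF _ cpf])
    show "f differentiable (at x)" for x using der differentiable_def by blast
    show "f x = 0" if "R < norm x" for x
      using 0[of x] K(2) R[of x] that by (fastforce simp: f_def)
  qed
  moreover have "(LINT x|?M. partial i f x) = (LINT x|lborel. partial i f x)"
  proof (rule integral_lebesgue_on_eq_lborel)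
    show "\<Omega> \<in> sets lebesgue" using \<Omega> by auto
    show "partial i f x = 0" if "x \<notin> \<Omega>" for x
    proof -
      have "v x = 0" using that K(2) 0 by blast
      then show ?thesis by (simp add: p)
    qed
  qed (rule borel_measurable_continuous_onI[OF cpf])
  ultimately have zero: "(LINT x|?M. partial i f x) = 0" by simp
  have v2: "v \<in> L2 \<Omega>" "?grad \<in> L2 \<Omega>" by (rule Cc_infinity_L2[OF \<Omega> v])+
  have intv: "integrable ?M (\<lambda>x. 1/2 * (norm (v x))\<^sup>2 - 2 * R\<^sup>2 * (norm (?grad x))\<^sup>2)"
    using L2D(2)[OF v2(1)] L2D(2)[OF v2(2)] by simp
  have "(LINT x|?M. 1/2 * (norm (v x))\<^sup>2 - 2 * R\<^sup>2 * (norm (?grad x))\<^sup>2) \<le> (LINT x|?M. partial i f x)"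
  proof (rule integral_mono_AE[OF intv])
    have "integrable (lebesgue_on K) (partial i f)" by (rule integrable_lebesgue_on_compact[OF cpf K(1)])
    then show "integrable ?M (partial i f)"
      using integral_lebesgue_on_support(2)[of \<Omega> K "partial i f"] \<Omega> K 0
        fmeasurableD[OF lmeasurable_compact[OF K(1)]] by (auto simp: p)
    show "AE x in ?M. 1/2 * (norm (v x))\<^sup>2 - 2 * R\<^sup>2 * (norm (?grad x))\<^sup>2 \<le> partial i f x"
    proof (rule AE_I2)
      fix x assume "x \<in> space ?M"
      then have "\<bar>x $ i\<bar> \<le> R" using R[of x] component_le_norm_cart[of x i] by simp
      moreover have "norm (partial i v x) \<le> norm (?grad x)" using Finite_Cartesian_Product.norm_nth_le[of "?grad x" i] by simp
      ultimately have *: "\<bar>x $ i\<bar> * norm (partial i v x) \<le> R * norm (?grad x)"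
        by (intro mult_mono) auto
      have "- (2 * (x $ i) * (v x \<bullet> partial i v x)) \<le> 2 * (\<bar>x $ i\<bar> * \<bar>v x \<bullet> partial i v x\<bar>)"
        using abs_ge_minus_self[of "x $ i * (v x \<bullet> partial i v x)"] by (simp add: abs_mult)
      also have "\<dots> \<le> 2 * (\<bar>x $ i\<bar> * (norm (v x) * norm (partial i v x)))"
        by (intro mult_left_mono Cauchy_Schwarz_ineq2) auto
      also have "\<dots> = 2 * (norm (v x) * (\<bar>x $ i\<bar> * norm (partial i v x)))" by simp
      also have "\<dots> \<le> 2 * (norm (v x) * (R * norm (?grad x)))"
        by (intro mult_left_mono *) auto
      also have "\<dots> \<le> 1/2 * (norm (v x))\<^sup>2 + 2 * R\<^sup>2 * (norm (?grad x))\<^sup>2"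
      proof -
        have "0 \<le> 1/2 * (norm (v x) - 2 * (R * norm (?grad x)))\<^sup>2" by simp
        then show ?thesis by (simp add: power2_diff power_mult_distrib)
      qed
      finally show "1/2 * (norm (v x))\<^sup>2 - 2 * R\<^sup>2 * (norm (?grad x))\<^sup>2 \<le> partial i f x"
        by (simp add: p dot_square_norm)
    qed
  qed
  then have "1/2 * (L2_norm \<Omega> v)\<^sup>2 \<le> 2 * R\<^sup>2 * (L2_norm \<Omega> ?grad)\<^sup>2"
    unfolding zero L2_norm_square using L2D(2)[OF v2(1)] L2D(2)[OF v2(2)] by simp
  also have "L2_norm \<Omega> ?grad = L2_norm \<Omega> (wgrad \<Omega> v)"
    by (rule L2_AE(2)[OF \<Omega> v2(2) Cc_infinity_H1(2)[OF \<Omega> v], symmetric])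
  finally show ?thesis by simp
qed

text \<open>
  Density of test functions. The constant grows because the triangle inequality is used for squares
  of norms, where it costs a factor \<open>2\<close>.
\<close>

lemma Poincare:
  fixes \<Omega> :: "(real ^ 'n::finite) set" and u :: "real ^ 'n \<Rightarrow> 'b::euclidean_space"
  assumes \<Omega>: "open \<Omega>" and R: "\<And>x. x \<in> \<Omega> \<Longrightarrow> norm x \<le> R" and u: "u \<in> H10 \<Omega>"
  shows "(L2_norm \<Omega> u)\<^sup>2 \<le> 16 * R\<^sup>2 * (L2_norm \<Omega> (wgrad \<Omega> u))\<^sup>2"
proof (rule le_of_le_plus_small_square)
  fix e :: real assume e: "0 < e"
  obtain v where v: "v \<in> Cc_infinity \<Omega>" "(H1_norm \<Omega> (\<lambda>x. u x + (-1) *\<^sub>R v x))\<^sup>2 < e\<^sup>2"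
    using H10_approx[OF u e] .
  let ?w = "\<lambda>x. u x + (-1) *\<^sub>R v x"
  have H: "u \<in> H1 \<Omega>" "v \<in> H1 \<Omega>" using H10_H1[OF u] Cc_infinity_H1(1)[OF \<Omega> v(1)] .
  have W: "?w \<in> H1 \<Omega>" by (rule H1_lin(1)[OF \<Omega> H])
  have we: "(L2_norm \<Omega> ?w)\<^sup>2 \<le> e\<^sup>2" "(L2_norm \<Omega> (wgrad \<Omega> ?w))\<^sup>2 \<le> e\<^sup>2"
    using v(2) zero_le_power2[of "L2_norm \<Omega> ?w"] zero_le_power2[of "L2_norm \<Omega> (wgrad \<Omega> ?w)"]
    unfolding H1_norm_square by linarith+
  have "(\<lambda>x. v x + 1 *\<^sub>R ?w x) = u" "(\<lambda>x. u x + (-1) *\<^sub>R ?w x) = v" by auto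
  then have "(L2_norm \<Omega> u)\<^sup>2 \<le> 2 * (L2_norm \<Omega> v)\<^sup>2 + 2 * e\<^sup>2"
    and 1: "(L2_norm \<Omega> (wgrad \<Omega> v))\<^sup>2 \<le> 2 * (L2_norm \<Omega> (wgrad \<Omega> u))\<^sup>2 + 2 * e\<^sup>2"
    using L2_lin(2)[OF H1D(1)[OF \<Omega> H(2)] H1D(1)[OF \<Omega> W], of 1] L2_norm_wgrad_lin[OF \<Omega> H(1) W, of "-1"] we by auto
  moreover have "(L2_norm \<Omega> v)\<^sup>2 \<le> 4 * R\<^sup>2 * (L2_norm \<Omega> (wgrad \<Omega> v))\<^sup>2"
    by (rule Poincare_test_functions[OF \<Omega> R v(1)])
  moreover have "4 * R\<^sup>2 * (L2_norm \<Omega> (wgrad \<Omega> v))\<^sup>2 \<le> 4 * R\<^sup>2 * (2 * (L2_norm \<Omega> (wgrad \<Omega> u))\<^sup>2 + 2 * e\<^sup>2)"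
    using 1 by (intro mult_left_mono) auto
  ultimately show "(L2_norm \<Omega> u)\<^sup>2 \<le> 16 * R\<^sup>2 * (L2_norm \<Omega> (wgrad \<Omega> u))\<^sup>2 + (2 + 16 * R\<^sup>2) * e\<^sup>2"
    by (simp add: algebra_simps)
qed

definition sym_part :: "real ^ 'n ^ 'n \<Rightarrow> real ^ 'n ^ 'n" where
  "sym_part A = (1/2) *\<^sub>R (A + transpose A)"

lemma sym_part_add: "sym_part (A + t *\<^sub>R B) = sym_part A + t *\<^sub>R sym_part B"
  by (simp add: sym_part_def transpose_def vec_eq_iff algebra_simps)

lemma norm_matrix_square: "(norm (A :: real ^ 'n::finite ^ 'm::finite))\<^sup>2 = (\<Sum>i\<in>UNIV. \<Sum>j\<in>UNIV. (A $ i $ j)\<^sup>2)"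
  by (simp add: norm_vec_square)

text \<open>
  For the gradient of a test function, the mixed sum on the right integrates to the same value as the
  squared divergence.
\<close>

lemma norm_sym_part_square:
  "(norm (sym_part A))\<^sup>2 = 1/2 * (norm A)\<^sup>2 + 1/2 * (\<Sum>i\<in>UNIV. \<Sum>j\<in>UNIV. A $ i $ j * A $ j $ i)"
proof -
  have "(norm (sym_part A))\<^sup>2 = (\<Sum>i\<in>UNIV. \<Sum>j\<in>UNIV. 1/4 * (A $ i $ j)\<^sup>2 + 1/4 * (A $ j $ i)\<^sup>2 + 1/2 * (A $ i $ j * A $ j $ i))"
    unfolding norm_matrix_square
    by (intro sum.cong refl) (simp add: sym_part_def transpose_def power2_eq_square algebra_simps)
  also have "\<dots> = 1/4 * (\<Sum>i\<in>UNIV. \<Sum>j\<in>UNIV. (A $ i $ j)\<^sup>2) + 1/4 * (\<Sum>i\<in>UNIV. \<Sum>j\<in>UNIV. (A $ j $ i)\<^sup>2)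
      + 1/2 * (\<Sum>i\<in>UNIV. \<Sum>j\<in>UNIV. A $ i $ j * A $ j $ i)"
    by (simp only: sum.distrib sum_distrib_left)
  also have "(\<Sum>i\<in>UNIV. \<Sum>j\<in>UNIV. (A $ j $ i)\<^sup>2) = (\<Sum>i\<in>UNIV. \<Sum>j\<in>UNIV. (A $ i $ j)\<^sup>2)"
    by (rule sum.swap)
  finally show ?thesis by (simp add: norm_matrix_square)
qed

lemma norm_sym_part_le: "(norm (sym_part A))\<^sup>2 \<le> (norm A)\<^sup>2"
proof -
  have "(\<Sum>i\<in>UNIV. \<Sum>j\<in>UNIV. A $ i $ j * A $ j $ i) \<le> (\<Sum>i\<in>UNIV. \<Sum>j\<in>UNIV. 1/2 * (A $ i $ j)\<^sup>2 + 1/2 * (A $ j $ i)\<^sup>2)"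
  proof (intro sum_mono)
    show "A $ i $ j * A $ j $ i \<le> 1/2 * (A $ i $ j)\<^sup>2 + 1/2 * (A $ j $ i)\<^sup>2" for i j
      using sum_squares_bound[of "A $ i $ j" "A $ j $ i"] by simp
  qed
  also have "\<dots> = 1/2 * (\<Sum>i\<in>UNIV. \<Sum>j\<in>UNIV. (A $ i $ j)\<^sup>2) + 1/2 * (\<Sum>i\<in>UNIV. \<Sum>j\<in>UNIV. (A $ j $ i)\<^sup>2)"
    by (simp only: sum.distrib sum_distrib_left)
  also have "(\<Sum>i\<in>UNIV. \<Sum>j\<in>UNIV. (A $ j $ i)\<^sup>2) = (\<Sum>i\<in>UNIV. \<Sum>j\<in>UNIV. (A $ i $ j)\<^sup>2)"
    by (rule sum.swap)
  finally show ?thesis using norm_sym_part_square[of A] norm_matrix_square[of A] by simp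
qed

lemma sym_grad_eq: "sym_grad \<Omega> u x = sym_part (wgrad \<Omega> u x)"
  by (simp add: sym_grad_def sym_part_def)

lemma continuous_sym_part: "continuous_on UNIV sym_part"
  unfolding sym_part_def[abs_def] transpose_def
  by (intro continuous_intros continuous_on_vec_lambda continuous_on_component)

lemma sym_part_L2:
  assumes "g \<in> L2 \<Omega>" shows "(\<lambda>x. sym_part (g x)) \<in> L2 \<Omega>"
proof -
  have m: "(\<lambda>x. sym_part (g x)) \<in> borel_measurable (lebesgue_on \<Omega>)"
    using measurable_compose[OF L2D(1)[OF assms] borel_measurable_continuous_onI[OF continuous_sym_part]] .
  have "integrable (lebesgue_on \<Omega>) (\<lambda>x. (norm (sym_part (g x)))\<^sup>2)"
  proof (rule Bochner_Integration.integrable_bound[OF L2D(2)[OF assms]])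
    show "(\<lambda>x. (norm (sym_part (g x)))\<^sup>2) \<in> borel_measurable (lebesgue_on \<Omega>)" using m by measurable
    show "AE x in lebesgue_on \<Omega>. norm ((norm (sym_part (g x)))\<^sup>2) \<le> norm ((norm (g x))\<^sup>2)"
      using norm_sym_part_le by (intro AE_I2) simp
  qed
  then show ?thesis using m by (simp add: L2_def)
qed

lemma sym_part_L2_norm_le:
  assumes "g \<in> L2 \<Omega>" shows "(L2_norm \<Omega> (\<lambda>x. sym_part (g x)))\<^sup>2 \<le> (L2_norm \<Omega> g)\<^sup>2"
  unfolding L2_norm_square
  by (rule integral_mono[OF L2D(2)[OF sym_part_L2[OF assms]] L2D(2)[OF assms] norm_sym_part_le])

lemma sym_grad_L2:
  assumes "open \<Omega>" "u \<in> H1 \<Omega>" shows "sym_grad \<Omega> u \<in> L2 \<Omega>"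
  using sym_part_L2[OF H1D(3)[OF assms]] by (simp add: sym_grad_eq[abs_def])

lemma sym_grad_lin:
  assumes "open \<Omega>" "u \<in> H1 \<Omega>" "v \<in> H1 \<Omega>"
  shows "AE x in lebesgue_on \<Omega>. sym_grad \<Omega> (\<lambda>x. u x + t *\<^sub>R v x) x = sym_grad \<Omega> u x + t *\<^sub>R sym_grad \<Omega> v x"
  using H1_lin(2)[OF assms, of t] by eventually_elim (simp add: sym_grad_eq sym_part_add)

text \<open>
  By \<open>integral_partial_partial_swap\<close>, the integral of \<open>\<partial>\<^sub>i v\<^sub>j \<partial>\<^sub>j v\<^sub>i\<close> equals that of \<open>\<partial>\<^sub>j v\<^sub>j \<partial>\<^sub>i v\<^sub>i\<close>. The
  sum over \<open>i\<close> and \<open>j\<close> is the integral of the squared divergence, so the mixed sum in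
  \<open>norm_sym_part_square\<close> contributes a nonnegative amount.
\<close>

lemma Korn_test_functions:
  fixes \<Omega> :: "(real ^ 'n::finite) set" and v :: "real ^ 'n \<Rightarrow> real ^ 'n"
  assumes \<Omega>: "open \<Omega>" and v: "v \<in> Cc_infinity \<Omega>"
  shows "(L2_norm \<Omega> (wgrad \<Omega> v))\<^sup>2 \<le> 2 * (L2_norm \<Omega> (sym_grad \<Omega> v))\<^sup>2"
proof -
  let ?M = "lebesgue_on \<Omega>"
  define g where "g x = (\<chi> i. partial i v x)" for x
  obtain K where K: "compact K" "K \<subseteq> \<Omega>" and 0: "\<And>x i. x \<notin> K \<Longrightarrow> v x = 0 \<and> partial i v x = 0"
    using Cc_infinity_support[OF v] by blast
  obtain R where R: "\<forall>x\<in>K. norm x \<le> R" using compact_imp_bounded[OF K(1), unfolded bounded_iff] by blast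
  have dv: "(v has_derivative frechet_derivative v (at x)) (at x)" for x
    using Cc_infinity_differentiable[OF v] by (simp only: frechet_derivative_works)
  have der: "((\<lambda>x. v x $ j) has_derivative (\<lambda>h. frechet_derivative v (at x) h $ j)) (at x)" for x j
    by (rule bounded_linear.has_derivative[OF bounded_linear_vec_nth dv])
  have g: "g x $ i $ j = partial i (\<lambda>x. v x $ j) x" for x i j
    by (simp add: g_def partial_eq[OF der] partial_def)
  have cp: "continuous_on UNIV (\<lambda>x. partial i v x $ j)" for i j
    by (intro continuous_on_component Cc_infinity_partial_continuous[OF v])
  have cg: "continuous_on UNIV (partial i (\<lambda>x. v x $ j))" for i j
  proof -
    have "partial i (\<lambda>x. v x $ j) = (\<lambda>x. partial i v x $ j)"
      by (rule ext) (use g[of _ i j] in \<open>simp add: g_def\<close>)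
    then show ?thesis using cp by simp
  qed
  have int: "integrable ?M (\<lambda>x. g x $ i $ j * g x $ k $ l)" for i j k l
  proof -
    have "continuous_on UNIV (\<lambda>x. g x $ i $ j * g x $ k $ l)"
      unfolding g_def vec_lambda_beta by (intro continuous_on_mult cp)
    then have "integrable (lebesgue_on K) (\<lambda>x. g x $ i $ j * g x $ k $ l)"
      using K(1) by (rule integrable_lebesgue_on_compact)
    then show ?thesis
      using integral_lebesgue_on_support(2)[of \<Omega> K "\<lambda>x. g x $ i $ j * g x $ k $ l"] \<Omega> K 0
        fmeasurableD[OF lmeasurable_compact[OF K(1)]] by (auto simp: g_def)
  qed
  have swap: "(LINT x|?M. g x $ i $ j * g x $ j $ i) = (LINT x|?M. g x $ j $ j * g x $ i $ i)" for i j
  proof -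
    have lb: "(LINT x|?M. g x $ i $ j * g x $ k $ l) = (LINT x|lborel. g x $ i $ j * g x $ k $ l)" for i j k l
    proof (rule integral_lebesgue_on_eq_lborel)
      show "\<Omega> \<in> sets lebesgue" using \<Omega> by auto
      have "continuous_on UNIV (\<lambda>x. g x $ i $ j * g x $ k $ l)"
        unfolding g_def vec_lambda_beta by (intro continuous_on_mult cp)
      then show "(\<lambda>x. g x $ i $ j * g x $ k $ l) \<in> borel_measurable borel"
        by (rule borel_measurable_continuous_onI)
      show "g x $ i $ j * g x $ k $ l = 0" if "x \<notin> \<Omega>" for x
      proof -
        have "partial i v x = 0" using that K(2) 0 by blast
        then show ?thesis by (simp add: g_def)
      qed
    qed
    have supp: "v x $ k = 0" if "R < norm x" for x k
      using 0[of x] R that by force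
    show ?thesis unfolding lb unfolding g
      by (rule integral_partial_partial_swap[OF _ cg supp _ cg supp])
        (use der differentiable_def in blast)+
  qed
  have "(LINT x|?M. (\<Sum>i\<in>UNIV. \<Sum>j\<in>UNIV. g x $ i $ j * g x $ j $ i)) =
      (\<Sum>i\<in>UNIV. \<Sum>j\<in>UNIV. LINT x|?M. g x $ i $ j * g x $ j $ i)"
    using int by (simp add: Bochner_Integration.integral_sum)
  also have "\<dots> = (\<Sum>i\<in>UNIV. \<Sum>j\<in>UNIV. LINT x|?M. g x $ j $ j * g x $ i $ i)"
    by (intro sum.cong refl swap)
  also have "\<dots> = (LINT x|?M. (\<Sum>i\<in>UNIV. \<Sum>j\<in>UNIV. g x $ j $ j * g x $ i $ i))"
    using int by (simp add: Bochner_Integration.integral_sum)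
  also have "\<dots> = (LINT x|?M. (\<Sum>i\<in>UNIV. g x $ i $ i)\<^sup>2)"
    by (simp add: power2_eq_square sum_distrib_left sum_distrib_right)
  also have "\<dots> \<ge> 0" by simp
  finally have nonneg: "0 \<le> (LINT x|?M. (\<Sum>i\<in>UNIV. \<Sum>j\<in>UNIV. g x $ i $ j * g x $ j $ i))" .
  have gL2: "g \<in> L2 \<Omega>" unfolding g_def by (rule Cc_infinity_L2(2)[OF \<Omega> v])
  have ae: "AE x in ?M. g x = wgrad \<Omega> v x" unfolding g_def by (rule Cc_infinity_H1(2)[OF \<Omega> v])
  then have ae': "AE x in ?M. sym_part (g x) = sym_grad \<Omega> v x" by eventually_elim (simp add: sym_grad_eq)
  have "(L2_norm \<Omega> (\<lambda>x. sym_part (g x)))\<^sup>2 =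
      (LINT x|?M. 1/2 * (norm (g x))\<^sup>2 + 1/2 * (\<Sum>i\<in>UNIV. \<Sum>j\<in>UNIV. g x $ i $ j * g x $ j $ i))"
    by (simp only: L2_norm_square norm_sym_part_square)
  also have "\<dots> = 1/2 * (L2_norm \<Omega> g)\<^sup>2 + 1/2 * (LINT x|?M. (\<Sum>i\<in>UNIV. \<Sum>j\<in>UNIV. g x $ i $ j * g x $ j $ i))"
    unfolding L2_norm_square using int L2D(2)[OF gL2] by simp
  finally have "(L2_norm \<Omega> g)\<^sup>2 \<le> 2 * (L2_norm \<Omega> (\<lambda>x. sym_part (g x)))\<^sup>2"
    using nonneg by linarith
  then show ?thesis
    using L2_AE(2)[OF \<Omega> gL2 ae] L2_AE(2)[OF \<Omega> sym_part_L2[OF gL2] ae'] by simp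
qed

lemma Korn:
  fixes \<Omega> :: "(real ^ 'n::finite) set" and u :: "real ^ 'n \<Rightarrow> real ^ 'n"
  assumes \<Omega>: "open \<Omega>" and u: "u \<in> H10 \<Omega>"
  shows "(L2_norm \<Omega> (wgrad \<Omega> u))\<^sup>2 \<le> 8 * (L2_norm \<Omega> (sym_grad \<Omega> u))\<^sup>2"
proof (rule le_of_le_plus_small_square)
  fix e :: real assume e: "0 < e"
  obtain v where v: "v \<in> Cc_infinity \<Omega>" "(H1_norm \<Omega> (\<lambda>x. u x + (-1) *\<^sub>R v x))\<^sup>2 < e\<^sup>2"
    using H10_approx[OF u e] .
  let ?w = "\<lambda>x. u x + (-1) *\<^sub>R v x"
  have H: "u \<in> H1 \<Omega>" "v \<in> H1 \<Omega>" using H10_H1[OF u] Cc_infinity_H1(1)[OF \<Omega> v(1)] .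
  have W: "?w \<in> H1 \<Omega>" by (rule H1_lin(1)[OF \<Omega> H])
  have we: "(L2_norm \<Omega> (wgrad \<Omega> ?w))\<^sup>2 \<le> e\<^sup>2"
    using v(2) zero_le_power2[of "L2_norm \<Omega> ?w"]
    unfolding H1_norm_square by linarith
  have we': "(L2_norm \<Omega> (sym_grad \<Omega> ?w))\<^sup>2 \<le> e\<^sup>2"
    using sym_part_L2_norm_le[OF H1D(3)[OF \<Omega> W]] we by (simp add: sym_grad_eq[abs_def])
  have eq: "(\<lambda>x. v x + 1 *\<^sub>R ?w x) = u" "(\<lambda>x. u x + (-1) *\<^sub>R ?w x) = v" by auto
  then have "(L2_norm \<Omega> (wgrad \<Omega> u))\<^sup>2 \<le> 2 * (L2_norm \<Omega> (wgrad \<Omega> v))\<^sup>2 + 2 * e\<^sup>2"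
    using L2_norm_wgrad_lin[OF \<Omega> H(2) W, of 1] we by auto
  moreover have "(L2_norm \<Omega> (sym_grad \<Omega> v))\<^sup>2 \<le> 2 * (L2_norm \<Omega> (sym_grad \<Omega> u))\<^sup>2 + 2 * e\<^sup>2"
    using L2_lin(2)[OF sym_grad_L2[OF \<Omega> H(1)] sym_grad_L2[OF \<Omega> W], of "-1"]
      L2_AE(2)[OF \<Omega> sym_grad_L2[OF \<Omega> H1_lin(1)[OF \<Omega> H(1) W]] sym_grad_lin[OF \<Omega> H(1) W], of "-1"] we'
    unfolding eq by simp
  moreover have "(L2_norm \<Omega> (wgrad \<Omega> v))\<^sup>2 \<le> 2 * (L2_norm \<Omega> (sym_grad \<Omega> v))\<^sup>2"
    by (rule Korn_test_functions[OF \<Omega> v(1)])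
  ultimately show "(L2_norm \<Omega> (wgrad \<Omega> u))\<^sup>2 \<le> 8 * (L2_norm \<Omega> (sym_grad \<Omega> u))\<^sup>2 + 10 * e\<^sup>2"
    by simp
qed

lemma H10_div_zero: "open \<Omega> \<Longrightarrow> (\<lambda>x. 0) \<in> H10_div \<Omega>"
proof -
  assume \<Omega>: "open \<Omega>"
  let ?z = "\<lambda>x::real ^ 'a. 0 :: real ^ 'a"
  have "AE x in lebesgue_on \<Omega>. (\<chi> i. partial i ?z x) = wgrad \<Omega> ?z x"
    by (rule Cc_infinity_H1(2)[OF \<Omega> Cc_infinity_zero])
  then have "AE x in lebesgue_on \<Omega>. wdiv \<Omega> ?z x = 0"
    by eventually_elim (simp add: wdiv_def trace_def vec_eq_iff partial_eq[OF has_derivative_const])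
  then show ?thesis using H10_zero[OF \<Omega>] by (simp add: H10_div_def)
qed

lemma H10_div_lin:
  assumes \<Omega>: "open \<Omega>" and u: "u \<in> H10_div \<Omega>" and v: "v \<in> H10_div \<Omega>"
  shows "(\<lambda>x. u x + t *\<^sub>R v x) \<in> H10_div \<Omega>"
proof -
  have H: "u \<in> H10 \<Omega>" "v \<in> H10 \<Omega>" using u v by (auto simp: H10_div_def)
  have "AE x in lebesgue_on \<Omega>. wdiv \<Omega> u x = 0" "AE x in lebesgue_on \<Omega>. wdiv \<Omega> v x = 0"
    using u v by (auto simp: H10_div_def)
  with H1_lin(2)[OF \<Omega> H10_H1[OF H(1)] H10_H1[OF H(2)], of t]
  have "AE x in lebesgue_on \<Omega>. wdiv \<Omega> (\<lambda>x. u x + t *\<^sub>R v x) x = 0"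
    by eventually_elim (simp add: wdiv_def trace_def sum.distrib sum_distrib_left[symmetric])
  then show ?thesis using H10_lin[OF \<Omega> H] by (simp add: H10_div_def)
qed

section \<open>Lower semicontinuity of the energies\<close>

context growth_function
begin

lemma mu_weight:
  fixes \<Omega> :: "(real ^ 'n::finite) set" and D :: "(real ^ 'n \<Rightarrow> 'v::real_vector) \<Rightarrow> real ^ 'n \<Rightarrow> 'b::euclidean_space"
  assumes Q: "quadratic_energy (lebesgue_on \<Omega>) V D G" and \<Omega>: "\<Omega> \<in> lmeasurable" and \<epsilon>: "0 < \<epsilon>" "\<epsilon> < 1"
  shows "\<exists>m K. \<forall>c\<in>LPhi_eps \<phi> \<Omega> \<epsilon>. quadratic_energy.weight (lebesgue_on \<Omega>) m K (\<lambda>x. mu \<phi> (c x))"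
proof -
  obtain m K where mK: "0 < m" "\<forall>s\<in>{\<epsilon>..1/\<epsilon>}. m \<le> mu \<phi> s \<and> mu \<phi> s \<le> K"
    using mu_bounds[OF \<epsilon>] by blast
  have "quadratic_energy.weight (lebesgue_on \<Omega>) m K (\<lambda>x. mu \<phi> (c x))" if c: "c \<in> LPhi_eps \<phi> \<Omega> \<epsilon>" for c
  proof -
    have cm: "c \<in> borel_measurable (lebesgue_on \<Omega>)" and ae: "AE x in lebesgue_on \<Omega>. \<epsilon> \<le> c x \<and> c x \<le> 1 / \<epsilon>"
      using c by (auto simp: LPhi_eps_def LPhi_def)
    have "(\<lambda>x. mu \<phi> (c x)) \<in> borel_measurable (lebesgue_on \<Omega>)"
      using \<Omega> \<epsilon> by (intro superposition_measurable[OF _ cm ae eps_le_inverse] mu_continuous) auto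
    moreover have "AE x in lebesgue_on \<Omega>. m \<le> mu \<phi> (c x) \<and> mu \<phi> (c x) \<le> K"
      using ae by eventually_elim (use mK(2) in auto)
    ultimately show ?thesis
      unfolding quadratic_energy.weight_def[OF Q] using mK(1) by blast
  qed
  then show ?thesis by blast
qed

lemma J_c_tendsto:
  fixes \<Omega> :: "(real ^ 'n::finite) set"
  assumes \<Omega>: "\<Omega> \<in> lmeasurable" and \<epsilon>: "0 < \<epsilon>" "\<epsilon> < 1"
    and c: "c \<in> LPhi_eps \<phi> \<Omega> \<epsilon>" and cn: "\<And>n::nat. cn n \<in> LPhi_eps \<phi> \<Omega> \<epsilon>"
    and lim: "AE x in lebesgue_on \<Omega>. (\<lambda>n. cn n x) \<longlonglongrightarrow> c x"
  shows "(\<lambda>n. J_c \<phi> \<Omega> (cn n)) \<longlonglongrightarrow> J_c \<phi> \<Omega> c"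
  unfolding J_c_def
proof (rule superposition_integral_tendsto[OF \<Omega> _ _ _ _ eps_le_inverse[OF \<epsilon>] _ lim])
  show "continuous_on {\<epsilon>..1/\<epsilon>} (\<lambda>s. Phi \<phi> s - 1/2 * mu \<phi> s * s)"
    using \<epsilon> by (intro continuous_intros mu_continuous Phi_continuous) auto
qed (use c cn in \<open>auto simp: LPhi_eps_def LPhi_def\<close>)

text \<open>
  The common argument for the scalar and the incompressible problem. Lower semicontinuity is checked
  along sequences, which is enough in a topology induced by a pseudometric; passing to a subsequence
  that converges almost everywhere does no harm, as the energies of all members are at most \<open>a\<close>.
  The sign \<open>omega \<phi>\<close> decides which of the two semicontinuity properties of \<open>min_energy\<close> is used.
\<close>

theorem energy_lower_semicontinuous:
  fixes \<Omega> :: "(real ^ 'n::finite) set" and D :: "(real ^ 'n \<Rightarrow> 'v::real_vector) \<Rightarrow> real ^ 'n \<Rightarrow> 'b::euclidean_space"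
  assumes Q: "quadratic_energy (lebesgue_on \<Omega>) V D G"
    and J: "\<And>c. J c = quadratic_energy.min_energy (lebesgue_on \<Omega>) V D G (\<lambda>x. mu \<phi> (c x))"
    and coercive: "\<And>u. u \<in> V \<Longrightarrow> (G u)\<^sup>2 \<le> C * (LINT x|lebesgue_on \<Omega>. (norm (D u x))\<^sup>2)"
    and \<Omega>: "\<Omega> \<in> lmeasurable" and \<epsilon>: "0 < \<epsilon>" "\<epsilon> < 1"
  shows "\<forall>c. E_eps \<phi> \<Omega> \<epsilon> J c \<noteq> - \<infinity>"
    and "lower_semicontinuous_map (dist_topology (LPhi \<phi> \<Omega>) (dist_Phi \<phi> \<Omega>)) (E_eps \<phi> \<Omega> \<epsilon> J)"
proof -
  interpret quadratic_energy "lebesgue_on \<Omega>" V D G by (rule Q)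
  obtain m K where w: "\<And>c. c \<in> LPhi_eps \<phi> \<Omega> \<epsilon> \<Longrightarrow> weight m K (\<lambda>x. mu \<phi> (c x))"
    using mu_weight[OF Q \<Omega> \<epsilon>] by blast
  have J_upper: "J c \<noteq> \<infinity>" for c
    using min_energy_le_zero[of "\<lambda>x. mu \<phi> (c x)"] by (auto simp: J)
  have J_lower: "J c \<noteq> - \<infinity>" if "c \<in> LPhi_eps \<phi> \<Omega> \<epsilon>" for c
    unfolding J by (rule min_energy_gt_minus_infinity[OF w[OF that] coercive])
  have omega: "omega \<phi> = 1 \<or> omega \<phi> = - 1" using omega_cases by auto
  have E: "E_eps \<phi> \<Omega> \<epsilon> J c = (if omega \<phi> = 1 then ereal (- J_c \<phi> \<Omega> c) - J c else ereal (J_c \<phi> \<Omega> c) + J c)"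
    if "c \<in> LPhi_eps \<phi> \<Omega> \<epsilon>" for c
    using omega that by (cases "J c") (auto simp: E_eps_def)
  have not_minf: "E_eps \<phi> \<Omega> \<epsilon> J c \<noteq> - \<infinity>" for c
  proof (cases "c \<in> LPhi_eps \<phi> \<Omega> \<epsilon>")
    case True
    then show ?thesis using J_upper[of c] J_lower[OF True] by (cases "J c") (auto simp: E)
  qed (simp add: E_eps_def)
  then show "\<forall>c. E_eps \<phi> \<Omega> \<epsilon> J c \<noteq> - \<infinity>" by blast
  have seq: "E_eps \<phi> \<Omega> \<epsilon> J c \<le> ereal a"
    if c: "c \<in> LPhi_eps \<phi> \<Omega> \<epsilon>" and cn: "\<And>n::nat. cn n \<in> LPhi_eps \<phi> \<Omega> \<epsilon>"
      and lim: "AE x in lebesgue_on \<Omega>. (\<lambda>n. cn n x) \<longlonglongrightarrow> c x"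
      and le: "\<And>n. E_eps \<phi> \<Omega> \<epsilon> J (cn n) \<le> ereal a" for c cn a
  proof -
    have Jc: "(\<lambda>n. J_c \<phi> \<Omega> (cn n)) \<longlonglongrightarrow> J_c \<phi> \<Omega> c"
      by (rule J_c_tendsto[OF \<Omega> \<epsilon> c cn lim])
    have "AE x in lebesgue_on \<Omega>. \<epsilon> \<le> c x \<and> c x \<le> 1 / \<epsilon>" "AE x in lebesgue_on \<Omega>. \<forall>n. \<epsilon> \<le> cn n x \<and> cn n x \<le> 1 / \<epsilon>"
      using c cn by (auto simp: LPhi_eps_def AE_all_countable)
    with lim have mulim: "AE x in lebesgue_on \<Omega>. (\<lambda>n. mu \<phi> (cn n x)) \<longlonglongrightarrow> mu \<phi> (c x)"
    proof eventually_elim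
      case (elim x)
      have "continuous_on {\<epsilon>..1/\<epsilon>} (mu \<phi>)" using \<epsilon> by (intro mu_continuous) auto
      then show ?case by (rule continuous_on_tendsto_compose) (use elim in auto)
    qed
    show ?thesis
    proof (cases "omega \<phi> = 1")
      case True
      have "ereal (- a - J_c \<phi> \<Omega> (cn n)) \<le> J (cn n)" for n
        using le[of n] True by (cases "J (cn n)") (auto simp: E[OF cn])
      then have "ereal (- a - J_c \<phi> \<Omega> c) \<le> J c"
        unfolding J
        by (rule min_energy_upper_semicontinuous[OF w[OF c] w[OF cn] mulim tendsto_diff[OF tendsto_const Jc]])
      then show ?thesis using True by (cases "J c") (auto simp: E[OF c])
    next
      case False
      have "J (cn n) \<le> ereal (a - J_c \<phi> \<Omega> (cn n))" for n
        using le[of n] False by (cases "J (cn n)") (auto simp: E[OF cn])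
      then have "J c \<le> ereal (a - J_c \<phi> \<Omega> c)"
        unfolding J
        by (rule min_energy_lower_semicontinuous[OF w[OF c] w[OF cn] mulim tendsto_diff[OF tendsto_const Jc]])
      then show ?thesis using False by (cases "J c") (auto simp: E[OF c])
    qed
  qed
  show "lower_semicontinuous_map (dist_topology (LPhi \<phi> \<Omega>) (dist_Phi \<phi> \<Omega>)) (E_eps \<phi> \<Omega> \<epsilon> J)"
    unfolding lower_semicontinuous_map_def openin_dist_topology topspace_dist_topology
  proof (intro allI conjI ballI)
    fix a c assume c: "c \<in> {c \<in> LPhi \<phi> \<Omega>. a < E_eps \<phi> \<Omega> \<epsilon> J c}"
    show "\<exists>r>0. {y \<in> LPhi \<phi> \<Omega>. dist_Phi \<phi> \<Omega> c y < r} \<subseteq> {c \<in> LPhi \<phi> \<Omega>. a < E_eps \<phi> \<Omega> \<epsilon> J c}"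
    proof (rule ccontr)
      assume neg: "\<not> ?thesis"
      have "\<exists>y. y \<in> LPhi \<phi> \<Omega> \<and> dist_Phi \<phi> \<Omega> c y < inverse (real (Suc n)) \<and> E_eps \<phi> \<Omega> \<epsilon> J y \<le> a" for n
      proof -
        have "0 < inverse (real (Suc n))" by simp
        with neg have "\<not> {y \<in> LPhi \<phi> \<Omega>. dist_Phi \<phi> \<Omega> c y < inverse (real (Suc n))} \<subseteq> {c \<in> LPhi \<phi> \<Omega>. a < E_eps \<phi> \<Omega> \<epsilon> J c}"
          by blast
        then show ?thesis by (auto simp: not_less)
      qed
      then obtain y where y: "\<And>n. y n \<in> LPhi \<phi> \<Omega>" "\<And>n. dist_Phi \<phi> \<Omega> c (y n) < inverse (real (Suc n))"
        "\<And>n. E_eps \<phi> \<Omega> \<epsilon> J (y n) \<le> a" by metis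
      have "a \<noteq> \<infinity>" using c by auto
      moreover have "a \<noteq> - \<infinity>" using y(3)[of 0] not_minf[of "y 0"] by auto
      ultimately obtain b where b: "a = ereal b" by (cases a) auto
      have ye: "y n \<in> LPhi_eps \<phi> \<Omega> \<epsilon>" for n
        using y(3)[of n] b by (auto simp: E_eps_def split: if_splits)
      have "(\<lambda>n. dist_Phi \<phi> \<Omega> c (y n)) \<longlonglongrightarrow> 0"
      proof (rule tendsto_sandwich[OF _ _ tendsto_const LIMSEQ_inverse_real_of_nat])
        show "\<forall>\<^sub>F n in sequentially. 0 \<le> dist_Phi \<phi> \<Omega> c (y n)"
          by (simp add: dist_Phi_def L2_norm_def)
        show "\<forall>\<^sub>F n in sequentially. dist_Phi \<phi> \<Omega> c (y n) \<le> inverse (real (Suc n))"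
          using y(2) by (simp add: less_imp_le)
      qed
      then obtain r where r: "c \<in> LPhi_eps \<phi> \<Omega> \<epsilon>" "AE x in lebesgue_on \<Omega>. (\<lambda>n. y (r n) x) \<longlonglongrightarrow> c x"
        using dist_Phi_AE_subseq[of c \<Omega> y \<epsilon>] c ye by blast
      have "E_eps \<phi> \<Omega> \<epsilon> J c \<le> ereal b"
        using y(3) b by (intro seq[OF r(1) ye r(2)]) simp
      then show False using c b leD by blast
    qed
  qed blast
qed

end

lemma H10_quadratic_energy:
  fixes \<Omega> :: "(real ^ 'n::finite) set" and G :: "(real ^ 'n \<Rightarrow> 'b::euclidean_space) \<Rightarrow> real"
  assumes \<Omega>: "open \<Omega>" and G: "G \<in> dual_space (H10 \<Omega>) (H1_norm \<Omega>)"
  shows "quadratic_energy (lebesgue_on \<Omega>) (H10 \<Omega>) (wgrad \<Omega>) G"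
proof
  show "(\<lambda>x. 0) \<in> H10 \<Omega>" by (rule H10_zero[OF \<Omega>])
  fix u v :: "real ^ 'n \<Rightarrow> 'b" and t :: real assume u: "u \<in> H10 \<Omega>"
  show "wgrad \<Omega> u \<in> borel_measurable (lebesgue_on \<Omega>)" "integrable (lebesgue_on \<Omega>) (\<lambda>x. (norm (wgrad \<Omega> u x))\<^sup>2)"
    using L2D[OF H1D(3)[OF \<Omega> H10_H1[OF u]]] by auto
  assume v: "v \<in> H10 \<Omega>"
  show "(\<lambda>x. u x + t *\<^sub>R v x) \<in> H10 \<Omega>" by (rule H10_lin[OF \<Omega> u v])
  show "AE x in lebesgue_on \<Omega>. wgrad \<Omega> (\<lambda>x. u x + t *\<^sub>R v x) x = wgrad \<Omega> u x + t *\<^sub>R wgrad \<Omega> v x"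
    by (rule H1_lin(2)[OF \<Omega> H10_H1[OF u] H10_H1[OF v]])
  have "(\<lambda>x. t *\<^sub>R v x) \<in> H10 \<Omega>" using H10_lin[OF \<Omega> H10_zero[OF \<Omega>] v, of t] by simp
  then show "G (\<lambda>x. u x + t *\<^sub>R v x) = G u + t * G v"
    using G u v unfolding dual_space_def by simp
qed

lemma H10_div_quadratic_energy:
  fixes \<Omega> :: "(real ^ 'n::finite) set" and G :: "(real ^ 'n \<Rightarrow> real ^ 'n) \<Rightarrow> real"
  assumes \<Omega>: "open \<Omega>" and G: "G \<in> dual_space (H10 \<Omega>) (H1_norm \<Omega>)"
  shows "quadratic_energy (lebesgue_on \<Omega>) (H10_div \<Omega>) (sym_grad \<Omega>) G"
proof -
  interpret H10: quadratic_energy "lebesgue_on \<Omega>" "H10 \<Omega>" "wgrad \<Omega>" G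
    by (rule H10_quadratic_energy[OF assms])
  show ?thesis
  proof
    show "(\<lambda>x. 0) \<in> H10_div \<Omega>" by (rule H10_div_zero[OF \<Omega>])
    fix u v :: "real ^ 'n \<Rightarrow> real ^ 'n" and t :: real assume u: "u \<in> H10_div \<Omega>"
    then have u': "u \<in> H10 \<Omega>" by (simp add: H10_div_def)
    show "sym_grad \<Omega> u \<in> borel_measurable (lebesgue_on \<Omega>)" "integrable (lebesgue_on \<Omega>) (\<lambda>x. (norm (sym_grad \<Omega> u x))\<^sup>2)"
      using L2D[OF sym_grad_L2[OF \<Omega> H10_H1[OF u']]] by auto
    assume v: "v \<in> H10_div \<Omega>"
    then have v': "v \<in> H10 \<Omega>" by (simp add: H10_div_def)
    show "(\<lambda>x. u x + t *\<^sub>R v x) \<in> H10_div \<Omega>" by (rule H10_div_lin[OF \<Omega> u v])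
    show "AE x in lebesgue_on \<Omega>. sym_grad \<Omega> (\<lambda>x. u x + t *\<^sub>R v x) x = sym_grad \<Omega> u x + t *\<^sub>R sym_grad \<Omega> v x"
      by (rule sym_grad_lin[OF \<Omega> H10_H1[OF u'] H10_H1[OF v']])
    show "G (\<lambda>x. u x + t *\<^sub>R v x) = G u + t * G v" by (rule H10.G_lin[OF u' v'])
  qed
qed

lemma dual_H10_gradient_bound:
  fixes \<Omega> :: "(real ^ 'n::finite) set" and G :: "(real ^ 'n \<Rightarrow> 'b::euclidean_space) \<Rightarrow> real"
  assumes \<Omega>: "open \<Omega>" "bounded \<Omega>" and G: "G \<in> dual_space (H10 \<Omega>) (H1_norm \<Omega>)"
  shows "\<exists>C\<ge>0. \<forall>u\<in>H10 \<Omega>. (G u)\<^sup>2 \<le> C * (L2_norm \<Omega> (wgrad \<Omega> u))\<^sup>2"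
proof -
  obtain C where C: "\<And>u. u \<in> H10 \<Omega> \<Longrightarrow> \<bar>G u\<bar> \<le> C * H1_norm \<Omega> u"
    using G unfolding dual_space_def by blast
  obtain R where R: "\<And>x. x \<in> \<Omega> \<Longrightarrow> norm x \<le> R" using \<Omega>(2) unfolding bounded_iff by blast
  have "(G u)\<^sup>2 \<le> C\<^sup>2 * (16 * R\<^sup>2 + 1) * (L2_norm \<Omega> (wgrad \<Omega> u))\<^sup>2" if u: "u \<in> H10 \<Omega>" for u
  proof -
    have "(G u)\<^sup>2 \<le> (C * H1_norm \<Omega> u)\<^sup>2" using power_mono[OF C[OF u] abs_ge_zero, of 2] by simp
    also have "\<dots> = C\<^sup>2 * ((L2_norm \<Omega> u)\<^sup>2 + (L2_norm \<Omega> (wgrad \<Omega> u))\<^sup>2)"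
      by (simp add: power_mult_distrib H1_norm_square)
    also have "\<dots> \<le> C\<^sup>2 * (16 * R\<^sup>2 * (L2_norm \<Omega> (wgrad \<Omega> u))\<^sup>2 + (L2_norm \<Omega> (wgrad \<Omega> u))\<^sup>2)"
      using Poincare[OF \<Omega>(1) R u] by (intro mult_left_mono) auto
    finally show ?thesis by (simp add: algebra_simps)
  qed
  then show ?thesis by (intro exI[of _ "C\<^sup>2 * (16 * R\<^sup>2 + 1)"]) auto
qed

theorem theorem3p6:
  fixes \<phi> :: "real \<Rightarrow> real" and \<Omega> :: "(real ^ 'n::finite) set"
  assumes "CARD('n) = 2 \<or> CARD('n) = 3"
    and "open \<Omega>" and "bounded \<Omega>" and "connected \<Omega>" and "\<Omega> \<noteq> {}"
    and "standing_assumptions \<phi>"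
    and "(0 < S_minus \<phi> \<and> S_minus \<phi> \<le> S_plus \<phi> \<and> S_plus \<phi> < 1) \<or>
         (1 < S_minus \<phi> \<and> S_minus \<phi> \<le> S_plus \<phi> \<and> S_plus \<phi> < \<infinity>)"
  shows "(\<forall>F G :: (real ^ 'n \<Rightarrow> real) \<Rightarrow> real. \<forall>\<epsilon>::real.
            F \<in> dual_space (W10 \<phi> \<Omega>) (W1_norm \<phi> \<Omega>) \<longrightarrow> is_H10_extension \<phi> \<Omega> F G \<longrightarrow>
            0 < \<epsilon> \<longrightarrow> \<epsilon> < 1 \<longrightarrow>
            (\<forall>c \<in> LPhi \<phi> \<Omega>. E_eps \<phi> \<Omega> \<epsilon> (J_scalar \<phi> \<Omega> G) c \<noteq> - \<infinity>) \<and>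
            lower_semicontinuous_map (dist_topology (LPhi \<phi> \<Omega>) (dist_Phi \<phi> \<Omega>))
              (E_eps \<phi> \<Omega> \<epsilon> (J_scalar \<phi> \<Omega> G))) \<and>
         (\<forall>F G :: (real ^ 'n \<Rightarrow> real ^ 'n) \<Rightarrow> real. \<forall>\<epsilon>::real.
            F \<in> dual_space (W10 \<phi> \<Omega>) (W1_norm \<phi> \<Omega>) \<longrightarrow> is_H10_extension \<phi> \<Omega> F G \<longrightarrow>
            0 < \<epsilon> \<longrightarrow> \<epsilon> < 1 \<longrightarrow>
            (\<forall>c \<in> LPhi \<phi> \<Omega>. E_eps \<phi> \<Omega> \<epsilon> (J_incompressible \<phi> \<Omega> G) c \<noteq> - \<infinity>) \<and>
            lower_semicontinuous_map (dist_topology (LPhi \<phi> \<Omega>) (dist_Phi \<phi> \<Omega>))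
              (E_eps \<phi> \<Omega> \<epsilon> (J_incompressible \<phi> \<Omega> G)))"
proof -
  interpret growth_function \<phi> using assms(6,7) by unfold_locales
  have \<Omega>: "\<Omega> \<in> lmeasurable" using assms(2,3) by (rule lmeasurable_open[rotated])
  have scalar: "(\<forall>c. E_eps \<phi> \<Omega> \<epsilon> (J_scalar \<phi> \<Omega> G) c \<noteq> - \<infinity>) \<and>
      lower_semicontinuous_map (dist_topology (LPhi \<phi> \<Omega>) (dist_Phi \<phi> \<Omega>)) (E_eps \<phi> \<Omega> \<epsilon> (J_scalar \<phi> \<Omega> G))"
    if G: "is_H10_extension \<phi> \<Omega> F G" and \<epsilon>: "0 < \<epsilon>" "\<epsilon> < 1" for F G :: "(real ^ 'n \<Rightarrow> real) \<Rightarrow> real" and \<epsilon>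
  proof -
    have G': "G \<in> dual_space (H10 \<Omega>) (H1_norm \<Omega>)" using G by (simp add: is_H10_extension_def)
    note Q = H10_quadratic_energy[OF assms(2) G']
    obtain C where C: "\<And>u. u \<in> H10 \<Omega> \<Longrightarrow> (G u)\<^sup>2 \<le> C * (L2_norm \<Omega> (wgrad \<Omega> u))\<^sup>2"
      using dual_H10_gradient_bound[OF assms(2,3) G'] by blast
    have J: "J_scalar \<phi> \<Omega> G c = quadratic_energy.min_energy (lebesgue_on \<Omega>) (H10 \<Omega>) (wgrad \<Omega>) G (\<lambda>x. mu \<phi> (c x))" for c
      by (simp add: J_scalar_def quadratic_energy.min_energy_def[OF Q] quadratic_energy.energy_def[OF Q])
    show ?thesis
      using energy_lower_semicontinuous[OF Q J C[unfolded L2_norm_square] \<Omega> \<epsilon>] by blast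
  qed
  have incompressible: "(\<forall>c. E_eps \<phi> \<Omega> \<epsilon> (J_incompressible \<phi> \<Omega> G) c \<noteq> - \<infinity>) \<and>
      lower_semicontinuous_map (dist_topology (LPhi \<phi> \<Omega>) (dist_Phi \<phi> \<Omega>)) (E_eps \<phi> \<Omega> \<epsilon> (J_incompressible \<phi> \<Omega> G))"
    if G: "is_H10_extension \<phi> \<Omega> F G" and \<epsilon>: "0 < \<epsilon>" "\<epsilon> < 1" for F G :: "(real ^ 'n \<Rightarrow> real ^ 'n) \<Rightarrow> real" and \<epsilon>
  proof -
    have G': "G \<in> dual_space (H10 \<Omega>) (H1_norm \<Omega>)" using G by (simp add: is_H10_extension_def)
    note Q = H10_div_quadratic_energy[OF assms(2) G']
    obtain C where C0: "C \<ge> 0" and C: "\<And>u. u \<in> H10 \<Omega> \<Longrightarrow> (G u)\<^sup>2 \<le> C * (L2_norm \<Omega> (wgrad \<Omega> u))\<^sup>2"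
      using dual_H10_gradient_bound[OF assms(2,3) G'] by blast
    have C': "(G u)\<^sup>2 \<le> C * 8 * (L2_norm \<Omega> (sym_grad \<Omega> u))\<^sup>2" if "u \<in> H10_div \<Omega>" for u
    proof -
      have u: "u \<in> H10 \<Omega>" using that by (simp add: H10_div_def)
      show ?thesis using C[OF u] mult_left_mono[OF Korn[OF assms(2) u] C0] by simp
    qed
    have J: "J_incompressible \<phi> \<Omega> G c = quadratic_energy.min_energy (lebesgue_on \<Omega>) (H10_div \<Omega>) (sym_grad \<Omega>) G (\<lambda>x. mu \<phi> (c x))" for c
      by (simp add: J_incompressible_def quadratic_energy.min_energy_def[OF Q] quadratic_energy.energy_def[OF Q])
    show ?thesis
      using energy_lower_semicontinuous[OF Q J C'[unfolded L2_norm_square] \<Omega> \<epsilon>] by blast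
  qed
  show ?thesis using scalar incompressible by blast
qed

end
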